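(* Let $\omega\in C^2(\mathbb{S}^2)$ be real-valued. Then the empirical spectral measures $\lambda^N_{T_N(\omega)}$ converge weakly to the level-set measure $\lambda_\omega$ as $N\to\infty$, i.e. $\int_{\mathbb{R}}f\,d\lambda^N_{T_N(\omega)}\to\int_{\mathbb{R}}f\,d\lambda_\omega$ for every bounded continuous $f\colon\mathbb{R}\to\mathbb{R}$.
   Context: Measures: For $\omega\in L^\infty(\mathbb{S}^2)$ the level-set measure $\lambda_\omega$ is the positive measure on $\mathbb{R}$ given by $\lambda_\omega(I)=\mu(\{x\in\mathbb{S}^2\mid\omega(x)\in I\})$, where $\mu$ is the standard area measure on the unit sphere (total mass $4\pi$); equivalently $\int f\,d\lambda_\omega=\int_{\mathbb{S}^2}f(\omega)\,\mu$. For $W\in\mathfrak u(N)$ with eigenvalues $\mathrm i\lambda_1,\dots,\mathrm i\lambda_N$ (with multiplicity), the empirical spectral measure is $\lambda^N_W=\frac{4\pi}{N}\sum_{k=1}^N\delta_{\lambda_k}$. Geometry: $\mathbb{S}^2\subset\mathbb{R}^3$ is the unit sphere with Cartesian coordinate functions $x_1,x_2,x_3$. $J$ denotes rotation of tangent vectors by $\pi/2$ in the positive direction, $\nabla^\perp=-J\nabla$, and $\{f,g\}=\nabla f\cdot\nabla^\perp g$. Matrices: For $N\ge2$ put $\ell'=(N-1)/2$ and $\hbar=\hbar_N=2/\sqrt{N^2-1}$. Index rows and columns of $N\times N$ matrices by $w=-\ell',-\ell'+1,\dots,\ell'$ (increasing) and set $f(w)=\sqrt{\ell'(\ell'+1)-w(w+1)}$.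 Let $S_3=\mathrm{diag}(-\mathrm i\ell',\dots,\mathrm i\ell')$, and let $S_1,S_2$ be the matrices whose only nonzero entries are $(S_1)_{w,w+1}=(S_1)_{w+1,w}=\frac{\mathrm i}{2}f(w)$, $(S_2)_{w,w+1}=\frac12 f(w)$, $(S_2)_{w+1,w}=-\frac12 f(w)$, for $w=-\ell',\dots,\ell'-1$. Put $X_\alpha=\hbar S_\alpha\in\mathfrak{u}(N)$. The Hoppe--Yau Laplacian is $\Delta_N=\frac1{\hbar^2}\sum_{\alpha=1}^3[X_\alpha,[X_\alpha,\cdot\,]]$ on $\mathfrak u(N)$; $\mathfrak u(N)=V_0\oplus\dots\oplus V_{N-1}$, where $V_\ell$ is the eigenspace of $\Delta_N$ with eigenvalue $-\ell(\ell+1)$, $\dim V_\ell=2\ell+1$. Quantization map: $\mathfrak u(N)$ carries the inner product $\langle A,B\rangle=-\frac{4\pi}{N}\operatorname{tr}(AB)$. Let $\mathcal H_\ell$ be the space of real spherical harmonics of degree $\ell$. $T_N\colon L^2(\mathbb{S}^2)\to\mathfrak u(N)$ is the linear map that vanishes on $\mathcal H_\ell$ for $\ell\ge N$, maps $\mathcal H_\ell$ isometrically onto $V_\ell$ for $\ell\le N-1$, satisfies $T_N\{x_\alpha,\omega\}=\frac1\hbar[X_\alpha,T_N\omega]$ for $\alpha=1,2,3$, and is normalized (signs) so that for each $\ell\le N-1$ it sends the zonal function $p_\ell(x_3)$ ($p_\ell$ the Legendre polynomial) to $\mathrm i$ times a real diagonal matrix whose last entry is positive; in particular $T_N1=\mathrm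 iI$ and $T_Nx_\alpha=X_\alpha$. *)

theory Defs
  imports
    "HOL-Analysis.Analysis"
    "Jordan_Normal_Form.Schur_Decomposition"
begin

no_notation Matrix.vec_index (infixl "$" 100)

text \<open>
  Functions on the sphere are represented by functions on the ambient space of which only the
  values on the unit sphere matter.
\<close>

abbreviation S2 :: "(real^3) set" where
  "S2 \<equiv> sphere 0 1"

definition spherical_coords :: "real \<times> real \<Rightarrow> real^3" where
  "spherical_coords = (\<lambda>(\<theta>, \<phi>). vector [sin \<theta> * cos \<phi>, sin \<theta> * sin \<phi>, cos \<theta>])"

text \<open>The area element of the parametrization by polar angle and azimuth is
  \<open>sin \<theta> d\<theta> d\<phi>\<close>. The underlying space of the measure is the sphere itself.\<close>

definition sphere_area :: "(real^3) measure" where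
  "sphere_area =
     distr (density lborel
              (\<lambda>(\<theta>, \<phi>). ennreal (indicator ({0..pi} \<times> {0..2*pi}) (\<theta>, \<phi>) * sin \<theta>)))
       (restrict_space borel S2) spherical_coords"

definition sphere_L2 :: "(real^3 \<Rightarrow> real) set" where
  "sphere_L2 = {f \<in> borel_measurable sphere_area. integrable sphere_area (\<lambda>x. (f x)\<^sup>2)}"

definition L2_norm :: "(real^3 \<Rightarrow> real) \<Rightarrow> real" where
  "L2_norm f = sqrt (\<integral>x. (f x)\<^sup>2 \<partial>sphere_area)"

primrec Ck_on :: "nat \<Rightarrow> (real^3) set \<Rightarrow> (real^3 \<Rightarrow> real) \<Rightarrow> bool" where
  "Ck_on 0 U f \<longleftrightarrow> continuous_on U f"
| "Ck_on (Suc k) U f \<longleftrightarrow> f differentiable_on U \<and>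
     (\<forall>i. Ck_on k U (\<lambda>x. frechet_derivative f (at x) (axis i 1)))"

definition Ck_sphere :: "nat \<Rightarrow> (real^3 \<Rightarrow> real) \<Rightarrow> bool" where
  "Ck_sphere k f \<longleftrightarrow> (\<exists>U g. open U \<and> S2 \<subseteq> U \<and> Ck_on k U g \<and> (\<forall>x\<in>S2. f x = g x))"

text \<open>The tangent vector that represents the differential of \<open>f\<close> along the sphere: the derivative
  within the sphere only determines a linear form on the tangent space, whence the first conjunct.\<close>

definition sphere_grad :: "(real^3 \<Rightarrow> real) \<Rightarrow> real^3 \<Rightarrow> real^3" where
  "sphere_grad f x =
     (THE v. inner v x = 0 \<and> (f has_derivative (\<lambda>h. inner v h)) (at x within S2))"

text \<open>With the sphere oriented by the outward normal, \<open>J v = x \<times> v\<close> for \<open>v\<close> tangent at \<open>x\<close>.\<close>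

definition sphere_perp_grad :: "(real^3 \<Rightarrow> real) \<Rightarrow> real^3 \<Rightarrow> real^3" where
  "sphere_perp_grad f x = - cross3 x (sphere_grad f x)"

definition poisson_bracket :: "(real^3 \<Rightarrow> real) \<Rightarrow> (real^3 \<Rightarrow> real) \<Rightarrow> real^3 \<Rightarrow> real" where
  "poisson_bracket f g x = inner (sphere_grad f x) (sphere_perp_grad g x)"

definition laplacian :: "(real^3 \<Rightarrow> real) \<Rightarrow> real^3 \<Rightarrow> real" where
  "laplacian f x = (\<Sum>i\<in>UNIV. (deriv ^^ 2) (\<lambda>t. f (x + t *\<^sub>R axis i 1)) 0)"

definition spherical_harmonics :: "nat \<Rightarrow> (real^3 \<Rightarrow> real) set" where
  "spherical_harmonics l = {Y. \<exists>p. real_polynomial_function p \<and>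
     (\<forall>c x. p (c *\<^sub>R x) = c ^ l * p x) \<and> (\<forall>x. laplacian p x = 0) \<and> (\<forall>x\<in>S2. Y x = p x)}"

text \<open>Rodrigues' formula.\<close>

definition legendre_poly :: "nat \<Rightarrow> real poly" where
  "legendre_poly l = Polynomial.smult (1 / (2 ^ l * fact l)) ((pderiv ^^ l) ([:-1, 0, 1:] ^ l))"

definition level_set_measure :: "(real^3 \<Rightarrow> real) \<Rightarrow> real measure" where
  "level_set_measure \<omega> = distr sphere_area borel \<omega>"

definition skew_herm :: "nat \<Rightarrow> complex mat set" where
  "skew_herm N = {A \<in> carrier_mat N N. mat_adjoint A = - A}"

definition skew_inner :: "nat \<Rightarrow> complex mat \<Rightarrow> complex mat \<Rightarrow> real" where
  "skew_inner N A B = - (4 * pi / real N) * Re (\<Sum>i<N. (A * B) $$ (i, i))"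

definition skew_norm :: "nat \<Rightarrow> complex mat \<Rightarrow> real" where
  "skew_norm N A = sqrt (skew_inner N A A)"

definition commutator :: "complex mat \<Rightarrow> complex mat \<Rightarrow> complex mat" where
  "commutator A B = A * B - B * A"

definition hbar :: "nat \<Rightarrow> real" where
  "hbar N = 2 / sqrt ((real N)\<^sup>2 - 1)"

text \<open>Row and column number \<open>j < N\<close> carries the weight \<open>w = j - (N - 1) / 2\<close>.\<close>

definition weight :: "nat \<Rightarrow> nat \<Rightarrow> real" where
  "weight N j = real j - (real N - 1) / 2"

definition ladder_coeff :: "nat \<Rightarrow> real \<Rightarrow> real" where
  "ladder_coeff N w =
     (let l = (real N - 1) / 2 in sqrt (l * (l + 1) - w * (w + 1)))"

definition spin1 :: "nat \<Rightarrow> complex mat" where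
  "spin1 N = Matrix.mat N N (\<lambda>(j, k).
     if k = Suc j then \<i> / 2 * of_real (ladder_coeff N (weight N j))
     else if j = Suc k then \<i> / 2 * of_real (ladder_coeff N (weight N k))
     else 0)"

definition spin2 :: "nat \<Rightarrow> complex mat" where
  "spin2 N = Matrix.mat N N (\<lambda>(j, k).
     if k = Suc j then 1 / 2 * of_real (ladder_coeff N (weight N j))
     else if j = Suc k then - (1 / 2) * of_real (ladder_coeff N (weight N k))
     else 0)"

definition spin3 :: "nat \<Rightarrow> complex mat" where
  "spin3 N = mat_diag N (\<lambda>j. \<i> * of_real (weight N j))"

definition quant_coord :: "nat \<Rightarrow> 3 \<Rightarrow> complex mat" where
  "quant_coord N \<alpha> = of_real (hbar N) \<cdot>\<^sub>m
     (if \<alpha> = 1 then spin1 N else if \<alpha> = 2 then spin2 N else spin3 N)"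

definition hoppe_yau :: "nat \<Rightarrow> complex mat \<Rightarrow> complex mat" where
  "hoppe_yau N A = of_real (1 / (hbar N)\<^sup>2) \<cdot>\<^sub>m
     (commutator (quant_coord N 1) (commutator (quant_coord N 1) A)
      + commutator (quant_coord N 2) (commutator (quant_coord N 2) A)
      + commutator (quant_coord N 3) (commutator (quant_coord N 3) A))"

definition hoppe_yau_eigenspace :: "nat \<Rightarrow> nat \<Rightarrow> complex mat set" where
  "hoppe_yau_eigenspace N l =
     {A \<in> skew_herm N. hoppe_yau N A = of_real (- (real l * (real l + 1))) \<cdot>\<^sub>m A}"

text \<open>Eigenvalues \<open>\<i> r\<close> are counted with their multiplicity as roots of the characteristic
  polynomial.\<close>

definition empirical_spectral_measure :: "complex mat \<Rightarrow> real measure" where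
  "empirical_spectral_measure W =
     distr (point_measure {r. eigenvalue W (\<i> * of_real r)}
              (\<lambda>r. ennreal (4 * pi / real (dim_row W)
                             * real (Polynomial.order (\<i> * of_real r) (char_poly W)))))
       borel (\<lambda>r. r)"

text \<open>Vanishing on each single space of harmonics of degree at least \<open>N\<close> determines the map
  on the whole of \<open>L\<^sup>2\<close> only together with continuity, which is therefore demanded explicitly; it also
  makes \<open>T f\<close> depend only on the almost-everywhere class of \<open>f\<close>. The bracket relation is
  demanded where the bracket is classically defined, that is, for continuously differentiable
  functions.\<close>

definition is_quantization :: "nat \<Rightarrow> ((real^3 \<Rightarrow> real) \<Rightarrow> complex mat) \<Rightarrow> bool" where
  "is_quantization N T \<longleftrightarrow>
     (\<forall>f\<in>sphere_L2. T f \<in> skew_herm N) \<and>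
     (\<forall>f\<in>sphere_L2. \<forall>g\<in>sphere_L2. \<forall>a b :: real.
        T (\<lambda>x. a * f x + b * g x) = of_real a \<cdot>\<^sub>m T f + of_real b \<cdot>\<^sub>m T g) \<and>
     (\<exists>C. \<forall>f\<in>sphere_L2. skew_norm N (T f) \<le> C * L2_norm f) \<and>
     (\<forall>l\<ge>N. \<forall>f\<in>spherical_harmonics l. T f = 0\<^sub>m N N) \<and>
     (\<forall>l<N. T ` spherical_harmonics l = hoppe_yau_eigenspace N l \<and>
        (\<forall>f\<in>spherical_harmonics l. skew_norm N (T f) = L2_norm f)) \<and>
     (\<forall>\<alpha> f. Ck_sphere 1 f \<longrightarrow>
        T (poisson_bracket (\<lambda>x. x $ \<alpha>) f)
          = of_real (1 / hbar N) \<cdot>\<^sub>m commutator (quant_coord N \<alpha>) (T f)) \<and>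
     (\<forall>l<N. \<exists>d :: nat \<Rightarrow> real.
        T (\<lambda>x. poly (legendre_poly l) (x $ 3)) = mat_diag N (\<lambda>j. \<i> * of_real (d j)) \<and>
        d (N - 1) > 0)"

end

theory Submission
  imports Defs "HOL-Real_Asymp.Real_Asymp"
begin

text \<open>
  The matrices \<open>-\<i> X\<^sub>\<alpha>\<close> are Hermitian, their squares sum to the
  identity and their commutators are of size \<open>\<hbar>\<close>, so for large \<open>N\<close>
  they behave like the commuting coordinate functions on the sphere. The proof makes this precise
  for traces, shows that quantized polynomials are polynomials in these matrices, and passes from
  polynomials to continuous functions by means of a contraction estimate.

  Traces. The number \<open>4\<pi>/N\<close> times the trace of a word in the matrices
  \<open>-\<i> X\<^sub>\<alpha>\<close> is, up to \<open>O(\<hbar>)\<close>, independent of the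
  order of the letters; it is invariant under infinitesimal rotations, because these act as
  commutators; and it respects the relation that the squares sum to one. The integral of the
  corresponding monomial over the sphere has the same three properties, and they determine all
  moments recursively from the total mass (\<open>rotation_moments_zero\<close>). Hence such
  traces converge to integrals (\<open>has_symbol_trace\<close>).

  Quantized polynomials. For a Legendre function of \<open>x\<^sub>3\<close> the image is a
  diagonal eigenvector of the Hoppe--Yau Laplacian. On diagonal matrices that operator is a second
  order difference operator with one-dimensional eigenspaces, so the image is a multiple
  \<open>c\<^sub>N\<close> of an explicit polynomial in \<open>-\<i> X\<^sub>3\<close>; the
  isometry property together with the convergence of traces gives the limit of
  \<open>c\<^sub>N\<^sup>2\<close>, and the sign normalization determines the sign
  (\<open>has_symbol_quantized_zonal\<close>). Rotations, that is brackets with the coordinates,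
  generate all polynomials on the sphere from these zonal functions
  (\<open>rpoly_zonal_induct\<close>), and the bracket relation transports the description of the
  image along them. So up to the factor \<open>\<i>\<close> every quantized polynomial is a
  polynomial in the matrices \<open>-\<i> X\<^sub>\<alpha>\<close> whose coefficients converge
  (\<open>has_symbol_quantized_poly\<close>), and all moments of its spectral measure converge to
  the moments of the level-set measure; as the eigenvalues stay bounded, the measures converge
  weakly (\<open>has_symbol_spectral_convergence\<close>).

  Continuous functions. Every polynomial is on the sphere a sum of harmonics of distinct degrees.
  The images of harmonics of distinct degrees are orthogonal, being eigenvectors of the Hoppe--Yau
  Laplacian for distinct eigenvalues, and the convergence of traces carries this orthogonality
  over to the sphere. With the isometry on each space of harmonics the map is therefore a
  contraction on polynomials (\<open>quantization_contraction_rpoly\<close>), uniformly in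
  \<open>N\<close>. On the other side, two Hermitian matrices that are close in the normalized
  Hilbert--Schmidt norm have close spectral averages of Lipschitz functions
  (\<open>spectral_sum_lipschitz\<close>). Approximating the given function uniformly by
  polynomials gives the convergence for Lipschitz test functions, and a cut-off argument gives it
  for bounded continuous ones.
\<close>

section \<open>Hermitian matrices and their spectra\<close>
lemma mat_adjoint_carrier [simp]:
  "A \<in> carrier_mat n m \<Longrightarrow> mat_adjoint A \<in> carrier_mat m n"
  unfolding mat_adjoint_def by (auto simp: mat_of_rows_def)

lemma mat_adjoint_dims [simp]:
  "dim_row (mat_adjoint A) = dim_col A" "dim_col (mat_adjoint A) = dim_row A"
  unfolding mat_adjoint_def by (auto simp: mat_of_rows_def)

lemma mat_adjoint_index [simp]:
  fixes A :: "complex mat"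
  assumes "i < dim_col A" "j < dim_row A"
  shows "mat_adjoint A $$ (i, j) = cnj (A $$ (j, i))"
  using assms unfolding mat_adjoint_def by (simp add: mat_of_rows_index)

lemma mat_adjoint_adjoint [simp]: "mat_adjoint (mat_adjoint A) = (A :: complex mat)"
  by (rule eq_matI) auto

lemma mat_mult_index:
  assumes "A \<in> carrier_mat n m" "B \<in> carrier_mat m p" "i < n" "j < p"
  shows "(A * B) $$ (i, j) = (\<Sum>k<m. A $$ (i, k) * B $$ (k, j))"
  using assms by (auto simp: scalar_prod_def lessThan_atLeast0)

lemma mult_carrier_square [simp]:
  "A \<in> carrier_mat n n \<Longrightarrow> B \<in> carrier_mat n n \<Longrightarrow> A * B \<in> carrier_mat n n"
  by (rule mult_carrier_mat)

lemma one_mult_square [simp]: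
  fixes A :: "'a::semiring_1 mat"
  assumes "A \<in> carrier_mat n n"
  shows "1\<^sub>m n * A = A" "A * 1\<^sub>m n = A"
  using assms by auto

lemma mat_adjoint_mult:
  fixes A B :: "complex mat"
  assumes "A \<in> carrier_mat n m" "B \<in> carrier_mat m p"
  shows "mat_adjoint (A * B) = mat_adjoint B * mat_adjoint A"
proof (rule eq_matI)
  fix i j assume "i < dim_row (mat_adjoint B * mat_adjoint A)" "j < dim_col (mat_adjoint B * mat_adjoint A)"
  then have ij: "i < p" "j < n" using assms by auto
  have "mat_adjoint (A * B) $$ (i, j) = cnj ((A * B) $$ (j, i))"
    using assms ij by (subst mat_adjoint_index) auto
  also have "\<dots> = (\<Sum>k<m. cnj (A $$ (j, k)) * cnj (B $$ (k, i)))"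
    using assms ij by (subst mat_mult_index[OF assms]) auto
  also have "\<dots> = (mat_adjoint B * mat_adjoint A) $$ (i, j)"
    using assms ij
    by (subst mat_mult_index[of _ p m _ n]) (auto intro!: sum.cong simp: mult.commute)
  finally show "mat_adjoint (A * B) $$ (i, j) = (mat_adjoint B * mat_adjoint A) $$ (i, j)" .
qed (use assms in auto)

definition unitary_mat :: "nat \<Rightarrow> complex mat \<Rightarrow> bool" where
  "unitary_mat n U \<longleftrightarrow> U \<in> carrier_mat n n \<and> U * mat_adjoint U = 1\<^sub>m n \<and> mat_adjoint U * U = 1\<^sub>m n"

lemma unitary_mat_mult:
  assumes "unitary_mat n U" "unitary_mat n V"
  shows "unitary_mat n (U * V)"
proof -
  have c: "U \<in> carrier_mat n n" "V \<in> carrier_mat n n" "mat_adjoint U \<in> carrier_mat n n"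
    "mat_adjoint V \<in> carrier_mat n n" using assms by (auto simp: unitary_mat_def)
  have "U * V * mat_adjoint (U * V) = U * (V * mat_adjoint V) * mat_adjoint U"
    using c by (simp add: mat_adjoint_mult[OF c(1,2)] assoc_mult_mat[of _ n n _ n _ n])
  moreover have "mat_adjoint (U * V) * (U * V) = mat_adjoint V * (mat_adjoint U * U) * V"
    using c by (simp add: mat_adjoint_mult[OF c(1,2)] assoc_mult_mat[of _ n n _ n _ n])
  ultimately show ?thesis using assms c by (simp add: unitary_mat_def)
qed

lemma mult_cnj_eq_cmod: "z * cnj z = (complex_of_real (cmod z))\<^sup>2"
  by (metis complex_norm_square of_real_power)

text \<open>The reflection that exchanges the first basis vector with the unit vector \<open>v\<close>. It is
  unitary and Hermitian at once, so conjugation with it keeps a matrix Hermitian; the sign condition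
  on the first entry of \<open>v\<close> keeps the denominator \<open>1 + r\<close> away from zero.\<close>

lemma householder:
  fixes v :: "nat \<Rightarrow> complex"
  assumes n: "0 < n" and unit: "(\<Sum>i<n. v i * cnj (v i)) = 1"
    and v0: "v 0 = - of_real r" "r \<ge> 0"
  obtains H where "unitary_mat n H" "mat_adjoint H = H" "\<And>i. i < n \<Longrightarrow> H $$ (i, 0) = v i"
proof -
  define u where "u i = v i - (if i = 0 then 1 else 0)" for i
  \<comment> \<open>\<open>t\<close> equals \<open>2 / |u|\<^sup>2\<close>, as for every
    reflection in the hyperplane orthogonal to \<open>u\<close>\<close>
  define t where "t = complex_of_real (1 / (1 + r))"
  define H where "H = Matrix.mat n n (\<lambda>(i, j). (if i = j then 1 else 0) - t * u i * cnj (u j))"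
  have H: "H \<in> carrier_mat n n" by (simp add: H_def)
  have "(\<Sum>i<n. u i * cnj (u i)) = (\<Sum>i<n. v i * cnj (v i) - (if i = 0 then v 0 + cnj (v 0) - 1 else 0))"
    by (intro sum.cong) (auto simp: u_def algebra_simps)
  also have "\<dots> = 1 - (v 0 + cnj (v 0) - 1)"
    using n by (simp only: sum_subtractf unit) (simp add: sum.delta)
  also have "\<dots> = 2 * of_real (1 + r)" using v0 by (simp add: algebra_simps)
  finally have su: "(\<Sum>i<n. u i * cnj (u i)) = 2 * of_real (1 + r)" .
  have tsu: "t * (\<Sum>i<n. u i * cnj (u i)) = 2"
  proof -
    have "1 / (1 + r) * (2 * (1 + r)) = 2" using v0 by (simp add: field_simps)
    then show ?thesis unfolding su t_def by (metis of_real_mult of_real_numeral)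
  qed
  have adj: "mat_adjoint H = H"
    by (rule eq_matI) (auto simp: H_def t_def)
  have HH: "H * H = 1\<^sub>m n"
  proof (rule eq_matI)
    fix i j assume "i < dim_row (1\<^sub>m n)" "j < dim_col (1\<^sub>m n)"
    then have ij: "i < n" "j < n" by auto
    have "(H * H) $$ (i, j) = (\<Sum>k<n. H $$ (i, k) * H $$ (k, j))"
      by (rule mat_mult_index[OF H H ij])
    also have "\<dots> = (\<Sum>k<n. (if k = i then (if i = j then 1 else 0) - t * u i * cnj (u j) else 0)
        + (if k = j then - t * u i * cnj (u j) else 0) + t * (u k * cnj (u k)) * (t * u i * cnj (u j)))"
      using ij by (intro sum.cong) (auto simp: H_def algebra_simps)
    also have "\<dots> = (if i = j then 1 else 0) - t * u i * cnj (u j) - t * u i * cnj (u j)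
        + (t * (\<Sum>k<n. u k * cnj (u k))) * (t * u i * cnj (u j))"
      using ij by (simp add: sum.distrib sum.delta flip: sum_distrib_right sum_distrib_left)
    also have "\<dots> = (if i = j then 1 else 0)" by (simp add: tsu)
    finally show "(H * H) $$ (i, j) = 1\<^sub>m n $$ (i, j)" using ij by simp
  qed (use H in auto)
  have "unitary_mat n H" using H HH adj by (simp add: unitary_mat_def)
  moreover have "H $$ (i, 0) = v i" if "i < n" for i
  proof -
    have "t * cnj (u 0) = -1"
    proof -
      have "cnj (u 0) = of_real (- (1 + r))" using v0 by (simp add: u_def)
      moreover have "1 / (1 + r) * (- (1 + r)) = - 1" using v0 by (simp add: field_simps)
      ultimately show ?thesis unfolding t_def by (metis of_real_mult of_real_1 of_real_minus)
    qed
    then have "t * u i * cnj (u 0) = - u i" by (metis mult.assoc mult.commute mult_minus1)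
    then show ?thesis using that n by (simp add: H_def u_def)
  qed
  ultimately show ?thesis using adj that by blast
qed

lemma unit_eigenvector:
  fixes A :: "complex mat"
  assumes A: "A \<in> carrier_mat n n" and n: "0 < n"
  obtains e v r where "(\<Sum>i<n. v i * cnj (v i)) = 1" "v 0 = - of_real r" "r \<ge> (0::real)"
    "\<And>i. i < n \<Longrightarrow> (\<Sum>k<n. A $$ (i, k) * v k) = e * v i"
proof -
  have "degree (char_poly A) = n" using degree_monic_char_poly[OF A] by simp
  then have "\<not> constant (poly (char_poly A))" using n by (simp add: constant_degree)
  then obtain e where "poly (char_poly A) e = 0" using fundamental_theorem_of_algebra by blast
  then obtain w where w: "eigenvector A w e"
    using eigenvalue_root_char_poly[OF A] by (auto simp: eigenvalue_def)
  have wc: "w \<in> carrier_vec n" "w \<noteq> 0\<^sub>v n" "A *\<^sub>v w = e \<cdot>\<^sub>v w"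
    using w A by (auto simp: eigenvector_def)
  define f where "f i = vec_index w i" for i
  have ev: "(\<Sum>k<n. A $$ (i, k) * f k) = e * f i" if "i < n" for i
  proof -
    have "vec_index (A *\<^sub>v w) i = e * f i" using wc that by (simp add: f_def)
    moreover have "vec_index (A *\<^sub>v w) i = (\<Sum>k<n. A $$ (i, k) * f k)"
      using that A wc(1) by (simp add: scalar_prod_def f_def lessThan_atLeast0)
    ultimately show ?thesis by simp
  qed
  obtain j where j: "j < n" "f j \<noteq> 0"
    using wc by (auto simp: f_def vec_eq_iff)
  define s where "s = (\<Sum>i<n. (cmod (f i))\<^sup>2)"
  have s: "s > 0" unfolding s_def using j by (intro sum_pos2[of _ j]) auto
  \<comment> \<open>normalizes the length and turns the phase so that the first entry is real and
    nonpositive\<close>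
  define c where "c = (if f 0 = 0 then 1 else - cnj (f 0) / of_real (cmod (f 0))) / of_real (sqrt s)"
  have cc: "c * cnj c = 1 / of_real s"
  proof -
    have "cmod c = 1 / sqrt s" using s by (auto simp: c_def norm_divide)
    then have "(cmod c)\<^sup>2 = 1 / s" using s by (simp add: power_divide)
    then show ?thesis by (metis complex_norm_square of_real_1 of_real_divide)
  qed
  show ?thesis
  proof (rule that[of "\<lambda>i. c * f i" "cmod (f 0) / sqrt s" e])
    have "(\<Sum>i<n. c * f i * cnj (c * f i)) = c * cnj c * of_real s"
      by (simp add: s_def sum_distrib_left mult_cnj_eq_cmod [symmetric] mult_ac)
    then show "(\<Sum>i<n. c * f i * cnj (c * f i)) = 1" using s cc by simp
    have "f 0 \<noteq> 0 \<Longrightarrow> cnj (f 0) * f 0 / of_real (cmod (f 0)) = of_real (cmod (f 0))"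
      using complex_norm_square[of "f 0"] by (simp add: field_simps power2_eq_square)
    then show "c * f 0 = - complex_of_real (cmod (f 0) / sqrt s)"
      by (auto simp: c_def)
    show "0 \<le> cmod (f 0) / sqrt s" using s by simp
    show "(\<Sum>k<n. A $$ (i, k) * (c * f k)) = e * (c * f i)" if "i < n" for i
      using arg_cong[OF ev[OF that], of "\<lambda>z. c * z"] by (simp add: sum_distrib_left mult_ac)
  qed
qed

text \<open>Deflation: conjugating with a reflection that sends the first basis vector to a unit eigenvector
  makes the first column a multiple of that basis vector. By symmetry the first row is as well, and
  the induction hypothesis applies to the remaining block.\<close>

lemma hermitian_diagonalization:
  fixes A :: "complex mat"
  assumes "A \<in> carrier_mat n n" "mat_adjoint A = A"
  shows "\<exists>U l. unitary_mat n U \<and> A = U * mat_diag n (\<lambda>i. of_real (l i)) * mat_adjoint U"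
  using assms
proof (induction n arbitrary: A)
  case 0
  then show ?case
    by (intro exI[of _ "1\<^sub>m 0"] exI[of _ "\<lambda>_. 0"]) (auto simp: unitary_mat_def mat_diag_def intro!: eq_matI)
next
  case (Suc n)
  note A = Suc.prems(1)
  obtain e v r where v: "(\<Sum>i<Suc n. v i * cnj (v i)) = 1" "v 0 = - of_real r" "r \<ge> (0::real)"
    "\<And>i. i < Suc n \<Longrightarrow> (\<Sum>k<Suc n. A $$ (i, k) * v k) = e * v i"
    by (rule unit_eigenvector[OF A zero_less_Suc]) (rule that)
  obtain H where H: "unitary_mat (Suc n) H" "mat_adjoint H = H" "\<And>i. i < Suc n \<Longrightarrow> H $$ (i, 0) = v i"
    by (rule householder[OF zero_less_Suc v(1,2,3)]) (rule that)
  have Hc: "H \<in> carrier_mat (Suc n) (Suc n)" and HH: "H * H = 1\<^sub>m (Suc n)"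
    using H by (auto simp: unitary_mat_def)
  define B where "B = H * (A * H)"
  have Bc: "B \<in> carrier_mat (Suc n) (Suc n)" using Hc A by (auto simp: B_def)
  have Badj: "mat_adjoint B = B"
    unfolding B_def using Hc A H Suc.prems(2)
    by (simp add: mat_adjoint_mult[of _ "Suc n" "Suc n" _ "Suc n"] assoc_mult_mat[of _ "Suc n" "Suc n" _ "Suc n" _ "Suc n"])
  have B0: "B $$ (i, 0) = (if i = 0 then e else 0)" if i: "i < Suc n" for i
  proof -
    have AH: "(A * H) $$ (k, 0) = e * H $$ (k, 0)" if "k < Suc n" for k
      using that v(4)[OF that] H(3) by (subst mat_mult_index[OF A Hc]) auto
    have "B $$ (i, 0) = (\<Sum>k<Suc n. H $$ (i, k) * (e * H $$ (k, 0)))"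
      unfolding B_def using A Hc i by (subst mat_mult_index[of _ "Suc n" "Suc n" _ "Suc n"]) (auto simp: AH simp del: sum.lessThan_Suc index_mult_mat(1) intro!: sum.cong)
    also have "\<dots> = e * (H * H) $$ (i, 0)"
      using i by (subst mat_mult_index[OF Hc Hc]) (auto simp: sum_distrib_left mult_ac simp del: sum.lessThan_Suc)
    finally show ?thesis using i HH by auto
  qed
  have B0': "B $$ (0, i) = (if i = 0 then e else 0)" if i: "i < Suc n" for i
  proof -
    have "B $$ (0, i) = cnj (B $$ (i, 0))"
      by (metis Badj Bc carrier_matD mat_adjoint_index that zero_less_Suc)
    moreover have "cnj e = e" using B0[of 0] mat_adjoint_index[of 0 B 0] Bc Badj by auto
    ultimately show ?thesis using B0[OF i] by auto
  qed
  define e' where "e' = Re e"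
  have ee: "e = of_real e'" using B0[of 0] mat_adjoint_index[of 0 B 0] Bc Badj
    by (auto simp: e'_def complex_eq_iff)
  define C where "C = Matrix.mat n n (\<lambda>(i, j). B $$ (Suc i, Suc j))"
  have Cc: "C \<in> carrier_mat n n" by (simp add: C_def)
  have "mat_adjoint C = C"
  proof (rule eq_matI)
    fix i j assume "i < dim_row C" "j < dim_col C"
    then have ij: "i < n" "j < n" by (auto simp: C_def)
    then have "mat_adjoint B $$ (Suc i, Suc j) = cnj (B $$ (Suc j, Suc i))"
      using Bc by (intro mat_adjoint_index) auto
    then show "mat_adjoint C $$ (i, j) = C $$ (i, j)" using ij Badj by (simp add: C_def)
  qed (auto simp: C_def)
  from Suc.IH[OF Cc this] obtain U l where U: "unitary_mat n U"
    and CU: "C = U * mat_diag n (\<lambda>i. of_real (l i)) * mat_adjoint U" by blast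
  have Uc: "U \<in> carrier_mat n n" "mat_adjoint U \<in> carrier_mat n n" using U by (auto simp: unitary_mat_def)
  let ?f = "\<lambda>X::complex mat. four_block_mat (1\<^sub>m 1) (0\<^sub>m 1 n) (0\<^sub>m n 1) X"
  define V where "V = ?f U"
  have Vc: "V \<in> carrier_mat (Suc n) (Suc n)" using Uc by (auto simp: V_def)
  have Vadj: "mat_adjoint V = ?f (mat_adjoint U)"
    by (rule eq_matI) (use Uc in \<open>auto simp: V_def\<close>)
  have fone: "?f (1\<^sub>m n) = 1\<^sub>m (Suc n)" by (rule eq_matI) auto
  have fmul: "four_block_mat (x \<cdot>\<^sub>m 1\<^sub>m 1) (0\<^sub>m 1 n) (0\<^sub>m n 1) X * four_block_mat (y \<cdot>\<^sub>m 1\<^sub>m 1) (0\<^sub>m 1 n) (0\<^sub>m n 1) Y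
    = four_block_mat ((x * y) \<cdot>\<^sub>m 1\<^sub>m 1) (0\<^sub>m 1 n) (0\<^sub>m n 1) (X * Y)"
    if XY: "X \<in> carrier_mat n n" "Y \<in> carrier_mat n n" for X Y and x y :: complex
    by (subst mult_four_block_mat[of _ 1 1 _ n _ n _ _ 1 _ n])
       (use XY in \<open>auto simp: left_mult_zero_mat[OF XY(2)] right_mult_zero_mat[OF XY(1)] intro!: arg_cong[where f="\<lambda>M. four_block_mat M _ _ _"] eq_matI\<close>)
  have one1: "1 \<cdot>\<^sub>m 1\<^sub>m 1 = (1\<^sub>m 1 :: complex mat)" by (rule eq_matI) auto
  note fmul1 = fmul[where x=1 and y=1, unfolded mult_1 one1]
  have Vu: "unitary_mat (Suc n) V"
    using U Vc fmul1[OF Uc] fmul1[OF Uc(2,1)] unfolding unitary_mat_def Vadj unfolding V_def by (metis fone)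
  define D where "D = mat_diag (Suc n) (\<lambda>i. complex_of_real (case i of 0 \<Rightarrow> e' | Suc j \<Rightarrow> l j))"
  have Deq: "D = four_block_mat (e \<cdot>\<^sub>m 1\<^sub>m 1) (0\<^sub>m 1 n) (0\<^sub>m n 1) (mat_diag n (\<lambda>i. of_real (l i)))"
    by (rule eq_matI) (auto simp: D_def mat_diag_def ee split: nat.splits)
  have "V * D * mat_adjoint V = four_block_mat (e \<cdot>\<^sub>m 1\<^sub>m 1) (0\<^sub>m 1 n) (0\<^sub>m n 1) C"
  proof -
    have "V * D = four_block_mat (e \<cdot>\<^sub>m 1\<^sub>m 1) (0\<^sub>m 1 n) (0\<^sub>m n 1) (U * mat_diag n (\<lambda>i. of_real (l i)))"
      unfolding V_def Deq using fmul[where x=1, unfolded mult_1 one1] Uc by simp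
    then show ?thesis
      unfolding Vadj CU using fmul[where y=1, unfolded mult_1_right one1] Uc by simp
  qed
  also have "\<dots> = B"
    by (rule eq_matI) (use Bc B0 B0' in \<open>auto simp: C_def\<close>)
  finally have VB: "V * D * mat_adjoint V = B" .
  have Dc: "D \<in> carrier_mat (Suc n) (Suc n)" by (simp add: D_def)
  have "H * V * D * mat_adjoint (H * V) = H * (V * D * mat_adjoint V) * H"
    using Hc Vc Dc H(2)
    by (simp add: mat_adjoint_mult[OF Hc Vc] assoc_mult_mat[of _ "Suc n" "Suc n" _ "Suc n" _ "Suc n"])
  also have "\<dots> = H * (H * A * H) * H" using A Hc by (simp add: VB B_def assoc_mult_mat[of _ "Suc n" "Suc n" _ "Suc n" _ "Suc n"])
  also have "\<dots> = (H * H) * A * (H * H)" 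
    using A Hc by (simp add: assoc_mult_mat[of _ "Suc n" "Suc n" _ "Suc n" _ "Suc n"] del: HH)
  also have "\<dots> = A" using A by (simp add: HH)
  finally show ?case using unitary_mat_mult[OF H(1) Vu] unfolding D_def by metis
qed


lemma unitary_rows:
  assumes "unitary_mat n U" "i < n" "j < n"
  shows "(\<Sum>k<n. U $$ (i, k) * cnj (U $$ (j, k))) = (if i = j then 1 else 0)"
    and "(\<Sum>k<n. cnj (U $$ (k, i)) * U $$ (k, j)) = (if i = j then 1 else 0)"
proof -
  have U: "U \<in> carrier_mat n n" "mat_adjoint U \<in> carrier_mat n n"
    "U * mat_adjoint U = 1\<^sub>m n" "mat_adjoint U * U = 1\<^sub>m n"
    using assms by (auto simp: unitary_mat_def)
  have "(\<Sum>k<n. U $$ (i, k) * cnj (U $$ (j, k))) = (U * mat_adjoint U) $$ (i, j)"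
    using U assms by (subst mat_mult_index[OF U(1,2)]) (auto intro!: sum.cong)
  then show "(\<Sum>k<n. U $$ (i, k) * cnj (U $$ (j, k))) = (if i = j then 1 else 0)"
    using U assms by simp
  have "(\<Sum>k<n. cnj (U $$ (k, i)) * U $$ (k, j)) = (mat_adjoint U * U) $$ (i, j)"
    using U assms by (subst mat_mult_index[OF U(2,1)]) (auto intro!: sum.cong)
  then show "(\<Sum>k<n. cnj (U $$ (k, i)) * U $$ (k, j)) = (if i = j then 1 else 0)"
    using U assms by simp
qed

definition mat_trace :: "nat \<Rightarrow> complex mat \<Rightarrow> complex" where
  "mat_trace n A = (\<Sum>i<n. A $$ (i, i))"

definition frobenius_sq :: "nat \<Rightarrow> complex mat \<Rightarrow> real" where
  "frobenius_sq n A = (\<Sum>i<n. \<Sum>j<n. (cmod (A $$ (i, j)))\<^sup>2)"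

lemma mat_trace_mult_comm:
  assumes "A \<in> carrier_mat n n" "B \<in> carrier_mat n n"
  shows "mat_trace n (A * B) = mat_trace n (B * A)"
proof -
  have "mat_trace n (A * B) = (\<Sum>i<n. \<Sum>k<n. A $$ (i, k) * B $$ (k, i))"
    unfolding mat_trace_def by (intro sum.cong refl mat_mult_index[OF assms]) auto
  also have "\<dots> = (\<Sum>k<n. \<Sum>i<n. B $$ (k, i) * A $$ (i, k))"
    by (subst sum.swap) (simp add: mult.commute)
  also have "\<dots> = mat_trace n (B * A)"
    unfolding mat_trace_def by (intro sum.cong refl mat_mult_index[OF assms(2,1), symmetric]) auto
  finally show ?thesis .
qed

lemma frobenius_sq_eq_tr:
  assumes "A \<in> carrier_mat n n"
  shows "of_real (frobenius_sq n A) = mat_trace n (mat_adjoint A * A)"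
    "of_real (frobenius_sq n A) = mat_trace n (A * mat_adjoint A)"
proof -
  have c: "mat_adjoint A \<in> carrier_mat n n" using assms by simp
  have "mat_trace n (A * mat_adjoint A) = (\<Sum>i<n. \<Sum>k<n. A $$ (i, k) * mat_adjoint A $$ (k, i))"
    unfolding mat_trace_def by (intro sum.cong refl mat_mult_index[OF assms c]) auto
  also have "\<dots> = (\<Sum>i<n. \<Sum>k<n. of_real ((cmod (A $$ (i, k)))\<^sup>2))"
    using assms by (intro sum.cong refl) (simp add: mult_cnj_eq_cmod)
  also have "\<dots> = of_real (frobenius_sq n A)" by (simp add: frobenius_sq_def)
  finally show 1: "of_real (frobenius_sq n A) = mat_trace n (A * mat_adjoint A)" by simp
  show "of_real (frobenius_sq n A) = mat_trace n (mat_adjoint A * A)"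
    using 1 mat_trace_mult_comm[OF assms c] by simp
qed

lemma frobenius_sq_unitary:
  assumes U: "unitary_mat n U" and V: "unitary_mat n V" and A: "A \<in> carrier_mat n n"
  shows "frobenius_sq n (mat_adjoint U * A * V) = frobenius_sq n A"
proof -
  have c: "U \<in> carrier_mat n n" "V \<in> carrier_mat n n" "U * mat_adjoint U = 1\<^sub>m n" "V * mat_adjoint V = 1\<^sub>m n"
    using U V by (auto simp: unitary_mat_def)
  let ?W = "mat_adjoint U * A * V"
  have "of_real (frobenius_sq n ?W) = mat_trace n (mat_adjoint ?W * ?W)"
    using c A by (intro frobenius_sq_eq_tr) auto
  also have "mat_adjoint ?W = mat_adjoint V * (mat_adjoint A * U)"
    using c A by (simp add: mat_adjoint_mult[of _ n n _ n])
  also have "mat_adjoint V * (mat_adjoint A * U) * ?W = mat_adjoint V * (mat_adjoint A * (U * mat_adjoint U) * A * V)"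
    using c(1,2) A by (simp add: assoc_mult_mat[of _ n n _ n _ n])
  also have "mat_trace n \<dots> = mat_trace n ((mat_adjoint A * (U * mat_adjoint U) * A * V) * mat_adjoint V)"
    using c(1,2) A by (intro mat_trace_mult_comm) auto
  also have "(mat_adjoint A * (U * mat_adjoint U) * A * V) * mat_adjoint V = mat_adjoint A * A * (V * mat_adjoint V)"
    using c(1,2) A by (simp add: c(3) assoc_mult_mat[of _ n n _ n _ n])
  also have "\<dots> = mat_adjoint A * A" using A by (simp add: c(4))
  also have "mat_trace n (mat_adjoint A * A) = of_real (frobenius_sq n A)" using frobenius_sq_eq_tr[OF A] by simp
  finally show ?thesis by (simp only: of_real_eq_iff)
qed

text \<open>The squared moduli of the entries of \<open>U\<^sup>* V\<close> form a doubly stochastic matrix,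
  and the squared Hilbert--Schmidt distance of \<open>A\<close> and \<open>B\<close> is the average
  of \<open>(l\<^sub>i - m\<^sub>j)\<^sup>2\<close> with these weights, multiplied by
  \<open>n\<close>. Averaging the Lipschitz bound with the same weights and applying the
  Cauchy--Schwarz inequality gives the estimate, with no need to match the two spectra.\<close>

lemma spectral_sum_lipschitz:
  fixes g :: "real \<Rightarrow> real" and l m :: "nat \<Rightarrow> real"
  assumes U: "unitary_mat n U" and V: "unitary_mat n V"
    and A: "A = U * mat_diag n (\<lambda>i. of_real (l i)) * mat_adjoint U"
    and B: "B = V * mat_diag n (\<lambda>i. of_real (m i)) * mat_adjoint V"
    and lip: "\<And>x y. \<bar>g x - g y\<bar> \<le> K * \<bar>x - y\<bar>" and K: "0 \<le> K"
  shows "\<bar>(\<Sum>i<n. g (l i)) - (\<Sum>i<n. g (m i))\<bar> \<le> K * sqrt (real n) * sqrt (frobenius_sq n (A - B))"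
proof -
  define W where "W = mat_adjoint U * V"
  have c: "U \<in> carrier_mat n n" "V \<in> carrier_mat n n" "mat_adjoint U * U = 1\<^sub>m n" "mat_adjoint V * V = 1\<^sub>m n"
    "U * mat_adjoint U = 1\<^sub>m n" "V * mat_adjoint V = 1\<^sub>m n"
    using U V by (auto simp: unitary_mat_def)
  have AB: "A \<in> carrier_mat n n" "B \<in> carrier_mat n n" using c by (auto simp: A B)
  have "unitary_mat n (mat_adjoint U)" using U by (auto simp: unitary_mat_def)
  then have W: "unitary_mat n W" unfolding W_def using V by (rule unitary_mat_mult)
  then have Wc: "W \<in> carrier_mat n n" by (simp add: unitary_mat_def)
  let ?w = "\<lambda>i j. (cmod (W $$ (i, j)))\<^sup>2"
  have rows: "(\<Sum>j<n. ?w i j) = 1" if "i < n" for i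
  proof -
    have "complex_of_real (\<Sum>j<n. ?w i j) = 1"
      using unitary_rows(1)[OF W that that] by (simp add: mult_cnj_eq_cmod)
    then show ?thesis by (simp only: of_real_eq_1_iff)
  qed
  have cols: "(\<Sum>i<n. ?w i j) = 1" if "j < n" for j
  proof -
    have "complex_of_real (\<Sum>i<n. ?w i j) = 1"
      using unitary_rows(2)[OF W that that] by (simp add: mult_cnj_eq_cmod mult.commute)
    then show ?thesis by (simp only: of_real_eq_1_iff)
  qed
  have "mat_adjoint U * A = mat_diag n (\<lambda>i. of_real (l i)) * mat_adjoint U"
  proof -
    have "mat_adjoint U * A = (mat_adjoint U * U) * (mat_diag n (\<lambda>i. of_real (l i)) * mat_adjoint U)"
      unfolding A using c(1,2) by (simp add: assoc_mult_mat[of _ n n _ n _ n])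
    then show ?thesis using c by simp
  qed
  then have UAV: "mat_adjoint U * A * V = mat_diag n (\<lambda>i. of_real (l i)) * W"
    using c(1,2) by (simp add: W_def assoc_mult_mat[of _ n n _ n _ n])
  have "mat_adjoint U * B * V = W * mat_diag n (\<lambda>i. of_real (m i)) * (mat_adjoint V * V)"
    unfolding B W_def using c(1,2) by (simp add: assoc_mult_mat[of _ n n _ n _ n])
  then have UBV: "mat_adjoint U * B * V = W * mat_diag n (\<lambda>i. of_real (m i))"
    using c Wc by simp
  have "mat_adjoint U * (A - B) * V = mat_adjoint U * A * V - mat_adjoint U * B * V"
    using c(1,2) AB by (simp add: mult_minus_distrib_mat[of _ n n _ n] minus_mult_distrib_mat[of _ n n _ _ n])
  then have diff: "mat_adjoint U * (A - B) * V = mat_diag n (\<lambda>i. of_real (l i)) * W - W * mat_diag n (\<lambda>i. of_real (m i))"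
    by (simp only: UAV UBV)
  have ent: "(mat_adjoint U * (A - B) * V) $$ (i, j) = of_real (l i - m j) * W $$ (i, j)" if "i < n" "j < n" for i j
    unfolding diff mat_diag_mult_left[OF Wc] mat_diag_mult_right[OF Wc]
    using that by (simp add: algebra_simps)
  have "frobenius_sq n (A - B) = frobenius_sq n (mat_adjoint U * (A - B) * V)"
    using frobenius_sq_unitary[OF U V minus_carrier_mat[OF AB(2)]] by simp
  also have "\<dots> = (\<Sum>i<n. \<Sum>j<n. (l i - m j)\<^sup>2 * ?w i j)"
    unfolding frobenius_sq_def by (intro sum.cong refl) (simp add: ent norm_mult power_mult_distrib flip: of_real_diff)
  finally have fr: "frobenius_sq n (A - B) = (\<Sum>i<n. \<Sum>j<n. (l i - m j)\<^sup>2 * ?w i j)" .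
  have "(\<Sum>i<n. g (l i)) = (\<Sum>i<n. \<Sum>j<n. g (l i) * ?w i j)"
    by (intro sum.cong refl) (simp add: rows flip: sum_distrib_left)
  moreover have "(\<Sum>j<n. g (m j)) = (\<Sum>i<n. \<Sum>j<n. g (m j) * ?w i j)"
    by (subst sum.swap, intro sum.cong refl) (simp add: cols flip: sum_distrib_left)
  ultimately have "\<bar>(\<Sum>i<n. g (l i)) - (\<Sum>i<n. g (m i))\<bar> = \<bar>\<Sum>i<n. \<Sum>j<n. (g (l i) - g (m j)) * ?w i j\<bar>"
    by (simp add: sum_subtractf algebra_simps)
  also have "\<dots> \<le> (\<Sum>i<n. \<Sum>j<n. \<bar>(g (l i) - g (m j)) * ?w i j\<bar>)"
    by (rule order_trans[OF sum_abs]) (intro sum_mono sum_abs)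
  also have "\<dots> \<le> (\<Sum>i<n. \<Sum>j<n. K * (\<bar>l i - m j\<bar> * ?w i j))"
    using lip by (intro sum_mono) (auto simp: abs_mult mult.assoc[symmetric] intro!: mult_right_mono)
  also have "\<dots> = K * (\<Sum>p\<in>{..<n} \<times> {..<n}. (\<bar>l (fst p) - m (snd p)\<bar> * cmod (W $$ p)) * cmod (W $$ p))"
    by (simp add: sum_distrib_left sum.cartesian_product case_prod_unfold power2_eq_square mult_ac)
  also have "\<dots> \<le> K * (L2_set (\<lambda>p. \<bar>l (fst p) - m (snd p)\<bar> * cmod (W $$ p)) ({..<n} \<times> {..<n})
      * L2_set (\<lambda>p. cmod (W $$ p)) ({..<n} \<times> {..<n}))"
    using K by (intro mult_left_mono order_trans[OF _ L2_set_mult_ineq] sum_mono) auto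
  also have "L2_set (\<lambda>p. \<bar>l (fst p) - m (snd p)\<bar> * cmod (W $$ p)) ({..<n} \<times> {..<n}) = sqrt (frobenius_sq n (A - B))"
    unfolding L2_set_def fr by (simp add: sum.cartesian_product case_prod_unfold power_mult_distrib)
  also have "L2_set (\<lambda>p. cmod (W $$ p)) ({..<n} \<times> {..<n}) = sqrt (real n)"
  proof -
    have "(\<Sum>p\<in>{..<n} \<times> {..<n}. (cmod (W $$ p))\<^sup>2) = (\<Sum>i<n. \<Sum>j<n. ?w i j)"
      by (simp add: sum.cartesian_product case_prod_unfold)
    also have "\<dots> = real n" by (simp add: rows)
    finally show ?thesis by (simp add: L2_set_def)
  qed
  finally show ?thesis by (simp add: mult_ac)
qed

lemma unitary_conj_pow:
  assumes U: "unitary_mat n U" and A: "A = U * mat_diag n d * mat_adjoint U"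
  shows "A ^\<^sub>m k = U * mat_diag n (\<lambda>i. d i ^ k) * mat_adjoint U"
proof (induction k)
  case 0
  then show ?case using U by (auto simp: unitary_mat_def A)
next
  case (Suc k)
  have c: "U \<in> carrier_mat n n" "mat_adjoint U * U = 1\<^sub>m n" using U by (auto simp: unitary_mat_def)
  have "A ^\<^sub>m Suc k = U * (mat_diag n (\<lambda>i. d i ^ k) * (mat_adjoint U * U) * mat_diag n d) * mat_adjoint U"
    using c(1) unfolding pow_mat.simps Suc.IH unfolding A by (simp add: assoc_mult_mat[of _ n n _ n _ n])
  then show ?case using c by (simp add: power_commutes)
qed

lemma mat_trace_unitary_conj:
  assumes U: "unitary_mat n U" and D: "D \<in> carrier_mat n n"
  shows "mat_trace n (U * D * mat_adjoint U) = mat_trace n D"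
proof -
  have c: "U \<in> carrier_mat n n" "mat_adjoint U * U = 1\<^sub>m n" using U by (auto simp: unitary_mat_def)
  have "mat_trace n (U * D * mat_adjoint U) = mat_trace n (mat_adjoint U * (U * D))"
    using c D by (intro mat_trace_mult_comm) auto
  also have "mat_adjoint U * (U * D) = (mat_adjoint U * U) * D"
    using c(1) D by (simp add: assoc_mult_mat[of _ n n _ n _ n])
  finally show ?thesis using c D by simp
qed

lemma mat_trace_pow_hermitian:
  assumes U: "unitary_mat n U" and A: "A = U * mat_diag n (\<lambda>i. of_real (l i)) * mat_adjoint U"
  shows "mat_trace n (A ^\<^sub>m k) = of_real (\<Sum>i<n. l i ^ k)"
  unfolding unitary_conj_pow[OF U A]
  by (subst mat_trace_unitary_conj[OF U]) (auto simp: mat_trace_def mat_diag_def)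

lemma char_poly_skew:
  assumes U: "unitary_mat n U" and A: "A = U * mat_diag n (\<lambda>i. of_real (l i)) * mat_adjoint U"
  shows "char_poly (\<i> \<cdot>\<^sub>m A) = (\<Prod>i<n. [:- (\<i> * of_real (l i)), 1:])"
proof -
  have c: "U \<in> carrier_mat n n" "mat_adjoint U * U = 1\<^sub>m n" "U * mat_adjoint U = 1\<^sub>m n"
    using U by (auto simp: unitary_mat_def)
  let ?D = "mat_diag n (\<lambda>i. \<i> * complex_of_real (l i))"
  have D: "?D = \<i> \<cdot>\<^sub>m mat_diag n (\<lambda>i. of_real (l i))" by (rule eq_matI) (auto simp: mat_diag_def)
  have "\<i> \<cdot>\<^sub>m A = U * ?D * mat_adjoint U"
    unfolding D A using c(1) by (simp add: mult_smult_distrib[of _ n n _ n] mult_smult_assoc_mat[of _ n n _ n])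
  then have "similar_mat_wit (\<i> \<cdot>\<^sub>m A) ?D U (mat_adjoint U)"
    using c by (intro similar_mat_witI[of _ _ n]) (auto simp: A)
  then have "similar_mat (\<i> \<cdot>\<^sub>m A) ?D" by (auto simp: similar_mat_def)
  then have "char_poly (\<i> \<cdot>\<^sub>m A) = char_poly ?D" by (rule char_poly_similar)
  also have "\<dots> = (\<Prod>a\<leftarrow>diag_mat ?D. [:- a, 1:])"
    by (rule char_poly_upper_triangular[of _ n]) (auto simp: mat_diag_def upper_triangular_def)
  also have "\<dots> = (\<Prod>i<n. [:- (\<i> * of_real (l i)), 1:])"
    by (simp add: diag_mat_def mat_diag_def o_def prod.list_conv_set_nth lessThan_atLeast0 cong: map_cong)
  finally show ?thesis .
qed

lemma order_prod_linear:
  fixes a :: "nat \<Rightarrow> complex"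
  shows "Polynomial.order z (\<Prod>i<n. [:- a i, 1:]) = card {i. i < n \<and> a i = z}"
proof (induction n)
  case (Suc n)
  have ne: "(\<Prod>i<n. [:- a i, 1:]) * [:- a n, 1:] \<noteq> 0"
    by (simp only: mult_eq_0_iff prod_zero_iff finite_lessThan) auto
  have "{i. i < Suc n \<and> a i = z} = {i. i < n \<and> a i = z} \<union> (if a n = z then {n} else {})"
    by (auto simp: less_Suc_eq)
  then have "card {i. i < Suc n \<and> a i = z} = card {i. i < n \<and> a i = z} + (if a n = z then 1 else 0)"
    by (auto simp: card_insert_if)
  moreover have "Polynomial.order z [:- a n, 1:] = (if a n = z then 1 else 0)"
    by (auto simp: order_linear' order_0I)
  ultimately show ?case using Suc.IH order_mult[OF ne] by (simp add: mult.commute)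
qed simp

text \<open>The algebraic multiplicities in the definition of the measure are the multiplicities in the list
  of diagonal entries, because the characteristic polynomial is the product of the linear factors.\<close>

lemma integral_empirical_spectral_measure:
  fixes f :: "real \<Rightarrow> real"
  assumes U: "unitary_mat n U" and A: "A = U * mat_diag n (\<lambda>i. of_real (l i)) * mat_adjoint U"
    and f: "f \<in> borel_measurable borel"
  shows "(\<integral>r. f r \<partial>empirical_spectral_measure (\<i> \<cdot>\<^sub>m A)) = 4 * pi / real n * (\<Sum>i<n. f (l i))"
proof -
  let ?W = "\<i> \<cdot>\<^sub>m A"
  have c: "U \<in> carrier_mat n n" using U by (auto simp: unitary_mat_def)
  have W: "?W \<in> carrier_mat n n" using c by (auto simp: A)
  have ord: "Polynomial.order (\<i> * of_real r) (char_poly ?W) = card {i. i < n \<and> l i = r}" for r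
    unfolding char_poly_skew[OF U A] order_prod_linear by simp
  have S: "{r. eigenvalue ?W (\<i> * of_real r)} = l ` {..<n}"
    unfolding eigenvalue_root_char_poly[OF W] char_poly_skew[OF U A]
    by (auto simp: poly_prod)
  let ?S = "l ` {..<n}"
  let ?d = "\<lambda>r. 4 * pi / real n * real (card {i. i < n \<and> l i = r})"
  have "empirical_spectral_measure ?W = distr (point_measure ?S (\<lambda>r. ennreal (?d r))) borel (\<lambda>r. r)"
    unfolding empirical_spectral_measure_def S ord carrier_matD(1)[OF W] ..
  then have "(\<integral>r. f r \<partial>empirical_spectral_measure ?W) = (\<integral>r. f r \<partial>point_measure ?S (\<lambda>r. ennreal (?d r)))"
    using f by (simp add: integral_distr measurable_point_measure_eq1)
  also have "\<dots> = (\<Sum>r\<in>?S. ?d r * f r)"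
    by (subst lebesgue_integral_point_measure_finite) auto
  also have "\<dots> = 4 * pi / real n * (\<Sum>r\<in>?S. (\<Sum>i\<in>{i. i < n \<and> l i = r}. f (l i)))"
    by (simp add: sum_distrib_left mult_ac)
  also have "(\<Sum>r\<in>?S. (\<Sum>i\<in>{i. i < n \<and> l i = r}. f (l i))) = (\<Sum>i<n. f (l i))"
    using sum.group[of "{..<n}" ?S l "\<lambda>i. f (l i)"] by simp
  finally show ?thesis .
qed

section \<open>Integration over the sphere\<close>
lemma sum_3_axis: "x = x $ 1 *\<^sub>R axis 1 1 + x $ 2 *\<^sub>R axis 2 1 + x $ 3 *\<^sub>R axis 3 (1::real)" for x :: "real^3"
  unfolding Finite_Cartesian_Product.vec_eq_iff forall_3 by (simp add: axis_def)

lemma cross3_nth: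
  "cross3 x y $ 1 = x $ 2 * y $ 3 - x $ 3 * y $ 2" "cross3 x y $ 2 = x $ 3 * y $ 1 - x $ 1 * y $ 3"
  "cross3 x y $ 3 = x $ 1 * y $ 2 - x $ 2 * y $ 1"
  by (simp_all add: cross3_def)

lemma spherical_coords_eq:
  "spherical_coords (t, p) = (sin t * cos p) *\<^sub>R axis 1 1 + (sin t * sin p) *\<^sub>R axis 2 1 + cos t *\<^sub>R axis 3 1"
  by (simp add: spherical_coords_def Finite_Cartesian_Product.vec_eq_iff forall_3 axis_def)

lemma spherical_coords_nth [simp]:
  "spherical_coords (t, p) $ 1 = sin t * cos p" "spherical_coords (t, p) $ 2 = sin t * sin p"
  "spherical_coords (t, p) $ 3 = cos t"
  by (simp_all add: spherical_coords_def)

lemma spherical_coords_in_S2: "spherical_coords z \<in> S2"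
proof -
  obtain t p where z: "z = (t, p)" by (cases z)
  have "(norm (spherical_coords z))\<^sup>2 = (sin t)\<^sup>2 * ((cos p)\<^sup>2 + (sin p)\<^sup>2) + (cos t)\<^sup>2"
    unfolding z power2_norm_eq_inner inner_vec_def sum_3 spherical_coords_nth inner_real_def
    by (simp only: power2_eq_square ring_distribs mult_ac)
  also have "\<dots> = 1" by simp
  finally have "norm (spherical_coords z) = 1" by (simp add: power2_eq_1_iff)
      (use norm_ge_zero[of "spherical_coords z"] in linarith)
  then show ?thesis by simp
qed

lemma continuous_on_spherical_coords [continuous_intros]: "continuous_on A spherical_coords"
proof -
  have "spherical_coords = (\<lambda>z. (sin (fst z) * cos (snd z)) *\<^sub>R axis 1 1 + (sin (fst z) * sin (snd z)) *\<^sub>R axis 2 1 + cos (fst z) *\<^sub>R axis 3 1)"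
    by (auto simp: fun_eq_iff spherical_coords_eq)
  moreover have "continuous_on A \<dots>" by (intro continuous_intros)
  ultimately show ?thesis by metis
qed

abbreviation angle_box :: "(real \<times> real) set" where
  "angle_box \<equiv> cbox (0, 0) (pi, 2 * pi)"

lemma sphere_area_space [simp]: "space sphere_area = S2"
  by (simp add: sphere_area_def space_restrict_space)

lemma sphere_area_sets [measurable_cong]: "sets sphere_area = sets (restrict_space borel S2)"
  by (simp add: sphere_area_def)

lemma continuous_measurable_sphere:
  "continuous_on S2 f \<Longrightarrow> (f :: real^3 \<Rightarrow> real) \<in> borel_measurable sphere_area"
  using borel_measurable_continuous_on_restrict[of S2 f]
  by (simp cong: measurable_cong_sets add: sphere_area_sets)

text \<open>The transfer from the pushed forward measure to an integral over a compact box of angles, where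
  Fubini's theorem and the fundamental theorem of calculus are available.\<close>

lemma sphere_integral:
  fixes f :: "real^3 \<Rightarrow> real"
  assumes f: "continuous_on S2 f"
  shows "integrable sphere_area f"
    and "(\<integral>x. f x \<partial>sphere_area) = integral angle_box (\<lambda>z. sin (fst z) * f (spherical_coords z))"
    and "continuous_on angle_box (\<lambda>z. sin (fst z) * f (spherical_coords z))"
proof -
  define h :: "real \<times> real \<Rightarrow> real" where "h = (\<lambda>z. indicator angle_box z * sin (fst z))"
  have hs: "(\<lambda>(t, p). ennreal (indicator ({0..pi} \<times> {0..2*pi}) (t, p) * sin t)) = (\<lambda>z. ennreal (h z))"
    by (auto simp: fun_eq_iff h_def cbox_Pair_eq)
  have hm: "h \<in> borel_measurable borel"
    unfolding h_def
    by (intro borel_measurable_times borel_measurable_indicator borel_measurable_continuous_onI continuous_intros) auto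
  have h0: "h z \<ge> 0" for z by (auto simp: h_def indicator_def cbox_Pair_eq sin_ge_zero)
  have cm: "spherical_coords \<in> measurable (density lborel (\<lambda>z. ennreal (h z))) (restrict_space borel S2)"
    using spherical_coords_in_S2
    by (intro measurable_restrict_space2) (auto intro!: borel_measurable_continuous_onI continuous_intros)
  have fm: "f \<in> borel_measurable (restrict_space borel S2)"
    using f by (rule borel_measurable_continuous_on_restrict)
  have fcm: "(\<lambda>z. f (spherical_coords z)) \<in> borel_measurable lborel"
    using measurable_compose[OF cm fm] by simp
  have fc: "continuous_on A (\<lambda>z. f (spherical_coords z))" for A
    using continuous_on_compose2[OF f continuous_on_spherical_coords] spherical_coords_in_S2 by blast
  show C: "continuous_on angle_box (\<lambda>z. sin (fst z) * f (spherical_coords z))"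
    by (intro continuous_intros fc)
  have int: "integrable lborel (\<lambda>z. indicator angle_box z *\<^sub>R (sin (fst z) * f (spherical_coords z)))"
    by (rule borel_integrable_compact[OF compact_cbox C])
  have eq: "(\<lambda>z. h z *\<^sub>R f (spherical_coords z)) = (\<lambda>z. indicator angle_box z *\<^sub>R (sin (fst z) * f (spherical_coords z)))"
    by (auto simp: h_def)
  have "integrable lborel (\<lambda>z. h z *\<^sub>R f (spherical_coords z))" unfolding eq by (rule int)
  then show "integrable sphere_area f"
    unfolding sphere_area_def hs
    using hm h0 fcm by (subst integrable_distr_eq[OF cm fm], subst integrable_density) auto
  have "(\<integral>x. f x \<partial>sphere_area) = (\<integral>z. h z *\<^sub>R f (spherical_coords z) \<partial>lborel)"
    unfolding sphere_area_def hs
    using hm h0 fcm by (subst integral_distr[OF cm fm], subst integral_density) auto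
  also have "\<dots> = integral angle_box (\<lambda>z. sin (fst z) * f (spherical_coords z))"
    unfolding eq
    using set_borel_integral_eq_integral(2)[of angle_box "\<lambda>z. sin (fst z) * f (spherical_coords z)"] int
    by (simp only: set_lebesgue_integral_def set_integrable_def)
  finally show "(\<integral>x. f x \<partial>sphere_area) = integral angle_box (\<lambda>z. sin (fst z) * f (spherical_coords z))" .
qed

text \<open>Each of the two summands is integrated first in the direction in which it is a derivative, where
  the boundary values cancel.\<close>

lemma integral_divergence_zero:
  fixes A B A' B' :: "real \<Rightarrow> real \<Rightarrow> real"
  assumes A: "\<And>t p. ((\<lambda>t. A t p) has_real_derivative A' t p) (at t)"
    and B: "\<And>t p. ((\<lambda>p. B t p) has_real_derivative B' t p) (at p)"
    and A0: "\<And>p. A 0 p = A pi p" and B0: "\<And>t. B t 0 = B t (2 * pi)"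
    and cA: "continuous_on UNIV (\<lambda>z. A' (fst z) (snd z))" and cB: "continuous_on UNIV (\<lambda>z. B' (fst z) (snd z))"
  shows "integral angle_box (\<lambda>z. A' (fst z) (snd z) + B' (fst z) (snd z)) = 0"
proof -
  have cA': "continuous_on angle_box (\<lambda>z. A' (fst z) (snd z))" and cB': "continuous_on angle_box (\<lambda>z. B' (fst z) (snd z))"
    using cA cB continuous_on_subset by blast+
  have "integral angle_box (\<lambda>z. A' (fst z) (snd z))
      = integral (cbox 0 pi) (\<lambda>t. integral (cbox 0 (2 * pi)) (\<lambda>p. A' t p))"
    using integral_prod_continuous[OF cA'] by simp
  also have "\<dots> = integral (cbox 0 (2 * pi)) (\<lambda>p. integral (cbox 0 pi) (\<lambda>t. A' t p))"
    using cA' by (intro integral_swap_continuous) (simp add: case_prod_unfold)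
  also have "(\<lambda>p. integral (cbox 0 pi) (\<lambda>t. A' t p)) = (\<lambda>p. 0)"
  proof
    fix p
    have "((\<lambda>t. A' t p) has_integral (A pi p - A 0 p)) {0..pi}"
      by (rule fundamental_theorem_of_calculus)
        (auto intro!: has_field_derivative_at_within A simp flip: has_real_derivative_iff_has_vector_derivative)
    then show "integral (cbox 0 pi) (\<lambda>t. A' t p) = 0" using A0[of p] by (simp add: integral_unique)
  qed
  finally have 1: "integral angle_box (\<lambda>z. A' (fst z) (snd z)) = 0" by simp
  have "(\<lambda>t. integral (cbox 0 (2 * pi)) (\<lambda>p. B' t p)) = (\<lambda>t. 0)"
  proof
    fix t
    have "((\<lambda>p. B' t p) has_integral (B t (2 * pi) - B t 0)) {0..2 * pi}"
      by (rule fundamental_theorem_of_calculus)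
        (auto intro!: has_field_derivative_at_within B simp flip: has_real_derivative_iff_has_vector_derivative)
    then show "integral (cbox 0 (2 * pi)) (\<lambda>p. B' t p) = 0" using B0[of t] by (simp add: integral_unique)
  qed
  then have 2: "integral angle_box (\<lambda>z. B' (fst z) (snd z)) = 0"
    using integral_prod_continuous[OF cB'] by simp
  show ?thesis
    using 1 2 cA' cB' by (subst integral_add) (auto intro!: integrable_continuous)
qed

text \<open>Invariance of the area measure under infinitesimal rotations about the coordinate axes. In polar
  angle \<open>t\<close> and azimuth \<open>p\<close>, the density \<open>sin t\<close> times the
  derivative of \<open>f\<close> along the rotation field is a divergence of functions that vanish
  at the poles, respectively are periodic in \<open>p\<close>.\<close>

lemma sphere_integral_rotation:
  fixes f :: "real^3 \<Rightarrow> real"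
  assumes d: "\<And>x. (f has_derivative f' x) (at x)" and c: "\<And>v. continuous_on UNIV (\<lambda>x. f' x v)"
  shows "(\<integral>x. f' x (cross3 x (axis \<alpha> 1)) \<partial>sphere_area) = 0"
proof -
  let ?P = spherical_coords
  let ?D = "\<lambda>i t p. f' (?P (t, p)) (axis i 1)"
  have lin: "linear (f' x)" for x using d has_derivative_linear by blast
  have dec: "f' x v = v $ 1 * f' x (axis 1 1) + v $ 2 * f' x (axis 2 1) + v $ 3 * f' x (axis 3 1)" for x v
    by (subst sum_3_axis[of v]) (simp add: linear_add[OF lin] linear_scale[OF lin])
  have dt: "((\<lambda>t. f (?P (t, p))) has_real_derivative
      (cos t * cos p * ?D 1 t p + cos t * sin p * ?D 2 t p - sin t * ?D 3 t p)) (at t)" for t p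
  proof -
    have 1: "((\<lambda>t. ?P (t, p)) has_derivative (\<lambda>h. h *\<^sub>R ((cos t * cos p) *\<^sub>R axis 1 1 + (cos t * sin p) *\<^sub>R axis 2 1 - sin t *\<^sub>R axis 3 1))) (at t)"
      unfolding spherical_coords_eq by (auto intro!: derivative_eq_intros simp: algebra_simps)
    have "((\<lambda>t. f (?P (t, p))) has_derivative (\<lambda>h. f' (?P (t, p)) (h *\<^sub>R ((cos t * cos p) *\<^sub>R axis 1 1 + (cos t * sin p) *\<^sub>R axis 2 1 - sin t *\<^sub>R axis 3 1)))) (at t)"
      by (rule has_derivative_compose[OF 1 d])
    then show ?thesis unfolding has_field_derivative_def
      by (rule has_derivative_eq_rhs) (simp add: linear_add[OF lin] linear_diff[OF lin] linear_scale[OF lin] fun_eq_iff algebra_simps)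
  qed
  have dp: "((\<lambda>p. f (?P (t, p))) has_real_derivative
      (- sin t * sin p * ?D 1 t p + sin t * cos p * ?D 2 t p)) (at p)" for t p
  proof -
    have 1: "((\<lambda>p. ?P (t, p)) has_derivative (\<lambda>h. h *\<^sub>R ((- sin t * sin p) *\<^sub>R axis 1 1 + (sin t * cos p) *\<^sub>R axis 2 1))) (at p)"
      unfolding spherical_coords_eq by (auto intro!: derivative_eq_intros simp: algebra_simps)
    have "((\<lambda>p. f (?P (t, p))) has_derivative (\<lambda>h. f' (?P (t, p)) (h *\<^sub>R ((- sin t * sin p) *\<^sub>R axis 1 1 + (sin t * cos p) *\<^sub>R axis 2 1)))) (at p)"
      by (rule has_derivative_compose[OF 1 d])
    then show ?thesis unfolding has_field_derivative_def
      by (rule has_derivative_eq_rhs) (simp add: linear_add[OF lin] linear_diff[OF lin] linear_scale[OF lin] linear_neg[OF lin] fun_eq_iff algebra_simps)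
  qed
  have fc: "continuous_on UNIV f"
    using d by (meson continuous_at_imp_continuous_on has_derivative_continuous)
  have cf: "continuous_on UNIV (\<lambda>z. f (?P (fst z, snd z)))"
    using continuous_on_compose2[OF fc continuous_on_spherical_coords] by simp
  have cD: "continuous_on UNIV (\<lambda>z. ?D i (fst z) (snd z))" for i
    using continuous_on_compose2[OF c continuous_on_spherical_coords] by simp
  have cX: "continuous_on S2 (\<lambda>x. f' x (cross3 x (axis \<alpha> 1)))"
  proof -
    have n: "continuous_on S2 (\<lambda>x. cross3 x (axis \<alpha> 1) $ i)" for i
      using exhaust_3[of i] by (elim disjE; simp only: cross3_nth; intro continuous_intros)
    show ?thesis
      unfolding dec[of _ "cross3 _ _"]
      by (intro continuous_on_add continuous_on_mult n continuous_on_subset[OF c]) auto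
  qed
  have per: "?P (t, 0) = ?P (t, 2 * pi)" for t by (simp add: spherical_coords_eq)
  consider "\<alpha> = 1" | "\<alpha> = 2" | "\<alpha> = 3" using exhaust_3 by metis
  then have "integral angle_box (\<lambda>z. sin (fst z) * f' (?P z) (cross3 (?P z) (axis \<alpha> 1))) = 0"
  proof cases
    case 1
    have eq: "sin (fst z) * f' (?P z) (cross3 (?P z) (axis \<alpha> 1)) =
        (sin (snd z) * (cos (fst z) * f (?P (fst z, snd z)) + sin (fst z) *
          (cos (fst z) * cos (snd z) * ?D 1 (fst z) (snd z) + cos (fst z) * sin (snd z) * ?D 2 (fst z) (snd z) - sin (fst z) * ?D 3 (fst z) (snd z))))
        + (cos (fst z) * (- sin (snd z) * f (?P (fst z, snd z)) + cos (snd z) *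
          (- sin (fst z) * sin (snd z) * ?D 1 (fst z) (snd z) + sin (fst z) * cos (snd z) * ?D 2 (fst z) (snd z))))" for z
    proof -
      obtain t p where z: "z = (t, p)" by (cases z)
      have "sin p * sin p = 1 - cos p * cos p" using sin_cos_squared_add[of p] by (simp add: power2_eq_square)
      then show ?thesis unfolding 1 z dec[of _ "cross3 _ _"] fst_conv snd_conv
        by (simp add: cross3_def axis_def) Groebner_Basis.algebra
    qed
    show ?thesis unfolding eq
      by (rule integral_divergence_zero[where A="\<lambda>t p. sin p * (sin t * f (?P (t, p)))" and B="\<lambda>t p. cos t * (cos p * f (?P (t, p)))"])
        (auto intro!: derivative_eq_intros dt dp continuous_intros cf[simplified] cD[simplified] simp: per algebra_simps)
  next
    case 2
    have eq: "sin (fst z) * f' (?P z) (cross3 (?P z) (axis \<alpha> 1)) =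
        (- cos (snd z) * (cos (fst z) * f (?P (fst z, snd z)) + sin (fst z) *
          (cos (fst z) * cos (snd z) * ?D 1 (fst z) (snd z) + cos (fst z) * sin (snd z) * ?D 2 (fst z) (snd z) - sin (fst z) * ?D 3 (fst z) (snd z))))
        + (cos (fst z) * (cos (snd z) * f (?P (fst z, snd z)) + sin (snd z) *
          (- sin (fst z) * sin (snd z) * ?D 1 (fst z) (snd z) + sin (fst z) * cos (snd z) * ?D 2 (fst z) (snd z))))" for z
    proof -
      obtain t p where z: "z = (t, p)" by (cases z)
      have "sin p * sin p = 1 - cos p * cos p" using sin_cos_squared_add[of p] by (simp add: power2_eq_square)
      then show ?thesis unfolding 2 z dec[of _ "cross3 _ _"] fst_conv snd_conv
        by (simp add: cross3_def axis_def) Groebner_Basis.algebra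
    qed
    show ?thesis unfolding eq
      by (rule integral_divergence_zero[where A="\<lambda>t p. - cos p * (sin t * f (?P (t, p)))" and B="\<lambda>t p. cos t * (sin p * f (?P (t, p)))"])
        (auto intro!: derivative_eq_intros dt dp continuous_intros cf[simplified] cD[simplified] simp: per algebra_simps)
  next
    case 3
    have eq: "sin (fst z) * f' (?P z) (cross3 (?P z) (axis \<alpha> 1)) =
        (0::real) + (- sin (fst z) * (- sin (fst z) * sin (snd z) * ?D 1 (fst z) (snd z) + sin (fst z) * cos (snd z) * ?D 2 (fst z) (snd z)))" for z
    proof -
      obtain t p where z: "z = (t, p)" by (cases z)
      show ?thesis unfolding 3 z dec[of _ "cross3 _ _"] fst_conv snd_conv
        by (simp add: cross3_def axis_def) Groebner_Basis.algebra
    qed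
    show ?thesis unfolding eq
      by (rule integral_divergence_zero[where A="\<lambda>t p. 0" and B="\<lambda>t p. - sin t * f (?P (t, p))"])
        (auto intro!: derivative_eq_intros dt dp continuous_intros cf[simplified] cD[simplified] simp: per algebra_simps)
  qed
  then show ?thesis using sphere_integral(2)[OF cX] by simp
qed

lemma sphere_area_total: "(\<integral>x. 1 \<partial>sphere_area) = 4 * pi"
proof -
  have c: "continuous_on angle_box (\<lambda>z. sin (fst z))" by (intro continuous_intros)
  have s: "(sin has_integral 2) {0..pi}"
  proof -
    have "(sin has_integral (- cos pi - (- cos 0))) {0..pi}"
      by (rule fundamental_theorem_of_calculus)
        (auto intro!: derivative_eq_intros simp flip: has_real_derivative_iff_has_vector_derivative)
    then show ?thesis by simp
  qed
  have "(\<integral>x. 1 \<partial>sphere_area) = integral angle_box (\<lambda>z. sin (fst z))"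
    using sphere_integral(2)[of "\<lambda>_. 1"] by (simp del: lebesgue_integral_const)
  also have "\<dots> = integral (cbox 0 pi) (\<lambda>t. integral (cbox 0 (2 * pi)) (\<lambda>p. sin t))"
    using integral_prod_continuous[OF c] by simp
  also have "\<dots> = 2 * pi * integral {0..pi} sin" by simp
  also have "\<dots> = 4 * pi" using s by (simp add: integral_unique)
  finally show ?thesis .
qed

section \<open>Moments determined by rotation invariance\<close>
text \<open>The three properties of the functional on words that trace and integral share: asymptotic
  invariance under exchange of neighbouring letters, the relation that the squares of the
  coordinates sum to one, and invariance under the derivation that turns the letter \<open>a\<close>
  into \<open>b\<close> and \<open>b\<close> into \<open>-a\<close>. They are stated asymptotically,
  so that a constant sequence expresses the exact properties.\<close>

definition rotation_moments :: "complex \<Rightarrow> (nat \<Rightarrow> 3 list \<Rightarrow> complex) \<Rightarrow> bool" where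
  "rotation_moments c t \<longleftrightarrow>
     (\<forall>u a b v. (\<lambda>N. t N (u @ a # b # v) - t N (u @ b # a # v)) \<longlonglongrightarrow> 0) \<and>
     (\<forall>v. (\<lambda>N. (\<Sum>a\<in>UNIV. t N (a # a # v)) - t N v) \<longlonglongrightarrow> 0) \<and>
     (\<forall>w a b. a \<noteq> b \<longrightarrow> (\<lambda>N. \<Sum>k<length w. (if w ! k = a then t N (w[k := b]) else 0)
                            - (if w ! k = b then t N (w[k := a]) else 0)) \<longlonglongrightarrow> 0) \<and>
     (\<lambda>N. t N []) \<longlonglongrightarrow> c"

lemma rotation_moments_diff:
  assumes "rotation_moments c t" "rotation_moments d s"
  shows "rotation_moments (c - d) (\<lambda>N w. t N w - s N w)"
  unfolding rotation_moments_def
proof (intro conjI allI impI)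
  fix u v w :: "3 list" and a b :: 3
  show "(\<lambda>N. (t N (u @ a # b # v) - s N (u @ a # b # v)) - (t N (u @ b # a # v) - s N (u @ b # a # v))) \<longlonglongrightarrow> 0"
    using tendsto_diff[of "\<lambda>N. t N (u @ a # b # v) - t N (u @ b # a # v)" 0 sequentially "\<lambda>N. s N (u @ a # b # v) - s N (u @ b # a # v)" 0] assms
    unfolding rotation_moments_def by (simp add: algebra_simps)
  show "(\<lambda>N. (\<Sum>a\<in>UNIV. t N (a # a # v) - s N (a # a # v)) - (t N v - s N v)) \<longlonglongrightarrow> 0"
    using tendsto_diff[of "\<lambda>N. (\<Sum>a\<in>UNIV. t N (a # a # v)) - t N v" 0 sequentially "\<lambda>N. (\<Sum>a\<in>UNIV. s N (a # a # v)) - s N v" 0] assms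
    unfolding rotation_moments_def by (simp add: algebra_simps sum_subtractf)
  show "(\<lambda>N. t N [] - s N []) \<longlonglongrightarrow> c - d"
    using assms unfolding rotation_moments_def by (intro tendsto_diff) auto
  assume ab: "a \<noteq> b"
  let ?f = "\<lambda>t N. \<Sum>k<length w. (if w ! k = a then t N (w[k := b]) else 0) - (if w ! k = b then t N (w[k := a]) else (0::complex))"
  have "?f t \<longlonglongrightarrow> 0" "?f s \<longlonglongrightarrow> 0"
    using assms ab unfolding rotation_moments_def by blast+
  then have "(\<lambda>N. ?f t N - ?f s N) \<longlonglongrightarrow> 0 - 0" by (rule tendsto_diff)
  moreover have "(\<lambda>N. ?f t N - ?f s N) = ?f (\<lambda>N w. t N w - s N w)"
    by (auto simp: fun_eq_iff sum_subtractf[symmetric] intro!: sum.cong)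
  ultimately show "?f (\<lambda>N w. t N w - s N w) \<longlonglongrightarrow> 0" by simp
qed

lemma tendsto_zero_trans:
  fixes f g h :: "nat \<Rightarrow> complex"
  assumes "(\<lambda>N. f N - g N) \<longlonglongrightarrow> 0" "(\<lambda>N. g N - h N) \<longlonglongrightarrow> 0"
  shows "(\<lambda>N. f N - h N) \<longlonglongrightarrow> 0"
  using tendsto_add[OF assms] by simp

lemma asymptotic_permutation:
  assumes sw: "\<And>u a b v. (\<lambda>N. t N (u @ a # b # v) - t N (u @ b # a # v)) \<longlonglongrightarrow> (0::complex)"
  shows "mset w = mset w' \<Longrightarrow> (\<lambda>N. t N (u @ w) - t N (u @ w')) \<longlonglongrightarrow> 0"
proof (induction w arbitrary: w' u)
  case Nil
  then show ?case by simp
next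
  case (Cons a r)
  have move: "(\<lambda>N. t N (u @ a # p @ q) - t N (u @ p @ a # q)) \<longlonglongrightarrow> 0" for p q u
  proof (induction p arbitrary: u)
    case Nil
    then show ?case by simp
  next
    case (Cons x p)
    from tendsto_zero_trans[OF sw[of u a x "p @ q"], of "\<lambda>N. t N (u @ x # p @ a # q)"] Cons[of "u @ [x]"]
    show ?case by simp
  qed
  have "a \<in> set w'" using Cons.prems by (metis list.set_intros(1) mset_eq_setD)
  then obtain p q where w': "w' = p @ a # q" by (meson split_list)
  with Cons.prems have "mset r = mset (p @ q)" by simp
  from Cons.IH[OF this, of "u @ [a]"]
  have "(\<lambda>N. t N (u @ a # r) - t N (u @ a # p @ q)) \<longlonglongrightarrow> 0" by simp
  from tendsto_zero_trans[OF this move] show ?case by (simp add: w')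
qed

text \<open>Induction on the length of a word \<open>a v\<close> of length \<open>n\<close>. Summing over
  \<open>b\<close> the invariance under the rotation in the plane of \<open>a\<close> and
  \<open>b\<close>, applied to the word \<open>b v\<close>, and reordering letters leaves \<open>-(n
  + 1)\<close> times the functional at \<open>a v\<close>, plus values at words from which a pair of
  equal letters has been removed; the latter are covered by the induction hypothesis.\<close>

lemma rotation_moments_zero:
  assumes "rotation_moments 0 d"
  shows "(\<lambda>N. d N w) \<longlonglongrightarrow> 0"
proof (induction "length w" arbitrary: w rule: less_induct)
  case less
  have sw: "\<And>u a b v. (\<lambda>N. d N (u @ a # b # v) - d N (u @ b # a # v)) \<longlonglongrightarrow> 0"
    and cas: "\<And>v. (\<lambda>N. (\<Sum>a\<in>UNIV. d N (a # a # v)) - d N v) \<longlonglongrightarrow> 0"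
    and rot: "\<And>w a b. a \<noteq> b \<Longrightarrow> (\<lambda>N. \<Sum>k<length w. (if w ! k = a then d N (w[k := b]) else 0)
                            - (if w ! k = b then d N (w[k := a]) else 0)) \<longlonglongrightarrow> 0"
    and nil: "(\<lambda>N. d N []) \<longlonglongrightarrow> 0"
    using assms unfolding rotation_moments_def by blast+
  have perm: "(\<lambda>N. d N w - d N w') \<longlonglongrightarrow> 0" if "mset w = mset w'" for w w'
    using asymptotic_permutation[of d w w' "[]"] sw that by simp
  show ?case
  proof (cases w)
    case Nil
    then show ?thesis using nil by simp
  next
    case w: (Cons a v)
    let ?R = "\<lambda>N b. \<Sum>k<length (b # v). (if (b # v) ! k = a then d N ((b # v)[k := b]) else 0)
                            - (if (b # v) ! k = b then d N ((b # v)[k := a]) else 0)"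
    have R: "(\<lambda>N. ?R N b) \<longlonglongrightarrow> 0" for b
      using rot[of a b "b # v"] by (cases "a = b") auto
    have R_eq: "?R N b = (if b = a then d N (a # v) else 0) - d N (a # v) +
        (\<Sum>i<length v. (if v ! i = a then d N (b # v[i := b]) else 0) - (if v ! i = b then d N (v ! i # v[i := a]) else 0))" for N b
      unfolding list.size sum.lessThan_Suc_shift add_Suc_right add_0_right
      by (auto intro!: sum.cong)
    have sumR: "(\<Sum>b\<in>UNIV. ?R N b) = - 2 * d N (a # v) +
        (\<Sum>i<length v. (if v ! i = a then \<Sum>b\<in>UNIV. d N (b # v[i := b]) else 0) - d N (v ! i # v[i := a]))" for N
    proof -
      let ?F = "\<lambda>b i. (if v ! i = a then d N (b # v[i := b]) else 0) - (if v ! i = b then d N (v ! i # v[i := a]) else 0)"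
      have "(\<Sum>b\<in>UNIV. ?R N b) = (\<Sum>b\<in>UNIV. ((if b = a then d N (a # v) else 0) - d N (a # v)) + (\<Sum>i<length v. ?F b i))"
        by (intro sum.cong refl R_eq)
      also have "\<dots> = (\<Sum>b\<in>UNIV. (if b = a then d N (a # v) else 0) - d N (a # v)) + (\<Sum>i<length v. \<Sum>b\<in>UNIV. ?F b i)"
        unfolding sum.distrib by (subst sum.swap) (rule refl)
      also have "(\<Sum>b\<in>UNIV. (if b = a then d N (a # v) else 0) - d N (a # v)) = - 2 * d N (a # v)"
        by (simp add: sum_subtractf)
      also have "(\<lambda>i. \<Sum>b\<in>UNIV. ?F b i) = (\<lambda>i. (if v ! i = a then \<Sum>b\<in>UNIV. d N (b # v[i := b]) else 0) - d N (v ! i # v[i := a]))"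
        by (auto simp: fun_eq_iff sum_subtractf)
      finally show ?thesis .
    qed
    have "(\<lambda>N. \<Sum>b\<in>UNIV. ?R N b) \<longlonglongrightarrow> (\<Sum>b\<in>(UNIV::3 set). 0)"
      by (intro tendsto_sum R)
    then have S: "(\<lambda>N. - 2 * d N (a # v) +
        (\<Sum>i<length v. (if v ! i = a then \<Sum>b\<in>UNIV. d N (b # v[i := b]) else 0) - d N (v ! i # v[i := a]))) \<longlonglongrightarrow> 0"
      unfolding sumR by simp
    \<comment> \<open>the two kinds of remaining terms: one reduces to shorter words, the other to
      the word \<open>a # v\<close> itself\<close>
    have swap_first: "mset (v ! i # v[i := c]) = mset (c # v)" if "i < length v" for i c
      using that by (simp add: mset_update)
    have A: "(\<lambda>N. \<Sum>b\<in>UNIV. d N (b # v[i := b])) \<longlonglongrightarrow> 0" if i: "i < length v" for i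
    proof -
      let ?v = "take i v @ drop (Suc i) v"
      have "mset (b # v[i := b]) = mset (b # b # ?v)" for b
        using i by (simp add: upd_conv_take_nth_drop)
      then have "(\<lambda>N. \<Sum>b\<in>UNIV. (d N (b # v[i := b]) - d N (b # b # ?v))) \<longlonglongrightarrow> (\<Sum>b\<in>(UNIV::3 set). 0)"
        by (intro tendsto_sum perm)
      from tendsto_add[OF this cas[of ?v]]
      have "(\<lambda>N. (\<Sum>b\<in>UNIV. d N (b # v[i := b])) - d N ?v) \<longlonglongrightarrow> 0"
        by (simp add: sum_subtractf)
      moreover have "(\<lambda>N. d N ?v) \<longlonglongrightarrow> 0"
        using i w by (intro less) auto
      ultimately have "(\<lambda>N. ((\<Sum>b\<in>UNIV. d N (b # v[i := b])) - d N ?v) + d N ?v) \<longlonglongrightarrow> 0 + 0"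
        by (rule tendsto_add)
      then show ?thesis by simp
    qed
    have B: "(\<lambda>N. d N (v ! i # v[i := a]) - d N (a # v)) \<longlonglongrightarrow> 0" if "i < length v" for i
      by (rule perm[OF swap_first[OF that]])
    have "(\<lambda>N. (\<Sum>i<length v. (if v ! i = a then \<Sum>b\<in>UNIV. d N (b # v[i := b]) else 0) - (d N (v ! i # v[i := a]) - d N (a # v))))
        \<longlonglongrightarrow> (\<Sum>i<length v. (if v ! i = a then 0 else 0) - 0)"
    proof (intro tendsto_sum tendsto_diff B)
      fix i assume "i \<in> {..<length v}"
      then show "(\<lambda>N. if v ! i = a then \<Sum>b\<in>UNIV. d N (b # v[i := b]) else 0) \<longlonglongrightarrow> (if v ! i = a then 0 else 0)"
        using A[of i] by (cases "v ! i = a") auto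
    qed auto
    from tendsto_diff[OF S this]
    have "(\<lambda>N. - (2 + of_nat (length v)) * d N (a # v)) \<longlonglongrightarrow> 0"
      by (simp add: sum_subtractf algebra_simps)
    moreover define c where "c = (2 + of_nat (length v) :: complex)"
    ultimately have "(\<lambda>N. - c * d N (a # v)) \<longlonglongrightarrow> 0" by simp
    from tendsto_mult_left[OF this, of "- inverse c"]
    have "(\<lambda>N. - inverse c * (- c * d N (a # v))) \<longlonglongrightarrow> 0" by simp
    moreover have "c \<noteq> 0"
      unfolding c_def by (metis of_nat_numeral of_nat_add of_nat_eq_0_iff add_eq_0_iff_both_eq_0 zero_neq_numeral)
    ultimately show ?thesis by (simp add: w flip: mult.assoc)
  qed
qed

lemma rotation_moments_unique:
  assumes "rotation_moments c t" "rotation_moments c (\<lambda>_. s)"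
  shows "(\<lambda>N. t N w) \<longlonglongrightarrow> s w"
proof -
  have "(\<lambda>N. t N w - s w) \<longlonglongrightarrow> 0"
    using rotation_moments_zero[of "\<lambda>N w. t N w - s w" w] rotation_moments_diff[OF assms] by simp
  then show ?thesis by (simp add: LIM_zero_iff)
qed

definition word_fun :: "3 list \<Rightarrow> real^3 \<Rightarrow> real" where
  "word_fun w x = prod_list (map (\<lambda>a. x $ a) w)"

primrec word_deriv :: "3 list \<Rightarrow> real^3 \<Rightarrow> real^3 \<Rightarrow> real" where
  "word_deriv [] x h = 0"
| "word_deriv (a # w) x h = h $ a * word_fun w x + x $ a * word_deriv w x h"

lemma word_fun_simps [simp]:
  "word_fun [] x = 1" "word_fun (a # w) x = x $ a * word_fun w x"
  "word_fun (u @ w) x = word_fun u x * word_fun w x"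
  by (simp_all add: word_fun_def)

lemma continuous_on_word_fun [continuous_intros]: "continuous_on A (word_fun w)"
proof (induction w)
  case (Cons a w)
  have "word_fun (a # w) = (\<lambda>x. x $ a * word_fun w x)" by (simp add: fun_eq_iff)
  then show ?case using Cons by (auto intro!: continuous_intros)
qed (simp add: word_fun_def)

lemma has_derivative_word_fun: "(word_fun w has_derivative word_deriv w x) (at x)"
proof (induction w)
  case Nil
  have "word_fun [] = (\<lambda>x. 1)" "word_deriv [] x = (\<lambda>h. 0)" by (auto simp: fun_eq_iff)
  then show ?case by simp
next
  case (Cons a w)
  have 1: "((\<lambda>x. x $ a) has_derivative (\<lambda>h. h $ a)) (at x)"
    by (intro bounded_linear_imp_has_derivative bounded_linear_vec_nth)
  have 2: "word_fun (a # w) = (\<lambda>x. x $ a * word_fun w x)" by (simp add: fun_eq_iff)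
  show ?case unfolding 2
    by (rule has_derivative_eq_rhs[OF has_derivative_mult[OF 1 Cons]]) (auto simp: fun_eq_iff algebra_simps)
qed

lemma continuous_on_word_deriv: "continuous_on A (\<lambda>x. word_deriv w x h)"
  by (induction w) (auto intro!: continuous_intros)

text \<open>The derivative of a monomial along the field \<open>x\<^sub>b \<partial>\<^sub>a - x\<^sub>a
  \<partial>\<^sub>b\<close>, in the form in which it occurs in the third condition on
  \<open>rotation_moments\<close>.\<close>

lemma word_deriv_rotation:
  assumes "a \<noteq> b" and h: "\<And>c. h $ c = (if c = a then x $ b else if c = b then - x $ a else 0)"
  shows "word_deriv w x h = (\<Sum>k<length w. (if w ! k = a then word_fun (w[k := b]) x else 0)
            - (if w ! k = b then word_fun (w[k := a]) x else 0))"
proof (induction w)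
  case (Cons c w)
  have "(\<Sum>k<length (c # w). (if (c # w) ! k = a then word_fun ((c # w)[k := b]) x else 0)
            - (if (c # w) ! k = b then word_fun ((c # w)[k := a]) x else 0))
    = h $ c * word_fun w x + (\<Sum>k<length w. x $ c * ((if w ! k = a then word_fun (w[k := b]) x else 0)
            - (if w ! k = b then word_fun (w[k := a]) x else 0)))"
    unfolding list.size sum.lessThan_Suc_shift add_Suc_right add_0_right
    using assms by (intro arg_cong2[where f="(+)"] sum.cong) (auto simp: algebra_simps)
  then show ?case by (simp add: Cons flip: sum_distrib_left)
qed simp

lemma rotation_field:
  assumes "a \<noteq> (b :: 3)"
  shows "\<exists>c s. \<forall>x :: real^3. \<forall>i. (s *\<^sub>R cross3 x (axis c 1)) $ i = (if i = a then x $ b else if i = b then - x $ a else 0)"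
proof -
  consider "a = 1 \<and> b = 2" | "a = 2 \<and> b = 1" | "a = 2 \<and> b = 3" | "a = 3 \<and> b = 2" | "a = 3 \<and> b = 1" | "a = 1 \<and> b = 3"
    using exhaust_3[of a] exhaust_3[of b] assms by auto
  then show ?thesis
  proof cases
    case 1 then show ?thesis unfolding forall_3 by (intro exI[of _ 3] exI[of _ 1]) (simp add: cross3_nth axis_def)
  next
    case 2 then show ?thesis unfolding forall_3 by (intro exI[of _ 3] exI[of _ "-1"]) (simp add: cross3_nth axis_def)
  next
    case 3 then show ?thesis unfolding forall_3 by (intro exI[of _ 1] exI[of _ 1]) (simp add: cross3_nth axis_def)
  next
    case 4 then show ?thesis unfolding forall_3 by (intro exI[of _ 1] exI[of _ "-1"]) (simp add: cross3_nth axis_def)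
  next
    case 5 then show ?thesis unfolding forall_3 by (intro exI[of _ 2] exI[of _ 1]) (simp add: cross3_nth axis_def)
  next
    case 6 then show ?thesis unfolding forall_3 by (intro exI[of _ 2] exI[of _ "-1"]) (simp add: cross3_nth axis_def)
  qed
qed

lemma rotation_moments_sphere:
  "rotation_moments (4 * pi) (\<lambda>_ w. complex_of_real (\<integral>x. word_fun w x \<partial>sphere_area))"
proof -
  have int: "integrable sphere_area (word_fun w)" for w
    by (rule sphere_integral(1)) (rule continuous_on_word_fun)
  have cas: "(\<Sum>a\<in>UNIV. (\<integral>x. word_fun (a # a # v) x \<partial>sphere_area)) = (\<integral>x. word_fun v x \<partial>sphere_area)" for v
  proof -
    have "(\<Sum>a\<in>UNIV. (\<integral>x. word_fun (a # a # v) x \<partial>sphere_area)) = (\<integral>x. (\<Sum>a\<in>UNIV. word_fun (a # a # v) x) \<partial>sphere_area)"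
      by (rule Bochner_Integration.integral_sum[symmetric]) (rule int)
    also have "\<dots> = (\<integral>x. word_fun v x \<partial>sphere_area)"
    proof (rule Bochner_Integration.integral_cong[OF refl])
      fix x :: "real^3" assume "x \<in> space sphere_area"
      then have "x $ 1 * x $ 1 + x $ 2 * x $ 2 + x $ 3 * x $ 3 = 1"
        by (simp add: norm_eq_1 inner_vec_def sum_3)
      then have "(x $ 1 * x $ 1 + x $ 2 * x $ 2 + x $ 3 * x $ 3) * word_fun v x = word_fun v x" by simp
      then show "(\<Sum>a\<in>UNIV. word_fun (a # a # v) x) = word_fun v x"
        by (simp add: sum_3 algebra_simps)
    qed
    finally show ?thesis .
  qed
  have rot: "(\<Sum>k<length w. (if w ! k = a then (\<integral>x. word_fun (w[k := b]) x \<partial>sphere_area) else 0)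
      - (if w ! k = b then (\<integral>x. word_fun (w[k := a]) x \<partial>sphere_area) else 0)) = 0" if ab: "a \<noteq> b" for w a b
  proof -
    obtain c s where cs: "\<And>x :: real^3. \<And>i. (s *\<^sub>R cross3 x (axis c 1)) $ i = (if i = a then x $ b else if i = b then - x $ a else 0)"
      using rotation_field[OF ab] by blast
    have lin: "word_deriv w x (s *\<^sub>R h) = s * word_deriv w x h" for x h
      by (induction w) (auto simp: algebra_simps)
    have int': "integrable sphere_area (\<lambda>x. if P then word_fun u x else 0)" for P u
      using int by (cases P) (auto intro: integrable_zero)
    have pull: "(\<integral>x. (if P then word_fun u x else 0) \<partial>sphere_area) = (if P then (\<integral>x. word_fun u x \<partial>sphere_area) else 0)" for P u
      by auto
    have "(\<integral>x. word_deriv w x (s *\<^sub>R cross3 x (axis c 1)) \<partial>sphere_area) = 0"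
      unfolding lin using sphere_integral_rotation[OF has_derivative_word_fun continuous_on_word_deriv, of w c] by simp
    then show ?thesis
      unfolding word_deriv_rotation[OF ab cs]
      by (subst (asm) Bochner_Integration.integral_sum)
        (auto simp: int' Bochner_Integration.integral_diff pull)
  qed
  show ?thesis
    unfolding rotation_moments_def
  proof (intro conjI allI impI)
    fix v show "(\<lambda>N. (\<Sum>a\<in>UNIV. complex_of_real (\<integral>x. word_fun (a # a # v) x \<partial>sphere_area)) - complex_of_real (\<integral>x. word_fun v x \<partial>sphere_area)) \<longlonglongrightarrow> 0"
      unfolding of_real_sum[symmetric] cas by simp
  next
    fix w and a b :: 3 assume "a \<noteq> b"
    from arg_cong[OF rot[OF this, of w], of complex_of_real]
    have "(\<Sum>k<length w. (if w ! k = a then complex_of_real (\<integral>x. word_fun (w[k := b]) x \<partial>sphere_area) else 0)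
      - (if w ! k = b then complex_of_real (\<integral>x. word_fun (w[k := a]) x \<partial>sphere_area) else 0)) = 0"
      by (simp add: if_distrib[of complex_of_real] cong: if_cong)
    then show "(\<lambda>N. \<Sum>k<length w. (if w ! k = a then complex_of_real (\<integral>x. word_fun (w[k := b]) x \<partial>sphere_area) else 0)
      - (if w ! k = b then complex_of_real (\<integral>x. word_fun (w[k := a]) x \<partial>sphere_area) else 0)) \<longlonglongrightarrow> 0"
      by simp
  next
    fix u v and a b :: 3
    have "word_fun (u @ a # b # v) = word_fun (u @ b # a # v)" by (simp add: fun_eq_iff)
    then show "(\<lambda>N. complex_of_real (\<integral>x. word_fun (u @ a # b # v) x \<partial>sphere_area) - complex_of_real (\<integral>x. word_fun (u @ b # a # v) x \<partial>sphere_area)) \<longlonglongrightarrow> 0"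
      by simp
  next
    have "(\<integral>x. word_fun [] x \<partial>sphere_area) = 4 * pi"
      using sphere_area_total by (simp only: word_fun_simps)
    then show "(\<lambda>N. complex_of_real (\<integral>x. word_fun [] x \<partial>sphere_area)) \<longlonglongrightarrow> 4 * pi" by simp
  qed
qed

section \<open>The quantized coordinates\<close>
text \<open>The Hermitian versions \<open>-\<i> X\<^sub>\<alpha>\<close> of the quantized coordinates; their
  spectra are real and approximate the interval from \<open>-1\<close> to \<open>1\<close>.\<close>

definition coord_mat :: "nat \<Rightarrow> 3 \<Rightarrow> complex mat" where
  "coord_mat N a = (- \<i>) \<cdot>\<^sub>m quant_coord N a"

text \<open>The off-diagonal entries of the first coordinate matrix, up to sign and phase those of the second.\<close>

definition ladder :: "nat \<Rightarrow> nat \<Rightarrow> real" where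
  "ladder N j = hbar N * ladder_coeff N (weight N j) / 2"

lemma hbar_pos: "N \<ge> 2 \<Longrightarrow> hbar N > 0"
proof -
  assume "N \<ge> 2"
  then have "(real N)\<^sup>2 \<ge> 2\<^sup>2" by (intro power_mono) auto
  then show ?thesis unfolding hbar_def by (intro divide_pos_pos real_sqrt_gt_zero) auto
qed

lemma hbar_sq: "N \<ge> 2 \<Longrightarrow> (hbar N)\<^sup>2 * ((real N)\<^sup>2 - 1) = 4"
proof -
  assume "N \<ge> 2"
  then have "(real N)\<^sup>2 \<ge> 2\<^sup>2" by (intro power_mono) auto
  then have nz: "(real N)\<^sup>2 - 1 > 0" by simp
  then have "(hbar N)\<^sup>2 = 4 / ((real N)\<^sup>2 - 1)" unfolding hbar_def by (simp add: power_divide)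
  moreover have "(real N)\<^sup>2 - 1 \<noteq> 0" using nz by simp
  ultimately show ?thesis by (metis nonzero_eq_divide_eq)
qed

lemma hbar_tendsto: "hbar \<longlonglongrightarrow> 0"
proof -
  have "(\<lambda>N. 2 / sqrt ((real N)\<^sup>2 - 1)) \<longlonglongrightarrow> 0" by real_asymp
  then show ?thesis unfolding hbar_def[abs_def] .
qed

lemma ladder_sq: "j < N \<Longrightarrow> 4 * (ladder N j)\<^sup>2 = (hbar N)\<^sup>2 * (real (N - 1 - j) * real (Suc j))"
proof -
  assume j: "j < N"
  have "(real N - 1) / 2 * ((real N - 1) / 2 + 1) - weight N j * (weight N j + 1) = real (N - 1 - j) * real (Suc j)"
    using j by (simp add: weight_def of_nat_diff field_simps)
  then have "ladder_coeff N (weight N j) = sqrt (real (N - 1 - j) * real (Suc j))"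
    by (simp add: ladder_coeff_def Let_def)
  then show ?thesis by (simp add: ladder_def power_mult_distrib power_divide)
qed

lemma ladder_nonneg: "N \<ge> 2 \<Longrightarrow> j < N \<Longrightarrow> 0 \<le> ladder N j"
proof -
  assume N: "N \<ge> 2" and j: "j < N"
  have "(real N - 1) / 2 * ((real N - 1) / 2 + 1) - weight N j * (weight N j + 1) = real (N - 1 - j) * real (Suc j)"
    using j by (simp add: weight_def of_nat_diff field_simps)
  then show ?thesis
    using hbar_pos[OF N] by (simp add: ladder_def ladder_coeff_def Let_def)
qed

lemma coord_mat_1:
  "coord_mat N 1 = Matrix.mat N N (\<lambda>(j, k). if k = Suc j then of_real (ladder N j) else if j = Suc k then of_real (ladder N k) else 0)"
  by (rule eq_matI) (auto simp: coord_mat_def quant_coord_def spin1_def ladder_def complex_eq_iff)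

lemma coord_mat_2:
  "coord_mat N 2 = Matrix.mat N N (\<lambda>(j, k). if k = Suc j then - \<i> * of_real (ladder N j) else if j = Suc k then \<i> * of_real (ladder N k) else 0)"
  by (rule eq_matI) (auto simp: coord_mat_def quant_coord_def spin2_def ladder_def complex_eq_iff)

lemma coord_mat_3: "coord_mat N 3 = mat_diag N (\<lambda>j. of_real (hbar N * weight N j))"
  by (rule eq_matI) (auto simp: coord_mat_def quant_coord_def spin3_def mat_diag_def complex_eq_iff)

lemma coord_mat_carrier [simp]: "coord_mat N a \<in> carrier_mat N N"
  using exhaust_3[of a] by (auto simp: coord_mat_1 coord_mat_2 coord_mat_3)

lemma coord_mat_dims [simp]: "dim_row (coord_mat N a) = N" "dim_col (coord_mat N a) = N"
  using carrier_matD[OF coord_mat_carrier] by blast+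

lemma quant_coord_eq: "quant_coord N a = \<i> \<cdot>\<^sub>m coord_mat N a"
  by (rule eq_matI) (auto simp: coord_mat_def)

lemma quant_coord_carrier [simp]: "quant_coord N a \<in> carrier_mat N N"
  by (simp add: quant_coord_eq)

lemma quant_coord_dims [simp]: "dim_row (quant_coord N a) = N" "dim_col (quant_coord N a) = N"
  by (simp_all add: quant_coord_eq)

lemma minus_carrier_square [simp]:
  "A \<in> carrier_mat n n \<Longrightarrow> B \<in> carrier_mat n n \<Longrightarrow> A - B \<in> carrier_mat n n"
  by (rule minus_carrier_mat)

lemma mat_diag_dims [simp]: "dim_row (mat_diag n d) = n" "dim_col (mat_diag n d) = n"
  by (simp_all add: mat_diag_def)

lemma imaginary_unit_mult: "\<i> * x * (\<i> * y) = - (x * y)" "\<i> * (x * (\<i> * y)) = - (x * y)"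
  by (simp_all add: complex_eq_iff)

lemma tridiagonal_mult:
  assumes T: "T = Matrix.mat N N (\<lambda>(j, k). if k = Suc j then a j else if j = Suc k then b k else (0::complex))"
    and M: "M \<in> carrier_mat N N" and jk: "j < N" "k < N"
  shows "(T * M) $$ (j, k) = (if Suc j < N then a j * M $$ (Suc j, k) else 0) + (if 0 < j then b (j - 1) * M $$ (j - 1, k) else 0)"
proof -
  have Tc: "T \<in> carrier_mat N N" by (simp add: T)
  have "(T * M) $$ (j, k) = (\<Sum>m<N. T $$ (j, m) * M $$ (m, k))" by (rule mat_mult_index[OF Tc M jk])
  also have "\<dots> = (\<Sum>m<N. (if m = Suc j then a j * M $$ (Suc j, k) else 0) + (if m = j - 1 then (if 0 < j then b (j - 1) * M $$ (j - 1, k) else 0) else 0))"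
    using jk by (intro sum.cong refl) (auto simp: T)
  also have "\<dots> = (if Suc j < N then a j * M $$ (Suc j, k) else 0) + (if 0 < j then b (j - 1) * M $$ (j - 1, k) else 0)"
    using jk by (simp add: sum.distrib sum.delta)
  finally show ?thesis .
qed

lemmas tridiagonal_mult_1 = tridiagonal_mult[OF coord_mat_1]
lemmas tridiagonal_mult_2 = tridiagonal_mult[OF coord_mat_2]

lemma diag_mult_index:
  fixes d :: "nat \<Rightarrow> complex"
  assumes "M \<in> carrier_mat N N" "j < N" "k < N"
  shows "(mat_diag N d * M) $$ (j, k) = d j * M $$ (j, k)" "(M * mat_diag N d) $$ (j, k) = M $$ (j, k) * d k"
  using assms by (simp_all add: mat_diag_mult_left mat_diag_mult_right[of _ N])

lemma coord_index:
  assumes "j < N" "k < N"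
  shows "coord_mat N 1 $$ (j, k) = (if k = Suc j then of_real (ladder N j) else if j = Suc k then of_real (ladder N k) else 0)"
    "coord_mat N 2 $$ (j, k) = (if k = Suc j then - \<i> * of_real (ladder N j) else if j = Suc k then \<i> * of_real (ladder N k) else 0)"
    "coord_mat N 3 $$ (j, k) = (if j = k then of_real (hbar N * weight N j) else 0)"
  using assms by (auto simp: coord_mat_1 coord_mat_2 coord_mat_3 mat_diag_def)

lemma ladder_sq_up:
  assumes "j < N"
  shows "4 * (if Suc j < N then (ladder N j)\<^sup>2 else 0) = (hbar N)\<^sup>2 * ((real N - 1 - real j) * (real j + 1))"
proof -
  have r: "real (N - 1 - j) = real N - 1 - real j" using assms by (simp add: of_nat_diff)
  show ?thesis
  proof (cases "Suc j < N")
    case True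
    then show ?thesis using ladder_sq[OF assms] by (simp only: r of_nat_Suc if_True add.commute)
  next
    case False
    then have "real N - 1 - real j = 0" using assms by simp
    then show ?thesis using False by simp
  qed
qed

lemma ladder_sq_down:
  assumes "j < N"
  shows "4 * (if 0 < j then (ladder N (j - 1))\<^sup>2 else 0) = (hbar N)\<^sup>2 * ((real N - real j) * real j)"
proof (cases j)
  case (Suc i)
  have r: "real (N - 1 - i) = real N - real (Suc i)" using assms Suc by (simp add: of_nat_diff)
  have i: "i < N" using assms Suc by simp
  show ?thesis unfolding Suc diff_Suc_1 using ladder_sq[OF i] unfolding r by simp
qed simp

text \<open>The two expressions in squared ladder entries that occur in products of tridiagonal matrices:
  their difference gives the commutation relations, their sum (the next lemma) the relation of the
  sphere. At the last row the ladder entry vanishes, which makes the case distinctions harmless.\<close>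

lemma ladder_diff:
  assumes "j < N" "N \<ge> 2"
  shows "2 * (if Suc j < N then (ladder N j)\<^sup>2 else 0) - 2 * (if 0 < j then (ladder N (j - 1))\<^sup>2 else 0) = - hbar N * (hbar N * weight N j)"
proof -
  have 1: "4 * (if Suc j < N then (ladder N j)\<^sup>2 else 0) = (hbar N)\<^sup>2 * ((real N - 1 - real j) * (real j + 1))"
    using ladder_sq_up assms by blast
  have 2: "4 * (if 0 < j then (ladder N (j - 1))\<^sup>2 else 0) = (hbar N)\<^sup>2 * ((real N - real j) * real j)"
    using ladder_sq_down assms by blast
  have "2 * (2 * (if Suc j < N then (ladder N j)\<^sup>2 else 0) - 2 * (if 0 < j then (ladder N (j - 1))\<^sup>2 else 0))
      = (hbar N)\<^sup>2 * ((real N - 1 - real j) * (real j + 1)) - (hbar N)\<^sup>2 * ((real N - real j) * real j)"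
    using 1 2 by simp
  also have "\<dots> = 2 * (- hbar N * (hbar N * weight N j))"
  proof -
    have "(real N - 1 - real j) * (real j + 1) - (real N - real j) * real j = - 2 * weight N j"
      by (simp add: weight_def field_simps)
    then have "(hbar N)\<^sup>2 * ((real N - 1 - real j) * (real j + 1) - (real N - real j) * real j)
      = (hbar N)\<^sup>2 * (- 2 * weight N j)" by simp
    then show ?thesis by (simp add: right_diff_distrib power2_eq_square mult_ac)
  qed
  finally show ?thesis by simp
qed

lemma ladder_sum:
  assumes "j < N" "N \<ge> 2"
  shows "2 * (if Suc j < N then (ladder N j)\<^sup>2 else 0) + 2 * (if 0 < j then (ladder N (j - 1))\<^sup>2 else 0) = 1 - (hbar N * weight N j)\<^sup>2"
proof -
  have 1: "4 * (if Suc j < N then (ladder N j)\<^sup>2 else 0) = (hbar N)\<^sup>2 * ((real N - 1 - real j) * (real j + 1))"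
    using ladder_sq_up assms by blast
  have 2: "4 * (if 0 < j then (ladder N (j - 1))\<^sup>2 else 0) = (hbar N)\<^sup>2 * ((real N - real j) * real j)"
    using ladder_sq_down assms by blast
  have "2 * (2 * (if Suc j < N then (ladder N j)\<^sup>2 else 0) + 2 * (if 0 < j then (ladder N (j - 1))\<^sup>2 else 0))
      = (hbar N)\<^sup>2 * ((real N - 1 - real j) * (real j + 1)) + (hbar N)\<^sup>2 * ((real N - real j) * real j)"
    using 1 2 by simp
  also have "\<dots> = (hbar N)\<^sup>2 * ((real N)\<^sup>2 - 1) / 2 - 2 * (hbar N * weight N j)\<^sup>2"
  proof -
    have "(real N - 1 - real j) * (real j + 1) + (real N - real j) * real j = ((real N)\<^sup>2 - 1) / 2 - 2 * (weight N j)\<^sup>2"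
      by (simp add: weight_def power2_eq_square field_simps)
    then have "(hbar N)\<^sup>2 * ((real N - 1 - real j) * (real j + 1) + (real N - real j) * real j)
      = (hbar N)\<^sup>2 * (((real N)\<^sup>2 - 1) / 2 - 2 * (weight N j)\<^sup>2)" by simp
    then show ?thesis by (simp only: power_mult_distrib distrib_left right_diff_distrib times_divide_eq_right mult.left_commute)
  qed
  finally show ?thesis using hbar_sq[OF assms(2)] by simp
qed

lemma coord_comm:
  assumes N: "N \<ge> 2"
  shows "commutator (coord_mat N 1) (coord_mat N 2) = (- \<i> * of_real (hbar N)) \<cdot>\<^sub>m coord_mat N 3"
    "commutator (coord_mat N 2) (coord_mat N 3) = (- \<i> * of_real (hbar N)) \<cdot>\<^sub>m coord_mat N 1"
    "commutator (coord_mat N 3) (coord_mat N 1) = (- \<i> * of_real (hbar N)) \<cdot>\<^sub>m coord_mat N 2"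
proof -
  show "commutator (coord_mat N 1) (coord_mat N 2) = (- \<i> * of_real (hbar N)) \<cdot>\<^sub>m coord_mat N 3"
  proof (rule eq_matI)
    fix j k assume "j < dim_row ((- \<i> * of_real (hbar N)) \<cdot>\<^sub>m coord_mat N 3)" "k < dim_col ((- \<i> * of_real (hbar N)) \<cdot>\<^sub>m coord_mat N 3)"
    then have jk: "j < N" "k < N" by auto
    have "commutator (coord_mat N 1) (coord_mat N 2) $$ (j, k)
        = (if j = k then \<i> * of_real (2 * (if Suc j < N then (ladder N j)\<^sup>2 else 0) - 2 * (if 0 < j then (ladder N (j - 1))\<^sup>2 else 0)) else 0)"
    proof -
      have "commutator (coord_mat N 1) (coord_mat N 2) $$ (j, k)
        = (coord_mat N 1 * coord_mat N 2) $$ (j, k) - (coord_mat N 2 * coord_mat N 1) $$ (j, k)"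
        using jk by (simp add: commutator_def del: index_mult_mat(1))
      then show ?thesis
        unfolding tridiagonal_mult_1[OF coord_mat_carrier jk] tridiagonal_mult_2[OF coord_mat_carrier jk]
        using jk by (cases j; simp only: power2_eq_square) (auto simp: coord_index imaginary_unit_mult algebra_simps cong: if_cong)
    qed
    also have "\<dots> = ((- \<i> * of_real (hbar N)) \<cdot>\<^sub>m coord_mat N 3) $$ (j, k)"
      unfolding ladder_diff[OF jk(1) N] using jk by (simp add: coord_index)
    finally show "commutator (coord_mat N 1) (coord_mat N 2) $$ (j, k) = ((- \<i> * of_real (hbar N)) \<cdot>\<^sub>m coord_mat N 3) $$ (j, k)" .
  qed (auto simp: commutator_def)
  have w: "of_real (weight N (Suc j)) = (of_real (weight N j) + 1 :: complex)" for j
    by (simp add: weight_def)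
  show "commutator (coord_mat N 2) (coord_mat N 3) = (- \<i> * of_real (hbar N)) \<cdot>\<^sub>m coord_mat N 1"
    by (rule eq_matI) (auto simp: commutator_def coord_mat_3 diag_mult_index coord_index w algebra_simps simp del: index_mult_mat(1))
  show "commutator (coord_mat N 3) (coord_mat N 1) = (- \<i> * of_real (hbar N)) \<cdot>\<^sub>m coord_mat N 2"
    by (rule eq_matI) (auto simp: commutator_def coord_mat_3 diag_mult_index coord_index w algebra_simps simp del: index_mult_mat(1))
qed

text \<open>The squares sum to exactly the identity: this is what the normalization of \<open>\<hbar>\<close>
  achieves.\<close>

lemma coord_casimir:
  assumes N: "N \<ge> 2"
  shows "coord_mat N 1 * coord_mat N 1 + coord_mat N 2 * coord_mat N 2 + coord_mat N 3 * coord_mat N 3 = 1\<^sub>m N"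
proof (rule eq_matI)
  fix j k assume "j < dim_row (1\<^sub>m N)" "k < dim_col (1\<^sub>m N)"
  then have jk: "j < N" "k < N" by auto
  have "(coord_mat N 1 * coord_mat N 1 + coord_mat N 2 * coord_mat N 2 + coord_mat N 3 * coord_mat N 3) $$ (j, k)
      = (if j = k then of_real (2 * (if Suc j < N then (ladder N j)\<^sup>2 else 0) + 2 * (if 0 < j then (ladder N (j - 1))\<^sup>2 else 0) + (hbar N * weight N j)\<^sup>2) else 0)"
  proof -
    have d: "dim_row (coord_mat N a) = N" "dim_col (coord_mat N a) = N" for a
      using coord_mat_carrier[of N a] by auto
    have "(coord_mat N 1 * coord_mat N 1 + coord_mat N 2 * coord_mat N 2 + coord_mat N 3 * coord_mat N 3) $$ (j, k)
      = (coord_mat N 1 * coord_mat N 1) $$ (j, k) + (coord_mat N 2 * coord_mat N 2) $$ (j, k) + (coord_mat N 3 * coord_mat N 3) $$ (j, k)"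
      using jk by (simp add: d del: index_mult_mat(1))
    moreover have "(coord_mat N 3 * coord_mat N 3) $$ (j, k) = (if j = k then (of_real (hbar N * weight N j))\<^sup>2 else 0)"
      using jk by (simp add: coord_mat_3 power2_eq_square) (simp add: mat_diag_def)
    moreover have "(coord_mat N 1 * coord_mat N 1) $$ (j, k) + (coord_mat N 2 * coord_mat N 2) $$ (j, k)
      = (if j = k then of_real (2 * (if Suc j < N then (ladder N j)\<^sup>2 else 0) + 2 * (if 0 < j then (ladder N (j - 1))\<^sup>2 else 0)) else 0)"
      unfolding tridiagonal_mult_1[OF coord_mat_carrier jk] tridiagonal_mult_2[OF coord_mat_carrier jk]
      using jk by (cases j) (auto simp: coord_index power2_eq_square imaginary_unit_mult)
    ultimately show ?thesis by simp
  qed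
  also have "\<dots> = 1\<^sub>m N $$ (j, k)"
    unfolding ladder_sum[OF jk(1) N] using jk by simp
  finally show "(coord_mat N 1 * coord_mat N 1 + coord_mat N 2 * coord_mat N 2 + coord_mat N 3 * coord_mat N 3) $$ (j, k) = 1\<^sub>m N $$ (j, k)" .
qed auto

text \<open>The rescaled adjoint action. The factor \<open>1/\<hbar>\<close> makes it the analogue of the
  bracket with a coordinate, and keeps it of order one on words in the coordinate matrices.\<close>

definition ad :: "nat \<Rightarrow> 3 \<Rightarrow> complex mat \<Rightarrow> complex mat" where
  "ad N a A = of_real (1 / hbar N) \<cdot>\<^sub>m commutator (quant_coord N a) A"

lemma ad_carrier [simp]: "A \<in> carrier_mat N N \<Longrightarrow> ad N a A \<in> carrier_mat N N"
  by (simp add: ad_def commutator_def)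

lemma commutator_carrier [simp]: "A \<in> carrier_mat n n \<Longrightarrow> B \<in> carrier_mat n n \<Longrightarrow> commutator A B \<in> carrier_mat n n"
  by (simp add: commutator_def)

lemma ad_eq:
  assumes "A \<in> carrier_mat N N"
  shows "ad N a A = (\<i> / of_real (hbar N)) \<cdot>\<^sub>m commutator (coord_mat N a) A"
  using assms carrier_matD[OF assms] unfolding ad_def commutator_def quant_coord_eq
  by (intro eq_matI) (auto simp: mult_smult_distrib[of _ N N _ N] mult_smult_assoc_mat[of _ N N _ N] algebra_simps)

lemma commutator_swap: "A \<in> carrier_mat n n \<Longrightarrow> B \<in> carrier_mat n n \<Longrightarrow> commutator A B = - commutator B A"
  by (rule eq_matI) (auto simp: commutator_def)

lemma commutator_self: "A \<in> carrier_mat n n \<Longrightarrow> commutator A A = 0\<^sub>m n n"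
  by (rule eq_matI) (auto simp: commutator_def)

text \<open>The same table as for the brackets of the coordinate functions on the sphere, without error terms.\<close>

lemma ad_coord:
  assumes N: "N \<ge> 2"
  shows "ad N 1 (coord_mat N 1) = 0\<^sub>m N N" "ad N 1 (coord_mat N 2) = coord_mat N 3" "ad N 1 (coord_mat N 3) = - coord_mat N 2"
    "ad N 2 (coord_mat N 1) = - coord_mat N 3" "ad N 2 (coord_mat N 2) = 0\<^sub>m N N" "ad N 2 (coord_mat N 3) = coord_mat N 1"
    "ad N 3 (coord_mat N 1) = coord_mat N 2" "ad N 3 (coord_mat N 2) = - coord_mat N 1" "ad N 3 (coord_mat N 3) = 0\<^sub>m N N"
proof -
  have h: "hbar N \<noteq> 0" using hbar_pos[OF N] by simp
  have s: "(\<i> / of_real (hbar N)) \<cdot>\<^sub>m ((- \<i> * of_real (hbar N)) \<cdot>\<^sub>m A) = A" for A :: "complex mat"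
    using h by (intro eq_matI) auto
  have s': "(\<i> / of_real (hbar N)) \<cdot>\<^sub>m (- ((- \<i> * of_real (hbar N)) \<cdot>\<^sub>m A)) = - A" for A :: "complex mat"
    using h by (intro eq_matI) auto
  note sw = commutator_swap[OF coord_mat_carrier coord_mat_carrier, of N]
  show "ad N 1 (coord_mat N 1) = 0\<^sub>m N N" "ad N 2 (coord_mat N 2) = 0\<^sub>m N N" "ad N 3 (coord_mat N 3) = 0\<^sub>m N N"
    by (simp_all add: ad_eq commutator_self[of _ N])
  show "ad N 1 (coord_mat N 2) = coord_mat N 3" "ad N 2 (coord_mat N 3) = coord_mat N 1" "ad N 3 (coord_mat N 1) = coord_mat N 2"
    by (simp_all only: ad_eq coord_mat_carrier coord_comm[OF N] s)
  show "ad N 1 (coord_mat N 3) = - coord_mat N 2" "ad N 2 (coord_mat N 1) = - coord_mat N 3" "ad N 3 (coord_mat N 2) = - coord_mat N 1"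
    by (simp_all only: ad_eq coord_mat_carrier sw[of 1 3] sw[of 2 1] sw[of 3 2] coord_comm[OF N] s')
qed

lemma ad_mult:
  assumes A: "A \<in> carrier_mat N N" and B: "B \<in> carrier_mat N N"
  shows "ad N a (A * B) = ad N a A * B + A * ad N a B"
proof -
  let ?X = "quant_coord N a" and ?c = "of_real (1 / hbar N) :: complex"
  have X: "?X \<in> carrier_mat N N" by simp
  have "commutator ?X (A * B) = commutator ?X A * B + A * commutator ?X B"
    unfolding commutator_def using A B X carrier_matD[OF A] carrier_matD[OF B]
    by (intro eq_matI) (auto simp: minus_mult_distrib_mat[of _ N N _ _ N] mult_minus_distrib_mat[of _ N N _ N] assoc_mult_mat[of _ N N _ N _ N])
  then show ?thesis
    unfolding ad_def using A B X
    by (simp add: add_smult_distrib_left_mat[of _ N N] mult_smult_distrib[of _ N N _ N] mult_smult_assoc_mat[of _ N N _ N])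
qed

lemma ad_add:
  assumes A: "A \<in> carrier_mat N N" and B: "B \<in> carrier_mat N N"
  shows "ad N a (A + B) = ad N a A + ad N a B"
proof -
  let ?X = "quant_coord N a"
  have X: "?X \<in> carrier_mat N N" by simp
  show ?thesis
    unfolding ad_def commutator_def using A B X carrier_matD[OF A] carrier_matD[OF B]
    by (intro eq_matI) (auto simp: add_mult_distrib_mat[of _ N N _ _ N] mult_add_distrib_mat[of _ N N _ N] algebra_simps)
qed

lemma ad_smult:
  assumes A: "A \<in> carrier_mat N N"
  shows "ad N a (c \<cdot>\<^sub>m A) = c \<cdot>\<^sub>m ad N a A"
proof -
  let ?X = "quant_coord N a"
  have X: "?X \<in> carrier_mat N N" by simp
  show ?thesis
    unfolding ad_def commutator_def using A X carrier_matD[OF A]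
    by (intro eq_matI) (auto simp: mult_smult_distrib[of _ N N _ N] mult_smult_assoc_mat[of _ N N _ N] algebra_simps)
qed

lemma ad_one: "ad N a (1\<^sub>m N) = 0\<^sub>m N N"
  unfolding ad_def commutator_def by (simp only: one_mult_square[OF quant_coord_carrier]) (auto intro!: eq_matI)

text \<open>The matrix analogue of \<open>rotation_field\<close>: every rotation in a coordinate plane is a
  multiple of a rotation about a coordinate axis.\<close>

lemma rotation_field_mat:
  assumes "a \<noteq> (b :: 3)"
  shows "\<exists>c s. \<forall>N\<ge>2. \<forall>i. of_real s \<cdot>\<^sub>m ad N c (coord_mat N i) =
    (if i = a then coord_mat N b else if i = b then - coord_mat N a else 0\<^sub>m N N)"
proof -
  have m1: "- 1 \<cdot>\<^sub>m A = - A" "1 \<cdot>\<^sub>m A = A" "- (- A) = A" "c \<cdot>\<^sub>m 0\<^sub>m N N = 0\<^sub>m N N" for A :: "complex mat" and c :: complex and N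
    by (auto intro!: eq_matI)
  consider "a = 1 \<and> b = 2" | "a = 2 \<and> b = 1" | "a = 2 \<and> b = 3" | "a = 3 \<and> b = 2" | "a = 3 \<and> b = 1" | "a = 1 \<and> b = 3"
    using exhaust_3[of a] exhaust_3[of b] assms by auto
  then show ?thesis
  proof cases
    case 1 then show ?thesis unfolding forall_3 by (intro exI[of _ 3] exI[of _ 1]) (simp add: ad_coord m1)
  next
    case 2 then show ?thesis unfolding forall_3 by (intro exI[of _ 3] exI[of _ "-1"]) (simp add: ad_coord m1)
  next
    case 3 then show ?thesis unfolding forall_3 by (intro exI[of _ 1] exI[of _ 1]) (simp add: ad_coord m1)
  next
    case 4 then show ?thesis unfolding forall_3 by (intro exI[of _ 1] exI[of _ "-1"]) (simp add: ad_coord m1)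
  next
    case 5 then show ?thesis unfolding forall_3 by (intro exI[of _ 2] exI[of _ 1]) (simp add: ad_coord m1)
  next
    case 6 then show ?thesis unfolding forall_3 by (intro exI[of _ 2] exI[of _ "-1"]) (simp add: ad_coord m1)
  qed
qed


section \<open>Row sums, traces and words\<close>

text \<open>The operator norm for the supremum norm on vectors. It is submultiplicative and bounds both traces
  and eigenvalues, which is all that is required of a norm here.\<close>

definition row_bound :: "nat \<Rightarrow> complex mat \<Rightarrow> real \<Rightarrow> bool" where
  "row_bound N A C \<longleftrightarrow> 0 \<le> C \<and> (\<forall>i<N. (\<Sum>j<N. cmod (A $$ (i, j))) \<le> C)"

lemma row_bound_add:
  assumes "A \<in> carrier_mat N N" "B \<in> carrier_mat N N" "row_bound N A C" "row_bound N B D"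
  shows "row_bound N (A + B) (C + D)"
  unfolding row_bound_def
proof (intro conjI allI impI)
  fix i assume i: "i < N"
  have "(\<Sum>j<N. cmod ((A + B) $$ (i, j))) \<le> (\<Sum>j<N. cmod (A $$ (i, j)) + cmod (B $$ (i, j)))"
    using assms i by (intro sum_mono) (auto intro: norm_triangle_ineq)
  then show "(\<Sum>j<N. cmod ((A + B) $$ (i, j))) \<le> C + D"
    using assms i unfolding row_bound_def sum.distrib by (meson add_mono order_trans)
qed (use assms in \<open>auto simp: row_bound_def\<close>)

lemma row_bound_smult:
  assumes "A \<in> carrier_mat N N" "row_bound N A C"
  shows "row_bound N (c \<cdot>\<^sub>m A) (cmod c * C)"
  using assms by (auto simp: row_bound_def norm_mult intro!: mult_left_mono simp flip: sum_distrib_left)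

lemma row_bound_mult:
  assumes "A \<in> carrier_mat N N" "B \<in> carrier_mat N N" "row_bound N A C" "row_bound N B D"
  shows "row_bound N (A * B) (C * D)"
  unfolding row_bound_def
proof (intro conjI allI impI)
  fix i assume i: "i < N"
  have "(\<Sum>j<N. cmod ((A * B) $$ (i, j))) \<le> (\<Sum>j<N. \<Sum>k<N. cmod (A $$ (i, k)) * cmod (B $$ (k, j)))"
    using i by (intro sum_mono) (auto simp: mat_mult_index[OF assms(1,2)] norm_mult intro!: order_trans[OF norm_sum] simp flip: norm_mult)
  also have "\<dots> = (\<Sum>k<N. cmod (A $$ (i, k)) * (\<Sum>j<N. cmod (B $$ (k, j))))"
    by (subst sum.swap) (simp add: sum_distrib_left)
  also have "\<dots> \<le> (\<Sum>k<N. cmod (A $$ (i, k)) * D)"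
    using assms by (intro sum_mono mult_left_mono) (auto simp: row_bound_def)
  also have "\<dots> \<le> C * D"
    using assms i unfolding row_bound_def sum_distrib_right[symmetric] by (intro mult_right_mono) auto
  finally show "(\<Sum>j<N. cmod ((A * B) $$ (i, j))) \<le> C * D" .
qed (use assms in \<open>auto simp: row_bound_def\<close>)

lemma row_bound_one: "row_bound N (1\<^sub>m N) 1"
  by (auto simp: row_bound_def if_distrib[of cmod] cong: if_cong)

lemma row_bound_mono: "row_bound N A C \<Longrightarrow> C \<le> D \<Longrightarrow> row_bound N A D"
  by (force simp: row_bound_def)

lemma ladder_le_one:
  assumes N: "N \<ge> 2" and j: "j < N"
  shows "ladder N j \<le> 1"
proof -
  have "real (N - 1 - j) * real (Suc j) = (real N)\<^sup>2 / 4 - (real (Suc j) - real N / 2)\<^sup>2"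
    using j by (simp add: of_nat_diff power2_eq_square field_simps)
  then have "real (N - 1 - j) * real (Suc j) \<le> (real N)\<^sup>2 / 4" by simp
  then have "4 * (ladder N j)\<^sup>2 \<le> (hbar N)\<^sup>2 * ((real N)\<^sup>2 / 4)"
    unfolding ladder_sq[OF j] by (intro mult_left_mono) auto
  also have "\<dots> \<le> (hbar N)\<^sup>2 * ((real N)\<^sup>2 - 1)"
  proof (intro mult_left_mono)
    have "(real N)\<^sup>2 \<ge> 2\<^sup>2" using N by (intro power_mono) auto
    then show "(real N)\<^sup>2 / 4 \<le> (real N)\<^sup>2 - 1" by simp
  qed simp
  also have "\<dots> = 4" by (rule hbar_sq[OF N])
  finally have "(ladder N j)\<^sup>2 \<le> 1\<^sup>2" by simp
  then show ?thesis by (rule power2_le_imp_le) simp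
qed

lemma hbar_weight_le_one:
  assumes N: "N \<ge> 2" and j: "j < N"
  shows "\<bar>hbar N * weight N j\<bar> \<le> 1"
proof -
  have "(hbar N * weight N j)\<^sup>2 \<le> 1\<^sup>2"
    using ladder_sum[OF j N] by (simp split: if_splits) (smt (verit) zero_le_power2)+
  then show ?thesis by (simp only: power_one abs_square_le_1)
qed

lemma row_bound_coord:
  assumes N: "N \<ge> 2"
  shows "row_bound N (coord_mat N a) 2"
proof -
  have tri: "(\<Sum>k<N. if k = Suc j then ladder N j else if j = Suc k then ladder N k else 0) \<le> 2" if j: "j < N" for j
  proof -
    have "(\<Sum>k<N. if k = Suc j then ladder N j else if j = Suc k then ladder N k else 0)
      \<le> (\<Sum>k<N. (if k = Suc j then 1 else 0) + (if k = j - 1 then 1 else 0))"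
      using j ladder_le_one[OF N] by (intro sum_mono) auto
    also have "\<dots> \<le> 2" by (simp add: sum.distrib)
    finally show ?thesis .
  qed
  have nn: "\<bar>ladder N k\<bar> = ladder N k" if "k < N" for k using ladder_nonneg[OF N that] by simp
  consider "a = 1" | "a = 2" | "a = 3" using exhaust_3 by metis
  then show ?thesis
  proof cases
    case 1
    have "(\<Sum>k<N. cmod (coord_mat N a $$ (j, k))) = (\<Sum>k<N. if k = Suc j then ladder N j else if j = Suc k then ladder N k else 0)" if "j < N" for j
      using that unfolding 1 by (intro sum.cong) (auto simp: coord_index nn)
    then show ?thesis using tri by (simp add: row_bound_def)
  next
    case 2
    have "(\<Sum>k<N. cmod (coord_mat N a $$ (j, k))) = (\<Sum>k<N. if k = Suc j then ladder N j else if j = Suc k then ladder N k else 0)" if "j < N" for j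
      using that unfolding 2 by (intro sum.cong) (auto simp: coord_index norm_mult nn)
    then show ?thesis using tri by (simp add: row_bound_def)
  next
    case 3
    have "(\<Sum>k<N. cmod (coord_mat N a $$ (j, k))) = (\<Sum>k<N. if k = j then \<bar>hbar N * weight N j\<bar> else 0)" if "j < N" for j
      using that unfolding 3 by (intro sum.cong) (auto simp: coord_index norm_mult abs_mult)
    then show ?thesis using hbar_weight_le_one[OF N] by (force simp: row_bound_def)
  qed
qed

text \<open>The trace, normalized to agree with the area of the sphere on the identity matrix.\<close>

definition area_trace :: "nat \<Rightarrow> complex mat \<Rightarrow> complex" where
  "area_trace N A = of_real (4 * pi / real N) * mat_trace N A"

lemma area_trace_linear:
  assumes "A \<in> carrier_mat N N" "B \<in> carrier_mat N N"
  shows "area_trace N (A + B) = area_trace N A + area_trace N B" "area_trace N (A - B) = area_trace N A - area_trace N B"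
  using assms by (simp_all add: area_trace_def mat_trace_def sum.distrib sum_subtractf algebra_simps)

lemma area_trace_smult: "A \<in> carrier_mat N N \<Longrightarrow> area_trace N (c \<cdot>\<^sub>m A) = c * area_trace N A"
  by (simp add: area_trace_def mat_trace_def mult.left_commute flip: sum_distrib_left)

lemma area_trace_zero [simp]: "area_trace N (0\<^sub>m N N) = 0"
  by (simp add: area_trace_def mat_trace_def)

lemma area_trace_one: "N \<ge> 1 \<Longrightarrow> area_trace N (1\<^sub>m N) = 4 * of_real pi"
  by (simp add: area_trace_def mat_trace_def)

lemma area_trace_uminus: "A \<in> carrier_mat N N \<Longrightarrow> area_trace N (- A) = - area_trace N A"
  by (simp add: area_trace_def mat_trace_def sum_negf)

lemma area_trace_comm:
  "A \<in> carrier_mat N N \<Longrightarrow> B \<in> carrier_mat N N \<Longrightarrow> area_trace N (A * B) = area_trace N (B * A)"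
  by (simp add: area_trace_def mat_trace_mult_comm)

lemma area_trace_ad: "A \<in> carrier_mat N N \<Longrightarrow> area_trace N (ad N a A) = 0"
  by (simp add: ad_def area_trace_smult commutator_def area_trace_linear area_trace_comm[of A])

lemma area_trace_bound:
  assumes "row_bound N A C" "N \<ge> 1"
  shows "cmod (area_trace N A) \<le> 4 * pi * C"
proof -
  have "cmod (mat_trace N A) \<le> (\<Sum>i<N. cmod (A $$ (i, i)))"
    unfolding mat_trace_def by (rule norm_sum)
  also have "\<dots> \<le> (\<Sum>i<N. C)"
  proof (intro sum_mono)
    fix i assume "i \<in> {..<N}"
    then have i: "i < N" by simp
    then have "cmod (A $$ (i, i)) \<le> (\<Sum>j<N. cmod (A $$ (i, j)))"
      by (intro member_le_sum) auto
    then show "cmod (A $$ (i, i)) \<le> C" using assms i unfolding row_bound_def by force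
  qed
  finally have "cmod (mat_trace N A) \<le> real N * C" by simp
  then have "4 * pi / real N * cmod (mat_trace N A) \<le> 4 * pi / real N * (real N * C)"
    by (intro mult_left_mono) auto
  then show ?thesis using assms by (simp add: area_trace_def norm_mult norm_divide)
qed

primrec word_mat :: "nat \<Rightarrow> 3 list \<Rightarrow> complex mat" where
  "word_mat N [] = 1\<^sub>m N"
| "word_mat N (a # w) = coord_mat N a * word_mat N w"

lemma word_mat_carrier [simp]: "word_mat N w \<in> carrier_mat N N"
  by (induction w) auto

lemma word_mat_append: "word_mat N (u @ w) = word_mat N u * word_mat N w"
  by (induction u) (auto simp: assoc_mult_mat[of _ N N _ N _ N])

lemma row_bound_word: "N \<ge> 2 \<Longrightarrow> row_bound N (word_mat N w) (2 ^ length w)"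
  by (induction w) (auto simp: row_bound_one intro!: row_bound_mult row_bound_coord)

text \<open>Two letters commute up to a factor \<open>\<hbar>\<close> times a matrix that is bounded uniformly
  in \<open>N\<close>.\<close>

lemma coord_swap:
  assumes N: "N \<ge> 2"
  shows "coord_mat N a * coord_mat N b - coord_mat N b * coord_mat N a = (- \<i> * of_real (hbar N)) \<cdot>\<^sub>m ad N a (coord_mat N b)"
  using hbar_pos[OF N] by (intro eq_matI) (auto simp: ad_eq commutator_def)

lemma row_bound_uminus: "A \<in> carrier_mat N N \<Longrightarrow> row_bound N A C \<Longrightarrow> row_bound N (- A) C"
  by (auto simp: row_bound_def)

lemma row_bound_ad_coord:
  assumes N: "N \<ge> 2"
  shows "row_bound N (ad N a (coord_mat N b)) 2"
proof -
  have z: "row_bound N (0\<^sub>m N N) 2" by (simp add: row_bound_def)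
  show ?thesis
    using exhaust_3[of a] exhaust_3[of b] z row_bound_coord[OF N] row_bound_uminus[OF coord_mat_carrier row_bound_coord[OF N]]
    by (elim disjE) (simp_all add: ad_coord[OF N])
qed

text \<open>The product rule for a derivation along a word, after multiplication by a fixed matrix
  \<open>U\<close> on the left. The generality in \<open>U\<close> is what lets the induction on the
  word go through.\<close>

lemma area_trace_rotation:
  assumes D: "\<And>A B. A \<in> carrier_mat N N \<Longrightarrow> B \<in> carrier_mat N N \<Longrightarrow> D (A * B) = D A * B + A * D B"
    and Dc: "\<And>A. A \<in> carrier_mat N N \<Longrightarrow> D A \<in> carrier_mat N N" and D1: "D (1\<^sub>m N) = 0\<^sub>m N N"
    and Dx: "\<And>i. D (coord_mat N i) = (if i = a then coord_mat N b else if i = b then - coord_mat N a else 0\<^sub>m N N)"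
    and ab: "a \<noteq> b"
  shows "U \<in> carrier_mat N N \<Longrightarrow> area_trace N (U * D (word_mat N w)) =
    (\<Sum>k<length w. (if w ! k = a then area_trace N (U * word_mat N (w[k := b])) else 0)
       - (if w ! k = b then area_trace N (U * word_mat N (w[k := a])) else 0))"
proof (induction w arbitrary: U)
  case Nil
  then show ?case by (simp add: D1)
next
  case (Cons i w)
  let ?W = "word_mat N w" and ?x = "coord_mat N i"
  have "area_trace N (U * D (word_mat N (i # w))) = area_trace N (U * (D ?x * ?W)) + area_trace N (U * (?x * D ?W))"
    using Cons.prems Dc by (simp add: D mult_add_distrib_mat[of _ N N _ N] area_trace_linear)
  also have "area_trace N (U * (?x * D ?W)) = area_trace N ((U * ?x) * D ?W)"
    using Cons.prems Dc by (simp add: assoc_mult_mat[of _ N N _ N _ N])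
  also have "\<dots> = (\<Sum>k<length w. (if w ! k = a then area_trace N (U * ?x * word_mat N (w[k := b])) else 0)
       - (if w ! k = b then area_trace N (U * ?x * word_mat N (w[k := a])) else 0))"
    using Cons.prems by (intro Cons.IH) simp
  also have "\<dots> = (\<Sum>k<length w. (if (i # w) ! Suc k = a then area_trace N (U * word_mat N ((i # w)[Suc k := b])) else 0)
       - (if (i # w) ! Suc k = b then area_trace N (U * word_mat N ((i # w)[Suc k := a])) else 0))"
    using Cons.prems by (intro sum.cong refl) (auto simp: assoc_mult_mat[of _ N N _ N _ N])
  also have "area_trace N (U * (D ?x * ?W)) = (if (i # w) ! 0 = a then area_trace N (U * word_mat N ((i # w)[0 := b])) else 0)
       - (if (i # w) ! 0 = b then area_trace N (U * word_mat N ((i # w)[0 := a])) else 0)"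
    using Cons.prems ab
    by (auto simp: Dx area_trace_uminus carrier_matD[OF word_mat_carrier])
  finally show ?case by (simp only: list.size sum.lessThan_Suc_shift add_Suc_right add_0_right)
qed

lemma rotation_moments_area_trace: "rotation_moments (4 * pi) (\<lambda>N w. area_trace N (word_mat N w))"
  unfolding rotation_moments_def
proof (intro conjI allI impI)
  fix u v :: "3 list" and a b :: 3
  let ?C = "2 ^ length u * (2 * 2 ^ length v)"
  have eq: "area_trace N (word_mat N (u @ a # b # v)) - area_trace N (word_mat N (u @ b # a # v))
      = (- \<i> * of_real (hbar N)) * area_trace N (word_mat N u * (ad N a (coord_mat N b) * word_mat N v))" if N: "N \<ge> 2" for N
  proof -
    let ?U = "word_mat N u" and ?V = "word_mat N v" and ?x = "coord_mat N"
    have "area_trace N (word_mat N (u @ a # b # v)) - area_trace N (word_mat N (u @ b # a # v))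
        = area_trace N (?U * ((?x a * ?x b - ?x b * ?x a) * ?V))"
      by (simp add: word_mat_append minus_mult_distrib_mat[of _ N N _ _ N] mult_minus_distrib_mat[of _ N N _ N] area_trace_linear assoc_mult_mat[of _ N N _ N _ N])
    also have "?x a * ?x b - ?x b * ?x a = (- \<i> * of_real (hbar N)) \<cdot>\<^sub>m ad N a (?x b)"
      by (rule coord_swap[OF N])
    also have "?U * (\<dots> * ?V) = (- \<i> * of_real (hbar N)) \<cdot>\<^sub>m (?U * (ad N a (?x b) * ?V))"
      by (simp add: mult_smult_distrib[of _ N N _ N] mult_smult_assoc_mat[of _ N N _ N])
    also have "area_trace N \<dots> = (- \<i> * of_real (hbar N)) * area_trace N (?U * (ad N a (?x b) * ?V))"
      by (rule area_trace_smult) simp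
    finally show ?thesis .
  qed
  have "\<forall>\<^sub>F N in sequentially. norm (area_trace N (word_mat N (u @ a # b # v)) - area_trace N (word_mat N (u @ b # a # v))) \<le> hbar N * (4 * pi * ?C)"
    using eventually_ge_at_top[of 2]
  proof eventually_elim
    case (elim N)
    have "cmod (area_trace N (word_mat N u * (ad N a (coord_mat N b) * word_mat N v))) \<le> 4 * pi * ?C"
      using elim by (intro area_trace_bound row_bound_mult row_bound_word row_bound_ad_coord) auto
    then show ?case unfolding eq[OF elim] using hbar_pos[OF elim] by (simp add: norm_mult)
  qed
  moreover have "(\<lambda>N. hbar N * (4 * pi * ?C)) \<longlonglongrightarrow> 0"
    by (rule tendsto_mult_left_zero[OF hbar_tendsto])
  ultimately show "(\<lambda>N. area_trace N (word_mat N (u @ a # b # v)) - area_trace N (word_mat N (u @ b # a # v))) \<longlonglongrightarrow> 0"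
    by (rule Lim_null_comparison)
next
  fix v :: "3 list"
  have "\<forall>\<^sub>F N in sequentially. 0 = (\<Sum>a\<in>UNIV. area_trace N (word_mat N (a # a # v))) - area_trace N (word_mat N v)"
    using eventually_ge_at_top[of 2]
  proof eventually_elim
    case (elim N)
    let ?V = "word_mat N v" and ?x = "coord_mat N"
    have "area_trace N ?V = area_trace N ((?x 1 * ?x 1 + ?x 2 * ?x 2 + ?x 3 * ?x 3) * ?V)"
      by (simp add: coord_casimir[OF elim])
    also have "\<dots> = (\<Sum>a\<in>UNIV. area_trace N (word_mat N (a # a # v)))"
      by (simp add: sum_3 add_mult_distrib_mat[of _ N N _ _ N] area_trace_linear assoc_mult_mat[of _ N N _ N _ N])
    finally show ?case by simp
  qed
  then show "(\<lambda>N. (\<Sum>a\<in>UNIV. area_trace N (word_mat N (a # a # v))) - area_trace N (word_mat N v)) \<longlonglongrightarrow> 0"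
    by (rule Lim_transform_eventually[OF tendsto_const])
next
  fix w and a b :: 3 assume ab: "a \<noteq> b"
  obtain c s where cs: "\<And>N i. N \<ge> 2 \<Longrightarrow> of_real s \<cdot>\<^sub>m ad N c (coord_mat N i) =
    (if i = a then coord_mat N b else if i = b then - coord_mat N a else 0\<^sub>m N N)"
    using rotation_field_mat[OF ab] by blast
  have "\<forall>\<^sub>F N in sequentially. 0 = (\<Sum>k<length w. (if w ! k = a then area_trace N (word_mat N (w[k := b])) else 0)
       - (if w ! k = b then area_trace N (word_mat N (w[k := a])) else 0))"
    using eventually_ge_at_top[of 2]
  proof eventually_elim
    case (elim N)
    let ?D = "\<lambda>A. of_real s \<cdot>\<^sub>m ad N c A"
    have "area_trace N (1\<^sub>m N * ?D (word_mat N w)) = (\<Sum>k<length w. (if w ! k = a then area_trace N (1\<^sub>m N * word_mat N (w[k := b])) else 0)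
       - (if w ! k = b then area_trace N (1\<^sub>m N * word_mat N (w[k := a])) else 0))"
    proof (rule area_trace_rotation[OF _ _ _ cs[OF elim] ab])
      fix A B :: "complex mat" assume AB: "A \<in> carrier_mat N N" "B \<in> carrier_mat N N"
      then show "?D (A * B) = ?D A * B + A * ?D B"
        by (simp add: ad_mult add_smult_distrib_left_mat[of _ N N] mult_smult_distrib[of _ N N _ N] mult_smult_assoc_mat[of _ N N _ N])
    next
      show "?D (1\<^sub>m N) = 0\<^sub>m N N" unfolding ad_one by (rule eq_matI) auto
    qed auto
    then show ?case by (simp add: area_trace_smult area_trace_ad cong: if_cong)
  qed
  then show "(\<lambda>N. \<Sum>k<length w. (if w ! k = a then area_trace N (word_mat N (w[k := b])) else 0)
       - (if w ! k = b then area_trace N (word_mat N (w[k := a])) else 0)) \<longlonglongrightarrow> 0"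
    by (rule Lim_transform_eventually[OF tendsto_const])
next
  have "\<forall>\<^sub>F N in sequentially. 4 * complex_of_real pi = area_trace N (word_mat N [])"
    using eventually_ge_at_top[of 1] by eventually_elim (simp add: area_trace_one)
  then show "(\<lambda>N. area_trace N (word_mat N [])) \<longlonglongrightarrow> 4 * pi"
    by (simp add: Lim_transform_eventually[OF tendsto_const])
qed

lemma area_trace_word_tendsto:
  "(\<lambda>N. area_trace N (word_mat N w)) \<longlonglongrightarrow> of_real (\<integral>x. word_fun w x \<partial>sphere_area)"
  by (rule rotation_moments_unique[OF rotation_moments_area_trace rotation_moments_sphere])

section \<open>Polynomials and rotations of the sphere\<close>
abbreviation "rpoly \<equiv> (real_polynomial_function :: (real^3 \<Rightarrow> real) \<Rightarrow> bool)"

lemma rpoly_coord: "rpoly (\<lambda>x. x $ a)"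
  by (intro real_polynomial_function.intros(1) bounded_linear_vec_nth)

lemma rpoly_cmult: "rpoly p \<Longrightarrow> rpoly (\<lambda>x. c * p x)"
  by (intro real_polynomial_function.intros(4) real_polynomial_function.intros(2))

definition dir_deriv :: "real^3 \<Rightarrow> (real^3 \<Rightarrow> real) \<Rightarrow> real^3 \<Rightarrow> real" where
  "dir_deriv v p x = frechet_derivative p (at x) v"

lemma dir_deriv_eqI: "(p has_derivative D) (at x) \<Longrightarrow> dir_deriv v p x = D v"
  unfolding dir_deriv_def by (metis frechet_derivative_at)

lemma rpoly_differentiable: "rpoly p \<Longrightarrow> p differentiable (at x)"
  by (induction p rule: real_polynomial_function.induct)
     (auto intro: bounded_linear_imp_differentiable)

lemma rpoly_has_derivative: "rpoly p \<Longrightarrow> (p has_derivative (\<lambda>v. dir_deriv v p x)) (at x)"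
  unfolding dir_deriv_def using rpoly_differentiable frechet_derivative_works by blast

lemma rpoly_continuous_on: "rpoly p \<Longrightarrow> continuous_on A p"
  by (meson continuous_at_imp_continuous_on differentiable_imp_continuous_within rpoly_differentiable)

lemma dir_deriv_linear: "bounded_linear f \<Longrightarrow> dir_deriv v f x = f v"
  by (rule dir_deriv_eqI) (rule bounded_linear_imp_has_derivative)

lemma dir_deriv_const: "dir_deriv v (\<lambda>x. c) x = 0"
  by (rule dir_deriv_eqI) (rule has_derivative_const)

lemma dir_deriv_add: "rpoly p \<Longrightarrow> rpoly q \<Longrightarrow> dir_deriv v (\<lambda>x. p x + q x) x = dir_deriv v p x + dir_deriv v q x"
  by (rule dir_deriv_eqI) (intro has_derivative_add rpoly_has_derivative)

lemma dir_deriv_mult: "rpoly p \<Longrightarrow> rpoly q \<Longrightarrow> dir_deriv v (\<lambda>x. p x * q x) x = dir_deriv v p x * q x + p x * dir_deriv v q x"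
  by (rule trans[OF dir_deriv_eqI[OF has_derivative_mult[OF rpoly_has_derivative rpoly_has_derivative]]]) auto

lemma dir_deriv_cmult: "rpoly p \<Longrightarrow> dir_deriv v (\<lambda>x. c * p x) x = c * dir_deriv v p x"
  using dir_deriv_mult[OF real_polynomial_function.intros(2), of p v c] by (simp add: dir_deriv_const)

lemma dir_deriv_coord: "dir_deriv v (\<lambda>x. x $ a) x = v $ a"
  by (rule dir_deriv_linear) (rule bounded_linear_vec_nth)

lemma dir_deriv_expand:
  assumes "rpoly p"
  shows "dir_deriv v p x = v $ 1 * dir_deriv (axis 1 1) p x + v $ 2 * dir_deriv (axis 2 1) p x + v $ 3 * dir_deriv (axis 3 1) p x"
proof -
  have l: "linear (\<lambda>v. dir_deriv v p x)" using rpoly_has_derivative[OF assms] has_derivative_linear by blast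
  show ?thesis
    by (subst sum_3_axis[of v]) (simp add: linear_add[OF l] linear_scale[OF l])
qed

lemma rpoly_dir_deriv: "rpoly p \<Longrightarrow> rpoly (dir_deriv v p)"
proof (induction p rule: real_polynomial_function.induct)
  case (linear f)
  then have "dir_deriv v f = (\<lambda>x. f v)" by (auto simp: dir_deriv_linear fun_eq_iff)
  then show ?case by auto
next
  case (const c)
  have "dir_deriv v (\<lambda>x. c) = (\<lambda>x. 0)" by (auto simp: dir_deriv_const fun_eq_iff)
  then show ?case by auto
next
  case (add f g)
  then have "dir_deriv v (\<lambda>x. f x + g x) = (\<lambda>x. dir_deriv v f x + dir_deriv v g x)" by (auto simp: dir_deriv_add fun_eq_iff)
  then show ?case using add by auto
next
  case (mult f g)
  then have "dir_deriv v (\<lambda>x. f x * g x) = (\<lambda>x. dir_deriv v f x * g x + f x * dir_deriv v g x)" by (auto simp: dir_deriv_mult fun_eq_iff)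
  then show ?case using mult by auto
qed

text \<open>The derivative along the rotation field about an axis, which on the sphere is the Poisson bracket
  with the coordinate (\<open>poisson_bracket_coord\<close> below). Unlike the bracket it is defined
  on the whole space and maps polynomials to polynomials.\<close>

definition rot_deriv :: "3 \<Rightarrow> (real^3 \<Rightarrow> real) \<Rightarrow> real^3 \<Rightarrow> real" where
  "rot_deriv a p x = dir_deriv (cross3 x (axis a 1)) p x"

lemma rot_deriv_const: "rot_deriv a (\<lambda>x. c) x = 0"
  by (simp add: rot_deriv_def dir_deriv_const)

lemma rot_deriv_add: "rpoly p \<Longrightarrow> rpoly q \<Longrightarrow> rot_deriv a (\<lambda>x. p x + q x) x = rot_deriv a p x + rot_deriv a q x"
  by (simp add: rot_deriv_def dir_deriv_add)

lemma rot_deriv_mult: "rpoly p \<Longrightarrow> rpoly q \<Longrightarrow> rot_deriv a (\<lambda>x. p x * q x) x = rot_deriv a p x * q x + p x * rot_deriv a q x"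
  by (simp add: rot_deriv_def dir_deriv_mult)

lemma rot_deriv_cmult: "rpoly p \<Longrightarrow> rot_deriv a (\<lambda>x. c * p x) x = c * rot_deriv a p x"
  by (simp add: rot_deriv_def dir_deriv_cmult)

lemma rot_deriv_coord: "rot_deriv a (\<lambda>x. x $ b) x = cross3 x (axis a 1) $ b"
  by (simp add: rot_deriv_def dir_deriv_coord)

lemma rot_deriv_expand:
  assumes "rpoly p"
  shows "rot_deriv 1 p x = x $ 3 * dir_deriv (axis 2 1) p x - x $ 2 * dir_deriv (axis 3 1) p x"
    "rot_deriv 2 p x = x $ 1 * dir_deriv (axis 3 1) p x - x $ 3 * dir_deriv (axis 1 1) p x"
    "rot_deriv 3 p x = x $ 2 * dir_deriv (axis 1 1) p x - x $ 1 * dir_deriv (axis 2 1) p x"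
  unfolding rot_deriv_def dir_deriv_expand[OF assms, of "cross3 _ _"] by (simp_all add: cross3_nth axis_def)

lemma rpoly_rot_deriv: "rpoly p \<Longrightarrow> rpoly (rot_deriv a p)"
proof -
  assume p: "rpoly p"
  have r: "rpoly (\<lambda>x. x $ i * dir_deriv (axis j 1) p x - x $ k * dir_deriv (axis l 1) p x)" for i j k l
    by (intro real_polynomial_function_diff real_polynomial_function.intros(4) rpoly_coord rpoly_dir_deriv p)
  have e: "rot_deriv 1 p = (\<lambda>x. x $ 3 * dir_deriv (axis 2 1) p x - x $ 2 * dir_deriv (axis 3 1) p x)"
    "rot_deriv 2 p = (\<lambda>x. x $ 1 * dir_deriv (axis 3 1) p x - x $ 3 * dir_deriv (axis 1 1) p x)"
    "rot_deriv 3 p = (\<lambda>x. x $ 2 * dir_deriv (axis 1 1) p x - x $ 1 * dir_deriv (axis 2 1) p x)"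
    by (auto simp: fun_eq_iff rot_deriv_expand[OF p])
  show ?thesis using exhaust_3[of a] by (elim disjE) (simp_all only: e r)
qed

lemma tangent_curve:
  assumes x: "x \<in> S2" and h: "inner x h = 0"
  obtains c :: "real \<Rightarrow> real^3" where "c 0 = x" "range c \<subseteq> S2" "(c has_derivative (\<lambda>t. t *\<^sub>R h)) (at 0)"
proof (cases "h = 0")
  case True
  show ?thesis by (rule that[of "\<lambda>_. x"]) (use x True in auto)
next
  case False
  define r where "r = norm h"
  have r: "r > 0" using False by (simp add: r_def)
  define c where "c t = cos (r * t) *\<^sub>R x + (sin (r * t) / r) *\<^sub>R h" for t
  have xx: "inner x x = 1" using x by (simp add: norm_eq_1)
  have hh: "inner h h = r * r" by (simp add: r_def power2_norm_eq_inner[symmetric] power2_eq_square)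
  have "norm (c t) = 1" for t
  proof -
    have "inner (c t) (c t) = cos (r * t) * cos (r * t) + sin (r * t) * sin (r * t)"
      using r h by (simp add: c_def inner_add_left inner_add_right xx hh inner_commute[of h x])
    also have "\<dots> = 1" using sin_cos_squared_add[of "r * t"] by (simp add: power2_eq_square)
    finally show ?thesis by (simp add: norm_eq_1)
  qed
  moreover have "(c has_derivative (\<lambda>t. t *\<^sub>R h)) (at 0)"
    unfolding c_def using r by (auto intro!: derivative_eq_intros)
  ultimately show ?thesis by (intro that[of c]) (auto simp: c_def)
qed

text \<open>A derivative within the sphere is determined on tangent vectors by the values on the sphere, since
  every tangent vector is the velocity of a great circle.\<close>

lemma tangential_derivative_unique:
  assumes f: "(f has_derivative D) (at x within S2)" and g: "(g has_derivative E) (at x within S2)"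
    and eq: "\<And>y. y \<in> S2 \<Longrightarrow> f y = (g y :: real)" and x: "x \<in> S2" and h: "inner x h = 0"
  shows "D h = E h"
proof -
  obtain c :: "real \<Rightarrow> real^3" where c: "c 0 = x" "range c \<subseteq> S2" "(c has_derivative (\<lambda>t. t *\<^sub>R h)) (at 0)"
    using tangent_curve[OF x h] .
  have "(f has_derivative D) (at (c 0) within range c)" "(g has_derivative E) (at (c 0) within range c)"
    using f g c(1,2) by (auto intro: has_derivative_subset)
  from this(1)[THEN has_derivative_in_compose[OF c(3)]] this(2)[THEN has_derivative_in_compose[OF c(3)]]
  have "((\<lambda>t. f (c t)) has_derivative (\<lambda>t. D (t *\<^sub>R h))) (at 0)" "((\<lambda>t. g (c t)) has_derivative (\<lambda>t. E (t *\<^sub>R h))) (at 0)"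
    by auto
  moreover have "(\<lambda>t. f (c t)) = (\<lambda>t. g (c t))" by (rule ext, rule eq) (use c(2) in blast)
  ultimately have "(\<lambda>t. D (t *\<^sub>R h)) = (\<lambda>t. E (t *\<^sub>R h))"
    using has_derivative_unique by (metis (no_types, lifting))
  from fun_cong[OF this, of 1] show ?thesis by simp
qed

lemma rot_deriv_cong_sphere:
  assumes "rpoly p" "rpoly q" "\<And>x. x \<in> S2 \<Longrightarrow> p x = q x" "x \<in> S2"
  shows "rot_deriv a p x = rot_deriv a q x"
  unfolding rot_deriv_def
  by (rule tangential_derivative_unique[of p "\<lambda>v. dir_deriv v p x" x q "\<lambda>v. dir_deriv v q x"])
     (use assms in \<open>auto intro: has_derivative_at_withinI rpoly_has_derivative simp: dot_cross_self\<close>)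

text \<open>Subtracting a multiple of \<open>|y|\<^sup>2 - 1\<close> does not change the function on the
  sphere but removes the normal component of its gradient.\<close>

lemma sphere_grad_rpoly:
  assumes p: "rpoly p" and x: "x \<in> S2"
    and g: "\<And>v. dir_deriv v p x = inner g v"
  shows "sphere_grad p x = g - inner g x *\<^sub>R x"
  unfolding sphere_grad_def
proof (rule the_equality, intro conjI)
  have xx: "inner x x = 1" using x by (simp add: norm_eq_1)
  show "inner (g - inner g x *\<^sub>R x) x = 0" by (simp add: inner_diff_left xx)
  let ?k = "inner g x"
  have "((\<lambda>y. p y - ?k / 2 * (inner y y - 1)) has_derivative (\<lambda>h. inner (g - ?k *\<^sub>R x) h)) (at x)"
    by (rule has_derivative_eq_rhs, (rule derivative_intros rpoly_has_derivative[OF p] | simp)+)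
      (auto simp: fun_eq_iff g inner_diff_left inner_commute algebra_simps)
  then have "((\<lambda>y. p y - ?k / 2 * (inner y y - 1)) has_derivative (\<lambda>h. inner (g - ?k *\<^sub>R x) h)) (at x within S2)"
    by (rule has_derivative_at_withinI)
  then show 1: "(p has_derivative (\<lambda>h. inner (g - ?k *\<^sub>R x) h)) (at x within S2)"
    by (rule has_derivative_transform[rotated 2]) (use x in \<open>auto simp: norm_eq_1\<close>)
  fix v assume v: "inner v x = 0 \<and> (p has_derivative (\<lambda>h. inner v h)) (at x within S2)"
  let ?w = "g - ?k *\<^sub>R x"
  have w: "inner ?w x = 0" by (simp add: inner_diff_left xx)
  have "inner v (v - ?w) = inner ?w (v - ?w)"
    by (rule tangential_derivative_unique[where h="v - ?w", OF conjunct2[OF v] 1 refl x])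
      (use v w in \<open>simp add: inner_diff_right inner_diff_left inner_commute\<close>)
  then have "inner (v - ?w) (v - ?w) = 0" by (simp add: inner_diff_left)
  then show "v = ?w" by simp
qed

lemma poisson_bracket_coord:
  assumes p: "rpoly p" and x: "x \<in> S2"
  shows "poisson_bracket (\<lambda>x. x $ a) p x = rot_deriv a p x"
proof -
  define g :: "real^3" where "g = vector [dir_deriv (axis 1 1) p x, dir_deriv (axis 2 1) p x, dir_deriv (axis 3 1) p x]"
  have g: "dir_deriv v p x = inner g v" for v
    by (subst dir_deriv_expand[OF p]) (simp add: g_def inner_vec_def sum_3 mult.commute)
  have 1: "sphere_grad p x = g - inner g x *\<^sub>R x" by (rule sphere_grad_rpoly[OF p x g])
  have 2: "sphere_grad (\<lambda>x. x $ a) x = axis a 1 - inner (axis a 1) x *\<^sub>R x"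
    by (rule sphere_grad_rpoly[OF rpoly_coord x]) (simp add: dir_deriv_coord inner_axis')
  have "poisson_bracket (\<lambda>x. x $ a) p x = - inner (axis a 1) (cross3 x g)"
    unfolding poisson_bracket_def sphere_perp_grad_def 1 2
    by (simp add: cross3_def inner_vec_def sum_3 algebra_simps)
  also have "\<dots> = inner g (cross3 x (axis a 1))"
    by (simp add: cross3_def inner_vec_def sum_3 algebra_simps)
  finally show ?thesis by (simp add: rot_deriv_def g)
qed

lemma Ck_on_rpoly: "rpoly p \<Longrightarrow> Ck_on k UNIV p"
proof (induction k arbitrary: p)
  case 0
  then show ?case by (simp add: rpoly_continuous_on)
next
  case (Suc k)
  have "Ck_on k UNIV (\<lambda>x. frechet_derivative p (at x) (axis i 1))" for i
    using Suc.IH[OF rpoly_dir_deriv[OF Suc.prems, of "axis i 1"]] by (simp add: dir_deriv_def[abs_def])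
  then show ?case using rpoly_differentiable[OF Suc.prems]
    by (simp add: differentiable_on_def)
qed

lemma Ck_sphere_rpoly: "rpoly p \<Longrightarrow> Ck_sphere k p"
  unfolding Ck_sphere_def using Ck_on_rpoly by (intro exI[of _ UNIV] exI[of _ p]) auto

section \<open>Matrix families with a symbol\<close>

text \<open>The families of matrices built from the coordinate matrices by finitely many ring operations, with
  scalar coefficients that may depend on \<open>N\<close> as long as they converge. The symbol is
  the polynomial obtained by replacing matrices by coordinates and coefficients by their limits; it
  is only significant on the sphere. Coefficients that depend on \<open>N\<close> are essential: the
  image of a polynomial under a quantization map is of this form exactly, but not with constant
  coefficients.\<close>

inductive has_symbol :: "(nat \<Rightarrow> complex mat) \<Rightarrow> (real^3 \<Rightarrow> real) \<Rightarrow> bool" where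
  one: "has_symbol (\<lambda>N. 1\<^sub>m N) (\<lambda>x. 1)"
| coord: "has_symbol (\<lambda>N. coord_mat N a) (\<lambda>x. x $ a)"
| add: "has_symbol A p \<Longrightarrow> has_symbol B q \<Longrightarrow> has_symbol (\<lambda>N. A N + B N) (\<lambda>x. p x + q x)"
| mult: "has_symbol A p \<Longrightarrow> has_symbol B q \<Longrightarrow> has_symbol (\<lambda>N. A N * B N) (\<lambda>x. p x * q x)"
| scale: "has_symbol A p \<Longrightarrow> c \<longlonglongrightarrow> c0 \<Longrightarrow> has_symbol (\<lambda>N. of_real (c N) \<cdot>\<^sub>m A N) (\<lambda>x. c0 * p x)"
| sphere: "has_symbol A p \<Longrightarrow> rpoly q \<Longrightarrow> (\<And>x. x \<in> S2 \<Longrightarrow> p x = q x) \<Longrightarrow> has_symbol A q"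
| eventually: "has_symbol A p \<Longrightarrow> (\<forall>\<^sub>F N in sequentially. A N = B N) \<Longrightarrow> has_symbol B p"

lemma has_symbol_rpoly: "has_symbol A p \<Longrightarrow> rpoly p"
  by (induction rule: has_symbol.induct) (auto intro: rpoly_coord)

lemma has_symbol_carrier: "has_symbol A p \<Longrightarrow> \<forall>\<^sub>F N in sequentially. A N \<in> carrier_mat N N"
proof (induction rule: has_symbol.induct)
  case (add A p B q)
  from add.IH show ?case by eventually_elim auto
next
  case (mult A p B q)
  from mult.IH show ?case by eventually_elim auto
next
  case (scale A p c c0)
  from scale.IH show ?case by eventually_elim auto
next
  case (eventually A p B)
  from eventually.IH eventually.hyps(2) show ?case by eventually_elim auto
qed auto

lemma has_symbol_row_bound: "has_symbol A p \<Longrightarrow> \<exists>C. \<forall>\<^sub>F N in sequentially. row_bound N (A N) C"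
proof (induction rule: has_symbol.induct)
  case one
  show ?case by (rule exI[of _ 1]) (simp add: row_bound_one)
next
  case (coord a)
  show ?case by (rule exI[of _ 2], rule eventually_mono[OF eventually_ge_at_top[of 2]]) (rule row_bound_coord)
next
  case (add A p B q)
  then obtain C D where "\<forall>\<^sub>F N in sequentially. row_bound N (A N) C" "\<forall>\<^sub>F N in sequentially. row_bound N (B N) D" by blast
  with has_symbol_carrier[OF add.hyps(1)] has_symbol_carrier[OF add.hyps(2)]
  have "\<forall>\<^sub>F N in sequentially. row_bound N (A N + B N) (C + D)"
    by eventually_elim (rule row_bound_add)
  then show ?case ..
next
  case (mult A p B q)
  then obtain C D where "\<forall>\<^sub>F N in sequentially. row_bound N (A N) C" "\<forall>\<^sub>F N in sequentially. row_bound N (B N) D" by blast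
  with has_symbol_carrier[OF mult.hyps(1)] has_symbol_carrier[OF mult.hyps(2)]
  have "\<forall>\<^sub>F N in sequentially. row_bound N (A N * B N) (C * D)"
    by eventually_elim (rule row_bound_mult)
  then show ?case ..
next
  case (scale A p c c0)
  then obtain C where C: "\<forall>\<^sub>F N in sequentially. row_bound N (A N) C" by blast
  have "(\<lambda>N. \<bar>c N\<bar>) \<longlonglongrightarrow> \<bar>c0\<bar>" using scale.hyps(2) by (rule tendsto_rabs)
  then have "\<forall>\<^sub>F N in sequentially. \<bar>c N\<bar> < \<bar>c0\<bar> + 1" by (rule order_tendstoD) simp
  with C has_symbol_carrier[OF scale.hyps(1)]
  have "\<forall>\<^sub>F N in sequentially. row_bound N (of_real (c N) \<cdot>\<^sub>m A N) ((\<bar>c0\<bar> + 1) * C)"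
  proof eventually_elim
    case (elim N)
    have "row_bound N (of_real (c N) \<cdot>\<^sub>m A N) (cmod (of_real (c N)) * C)"
      using elim by (intro row_bound_smult)
    then show ?case
      by (rule row_bound_mono) (use elim in \<open>auto simp: row_bound_def intro!: mult_right_mono\<close>)
  qed
  then show ?case ..
next
  case (eventually A p B)
  then obtain C where "\<forall>\<^sub>F N in sequentially. row_bound N (A N) C" by blast
  with eventually.hyps(2) have "\<forall>\<^sub>F N in sequentially. row_bound N (B N) C"
    by eventually_elim simp
  then show ?case ..
qed auto

text \<open>A strengthening of the convergence of traces that survives multiplication: the trace is tested
  against all words on the right.\<close>

definition word_trace_convergent :: "(nat \<Rightarrow> complex mat) \<Rightarrow> (real^3 \<Rightarrow> real) \<Rightarrow> bool" where
  "word_trace_convergent B q \<longleftrightarrow> rpoly q \<and> (\<forall>\<^sub>F N in sequentially. B N \<in> carrier_mat N N) \<and>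
     (\<forall>v. (\<lambda>N. area_trace N (B N * word_mat N v)) \<longlonglongrightarrow> of_real (\<integral>x. q x * word_fun v x \<partial>sphere_area))"

lemma integrable_rpoly_word: "rpoly q \<Longrightarrow> integrable sphere_area (\<lambda>x. q x * word_fun v x)"
  by (intro sphere_integral(1) continuous_intros rpoly_continuous_on)

text \<open>The induction is on the right factor while the left factor stays arbitrary, so that the case of a
  product is two applications of the induction hypothesis.\<close>

lemma word_trace_convergent_mult:
  assumes "has_symbol A p"
  shows "word_trace_convergent B q \<Longrightarrow> word_trace_convergent (\<lambda>N. B N * A N) (\<lambda>x. q x * p x)"
  using assms
proof (induction arbitrary: B q rule: has_symbol.induct)
  case one
  have "\<forall>\<^sub>F N in sequentially. B N = B N * 1\<^sub>m N"
    using one unfolding word_trace_convergent_def by (auto elim!: eventually_mono)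
  then have "\<forall>\<^sub>F N in sequentially. area_trace N (B N * word_mat N v) = area_trace N (B N * 1\<^sub>m N * word_mat N v)" for v
    by (auto elim!: eventually_mono)
  with one show ?case unfolding word_trace_convergent_def
    by (auto intro: Lim_transform_eventually elim!: eventually_mono)
next
  case (coord a)
  have "rpoly (\<lambda>x. q x * x $ a)" using coord by (intro real_polynomial_function.intros(4) rpoly_coord) (simp add: word_trace_convergent_def)
  moreover have c: "\<forall>\<^sub>F N in sequentially. B N \<in> carrier_mat N N" using coord by (simp add: word_trace_convergent_def)
  moreover from c have "\<forall>\<^sub>F N in sequentially. B N * coord_mat N a \<in> carrier_mat N N" by eventually_elim simp
  moreover have "(\<lambda>N. area_trace N (B N * coord_mat N a * word_mat N v)) \<longlonglongrightarrow> of_real (\<integral>x. q x * x $ a * word_fun v x \<partial>sphere_area)" for v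
  proof -
    have "(\<lambda>N. area_trace N (B N * word_mat N (a # v))) \<longlonglongrightarrow> of_real (\<integral>x. q x * word_fun (a # v) x \<partial>sphere_area)"
      using coord unfolding word_trace_convergent_def by blast
    moreover from c have "\<forall>\<^sub>F N in sequentially. area_trace N (B N * word_mat N (a # v)) = area_trace N (B N * coord_mat N a * word_mat N v)"
      
    proof eventually_elim
      case (elim N)
      then show ?case by (simp add: assoc_mult_mat[of _ N N _ N _ N])
    qed
    ultimately show ?thesis by (auto intro: Lim_transform_eventually simp: mult.assoc)
  qed
  ultimately show ?case unfolding word_trace_convergent_def by blast
next
  case (add A p A' p')
  note T = add.IH(1)[OF add.prems] add.IH(2)[OF add.prems]
  have B: "\<forall>\<^sub>F N in sequentially. B N \<in> carrier_mat N N" "rpoly q" using add.prems by (simp_all add: word_trace_convergent_def)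
  note c = has_symbol_carrier[OF add.hyps(1)] has_symbol_carrier[OF add.hyps(2)]
  have r: "rpoly (\<lambda>x. q x * p x)" "rpoly (\<lambda>x. q x * p' x)" using T by (simp_all add: word_trace_convergent_def)
  show ?case unfolding word_trace_convergent_def
  proof (intro conjI allI)
    show "rpoly (\<lambda>x. q x * (p x + p' x))"
      using real_polynomial_function.intros(3)[OF r] by (simp add: distrib_left)
    show "\<forall>\<^sub>F N in sequentially. B N * (A N + A' N) \<in> carrier_mat N N"
      using B(1) c by eventually_elim simp
    fix v
    have "(\<lambda>N. area_trace N (B N * A N * word_mat N v) + area_trace N (B N * A' N * word_mat N v)) \<longlonglongrightarrow>
       of_real (\<integral>x. q x * p x * word_fun v x \<partial>sphere_area) + of_real (\<integral>x. q x * p' x * word_fun v x \<partial>sphere_area)"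
      using T unfolding word_trace_convergent_def by (intro tendsto_add) blast+
    also have "of_real (\<integral>x. q x * p x * word_fun v x \<partial>sphere_area) + of_real (\<integral>x. q x * p' x * word_fun v x \<partial>sphere_area)
       = complex_of_real (\<integral>x. q x * (p x + p' x) * word_fun v x \<partial>sphere_area)"
      using integrable_rpoly_word[OF r(1), of v] integrable_rpoly_word[OF r(2), of v]
      by (simp add: Bochner_Integration.integral_add algebra_simps flip: of_real_add)
    finally have L: "(\<lambda>N. area_trace N (B N * A N * word_mat N v) + area_trace N (B N * A' N * word_mat N v)) \<longlonglongrightarrow>
       complex_of_real (\<integral>x. q x * (p x + p' x) * word_fun v x \<partial>sphere_area)" .
    have "\<forall>\<^sub>F N in sequentially. area_trace N (B N * A N * word_mat N v) + area_trace N (B N * A' N * word_mat N v) = area_trace N (B N * (A N + A' N) * word_mat N v)"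
      using B(1) c
    proof eventually_elim
      case (elim N)
      then show ?case
        by (simp add: mult_add_distrib_mat[of _ N N _ N] add_mult_distrib_mat[of _ N N _ _ N] area_trace_linear)
    qed
    with L show "(\<lambda>N. area_trace N (B N * (A N + A' N) * word_mat N v)) \<longlonglongrightarrow> complex_of_real (\<integral>x. q x * (p x + p' x) * word_fun v x \<partial>sphere_area)"
      by (rule Lim_transform_eventually)
  qed
next
  case (mult A p A' p')
  have T: "word_trace_convergent (\<lambda>N. B N * A N * A' N) (\<lambda>x. q x * p x * p' x)"
    by (rule mult.IH(2)[OF mult.IH(1)[OF mult.prems]])
  have B: "\<forall>\<^sub>F N in sequentially. B N \<in> carrier_mat N N" using mult.prems by (simp_all add: word_trace_convergent_def)
  have e: "\<forall>\<^sub>F N in sequentially. B N * A N * A' N = B N * (A N * A' N)"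
    using B has_symbol_carrier[OF mult.hyps(1)] has_symbol_carrier[OF mult.hyps(2)]
    by eventually_elim (rule assoc_mult_mat)
  have "\<forall>\<^sub>F N in sequentially. area_trace N (B N * A N * A' N * word_mat N v) = area_trace N (B N * (A N * A' N) * word_mat N v)" for v
    using e by eventually_elim simp
  moreover have "\<forall>\<^sub>F N in sequentially. B N * (A N * A' N) \<in> carrier_mat N N"
    using B has_symbol_carrier[OF mult.hyps(1)] has_symbol_carrier[OF mult.hyps(2)] by eventually_elim simp
  ultimately show ?case using T unfolding word_trace_convergent_def
    by (auto intro: Lim_transform_eventually simp: mult.assoc)
next
  case (scale A p c c0)
  note T = scale.IH[OF scale.prems]
  have B: "\<forall>\<^sub>F N in sequentially. B N \<in> carrier_mat N N" using scale.prems by (simp_all add: word_trace_convergent_def)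
  have r: "rpoly (\<lambda>x. q x * p x)" using T by (simp add: word_trace_convergent_def)
  show ?case unfolding word_trace_convergent_def
  proof (intro conjI allI)
    show "rpoly (\<lambda>x. q x * (c0 * p x))" using rpoly_cmult[OF r, of c0] by (simp add: mult.left_commute)
    show "\<forall>\<^sub>F N in sequentially. B N * (of_real (c N) \<cdot>\<^sub>m A N) \<in> carrier_mat N N"
      using B has_symbol_carrier[OF scale.hyps(1)] by eventually_elim simp
    fix v
    have "(\<lambda>N. of_real (c N) * area_trace N (B N * A N * word_mat N v)) \<longlonglongrightarrow>
       of_real c0 * of_real (\<integral>x. q x * p x * word_fun v x \<partial>sphere_area)"
      using T scale.hyps(2) unfolding word_trace_convergent_def by (intro tendsto_mult tendsto_of_real) blast+
    also have "of_real c0 * of_real (\<integral>x. q x * p x * word_fun v x \<partial>sphere_area) = complex_of_real (\<integral>x. q x * (c0 * p x) * word_fun v x \<partial>sphere_area)"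
      by (simp add: mult.left_commute mult.assoc flip: of_real_mult)
    finally have L: "(\<lambda>N. of_real (c N) * area_trace N (B N * A N * word_mat N v)) \<longlonglongrightarrow> complex_of_real (\<integral>x. q x * (c0 * p x) * word_fun v x \<partial>sphere_area)" .
    have "\<forall>\<^sub>F N in sequentially. of_real (c N) * area_trace N (B N * A N * word_mat N v) = area_trace N (B N * (of_real (c N) \<cdot>\<^sub>m A N) * word_mat N v)"
      using B has_symbol_carrier[OF scale.hyps(1)]
    proof eventually_elim
      case (elim N)
      then show ?case
        by (simp add: mult_smult_distrib[of _ N N _ N] mult_smult_assoc_mat[of _ N N _ N] area_trace_smult)
    qed
    with L show "(\<lambda>N. area_trace N (B N * (of_real (c N) \<cdot>\<^sub>m A N) * word_mat N v)) \<longlonglongrightarrow> complex_of_real (\<integral>x. q x * (c0 * p x) * word_fun v x \<partial>sphere_area)"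
      by (rule Lim_transform_eventually)
  qed
next
  case (sphere A p p')
  note T = sphere.IH[OF sphere.prems]
  have "rpoly (\<lambda>x. q x * p' x)" using sphere by (intro real_polynomial_function.intros(4)) (auto simp: word_trace_convergent_def)
  moreover have "(\<integral>x. q x * p x * word_fun v x \<partial>sphere_area) = (\<integral>x. q x * p' x * word_fun v x \<partial>sphere_area)" for v
    by (rule Bochner_Integration.integral_cong) (use sphere.hyps(3) in auto)
  ultimately show ?case using T unfolding word_trace_convergent_def by simp
next
  case (eventually A p A')
  note T = eventually.IH[OF eventually.prems]
  have "\<forall>\<^sub>F N in sequentially. area_trace N (B N * A N * word_mat N v) = area_trace N (B N * A' N * word_mat N v)" for v
    using eventually.hyps(2) by eventually_elim simp
  moreover have "\<forall>\<^sub>F N in sequentially. B N * A' N \<in> carrier_mat N N"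
    using T[unfolded word_trace_convergent_def, THEN conjunct2, THEN conjunct1] eventually.hyps(2) by eventually_elim simp
  ultimately show ?case using T unfolding word_trace_convergent_def
    by (auto intro: Lim_transform_eventually)
qed

lemma has_symbol_trace:
  assumes "has_symbol A p"
  shows "(\<lambda>N. area_trace N (A N)) \<longlonglongrightarrow> of_real (\<integral>x. p x \<partial>sphere_area)"
proof -
  have "word_trace_convergent (\<lambda>N. 1\<^sub>m N) (\<lambda>x. 1)"
    unfolding word_trace_convergent_def using area_trace_word_tendsto by auto
  from word_trace_convergent_mult[OF assms this] have "word_trace_convergent (\<lambda>N. 1\<^sub>m N * A N) (\<lambda>x. 1 * p x)" .
  then have "(\<lambda>N. area_trace N (1\<^sub>m N * A N * word_mat N [])) \<longlonglongrightarrow> of_real (\<integral>x. 1 * p x * word_fun [] x \<partial>sphere_area)"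
    unfolding word_trace_convergent_def by blast
  moreover have "\<forall>\<^sub>F N in sequentially. area_trace N (1\<^sub>m N * A N * word_mat N []) = area_trace N (A N)"
    using has_symbol_carrier[OF assms] by eventually_elim simp
  ultimately show ?thesis by (auto intro: Lim_transform_eventually)
qed

lemma has_symbol_cmult: "has_symbol A p \<Longrightarrow> has_symbol (\<lambda>N. of_real c \<cdot>\<^sub>m A N) (\<lambda>x. c * p x)"
  by (rule has_symbol.scale) auto

lemma has_symbol_zero: "has_symbol (\<lambda>N. 0\<^sub>m N N) (\<lambda>x. 0)"
proof -
  have "has_symbol (\<lambda>N. of_real 0 \<cdot>\<^sub>m 1\<^sub>m N) (\<lambda>x. 0 * 1)" by (rule has_symbol_cmult[OF has_symbol.one])
  moreover have "of_real 0 \<cdot>\<^sub>m 1\<^sub>m N = (0\<^sub>m N N :: complex mat)" for N by (rule eq_matI) auto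
  ultimately show ?thesis by simp
qed

lemma has_symbol_pow: "has_symbol A p \<Longrightarrow> has_symbol (\<lambda>N. A N ^\<^sub>m k) (\<lambda>x. p x ^ k)"
proof (induction k)
  case 0
  have "\<forall>\<^sub>F N in sequentially. 1\<^sub>m N = A N ^\<^sub>m 0"
    using has_symbol_carrier[OF 0] by eventually_elim auto
  from has_symbol.eventually[OF has_symbol.one this] show ?case by simp
next
  case (Suc k)
  from has_symbol.mult[OF Suc.IH[OF Suc.prems] Suc.prems] show ?case by (simp add: mult.commute)
qed

text \<open>The adjoint action and the rotation derivative are derivations with the same table on the
  generators. A change of symbol off the sphere is harmless because rotations are tangential.\<close>

lemma has_symbol_ad: "has_symbol A p \<Longrightarrow> has_symbol (\<lambda>N. ad N a (A N)) (rot_deriv a p)"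
proof (induction rule: has_symbol.induct)
  case one
  have "rot_deriv a (\<lambda>x. 1) = (\<lambda>x. 0)" by (auto simp: rot_deriv_const)
  then show ?case using has_symbol_zero by (simp add: ad_one)
next
  case (coord b)
  have neg: "has_symbol (\<lambda>N. - coord_mat N c) (\<lambda>x. - x $ c)" for c
  proof -
    have "of_real (- 1) \<cdot>\<^sub>m coord_mat N c = - coord_mat N c" for N by (rule eq_matI) auto
    then show ?thesis using has_symbol_cmult[OF has_symbol.coord[of c], of "-1"] by simp
  qed
  have ev: "has_symbol (\<lambda>N. ad N a (coord_mat N b)) p" if "has_symbol B p" "\<And>N. N \<ge> 2 \<Longrightarrow> ad N a (coord_mat N b) = B N" for a b B p
    by (rule has_symbol.eventually[OF that(1)]) (rule eventually_mono[OF eventually_ge_at_top[of 2]], simp add: that(2))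
  have l: "rot_deriv a (\<lambda>x. x $ b) = (\<lambda>x. cross3 x (axis a 1) $ b)" by (auto simp: rot_deriv_coord)
  show ?case unfolding l
    using exhaust_3[of a] exhaust_3[of b]
    by (elim disjE)
      (simp_all add: cross3_nth axis_def ev[OF has_symbol_zero ad_coord(1)] ev[OF has_symbol_zero ad_coord(5)] ev[OF has_symbol_zero ad_coord(9)]
        ev[OF has_symbol.coord ad_coord(2)] ev[OF neg ad_coord(3)] ev[OF neg ad_coord(4)] ev[OF has_symbol.coord ad_coord(6)]
        ev[OF has_symbol.coord ad_coord(7)] ev[OF neg ad_coord(8)])
next
  case (add A p B q)
  have "rot_deriv a (\<lambda>x. p x + q x) = (\<lambda>x. rot_deriv a p x + rot_deriv a q x)"
    using has_symbol_rpoly[OF add.hyps(1)] has_symbol_rpoly[OF add.hyps(2)] by (auto simp: rot_deriv_add)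
  moreover have "\<forall>\<^sub>F N in sequentially. ad N a (A N) + ad N a (B N) = ad N a (A N + B N)"
    using has_symbol_carrier[OF add.hyps(1)] has_symbol_carrier[OF add.hyps(2)] by eventually_elim (simp add: ad_add)
  ultimately show ?case using has_symbol.eventually[OF has_symbol.add[OF add.IH]] by simp
next
  case (mult A p B q)
  have "rot_deriv a (\<lambda>x. p x * q x) = (\<lambda>x. rot_deriv a p x * q x + p x * rot_deriv a q x)"
    using has_symbol_rpoly[OF mult.hyps(1)] has_symbol_rpoly[OF mult.hyps(2)] by (auto simp: rot_deriv_mult)
  moreover have "\<forall>\<^sub>F N in sequentially. ad N a (A N) * B N + A N * ad N a (B N) = ad N a (A N * B N)"
    using has_symbol_carrier[OF mult.hyps(1)] has_symbol_carrier[OF mult.hyps(2)] by eventually_elim (simp add: ad_mult)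
  ultimately show ?case
    using has_symbol.eventually[OF has_symbol.add[OF has_symbol.mult[OF mult.IH(1) mult.hyps(2)] has_symbol.mult[OF mult.hyps(1) mult.IH(2)]]] by simp
next
  case (scale A p c c0)
  have "rot_deriv a (\<lambda>x. c0 * p x) = (\<lambda>x. c0 * rot_deriv a p x)"
    using has_symbol_rpoly[OF scale.hyps(1)] by (auto simp: rot_deriv_cmult)
  moreover have "\<forall>\<^sub>F N in sequentially. of_real (c N) \<cdot>\<^sub>m ad N a (A N) = ad N a (of_real (c N) \<cdot>\<^sub>m A N)"
    using has_symbol_carrier[OF scale.hyps(1)] by eventually_elim (simp add: ad_smult)
  ultimately show ?case using has_symbol.eventually[OF has_symbol.scale[OF scale.IH scale.hyps(2)]] by simp
next
  case (sphere A p q)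
  show ?case
    by (rule has_symbol.sphere[OF sphere.IH]) (use sphere.hyps has_symbol_rpoly in \<open>auto intro: rpoly_rot_deriv rot_deriv_cong_sphere\<close>)
next
  case (eventually A p B)
  have "\<forall>\<^sub>F N in sequentially. ad N a (A N) = ad N a (B N)"
    using eventually.hyps(2) by eventually_elim simp
  then show ?case by (rule has_symbol.eventually[OF eventually.IH])
qed

text \<open>Only the entry \<open>\<hbar> sqrt (N - 1) / 2\<close> next to the diagonal, in the case of the
  first two coordinates, and the distance of the largest weight from \<open>1\<close>, in the case
  of the third, contribute.\<close>

lemma last_row_coord:
  assumes N: "N \<ge> 2"
  shows "(\<Sum>j<N. cmod (coord_mat N a $$ (N - 1, j) - (if j = N - 1 then of_real (axis 3 1 $ a) else 0))) \<le> hbar N * sqrt (real N) + (1 - hbar N * weight N (N - 1))"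
proof -
  let ?e = "axis 3 1 :: real^3"
  have lad: "\<bar>ladder N (N - 2)\<bar> \<le> hbar N * sqrt (real N)"
  proof -
    have j: "N - 2 < N" using N by simp
    have "real (N - 1 - (N - 2)) * real (Suc (N - 2)) = real N - 1" using N by (simp add: of_nat_diff)
    then have "4 * (ladder N (N - 2))\<^sup>2 = (hbar N)\<^sup>2 * (real N - 1)" using ladder_sq[OF j] by (simp only:)
    then have "(ladder N (N - 2))\<^sup>2 = (hbar N)\<^sup>2 * (real N - 1) / 4" by simp
    also have "\<dots> \<le> (hbar N * sqrt (real N))\<^sup>2"
      using N by (simp add: power_mult_distrib field_simps mult_left_mono)
    finally show ?thesis using hbar_pos[OF N] by (simp add: abs_le_square_iff[symmetric] abs_mult)
  qed
  have w: "hbar N * weight N (N - 1) \<le> 1" using hbar_weight_le_one[OF N, of "N - 1"] N by simp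
  have off: "(\<Sum>j<N. if j = N - 2 then \<bar>ladder N (N - 2)\<bar> else 0) = \<bar>ladder N (N - 2)\<bar>" using N by simp
  consider "a = 1" | "a = 2" | "a = 3" using exhaust_3 by metis
  then show ?thesis
  proof cases
    case 1
    have "(\<Sum>j<N. cmod (coord_mat N a $$ (N - 1, j) - (if j = N - 1 then of_real (?e $ a) else 0))) = (\<Sum>j<N. if j = N - 2 then \<bar>ladder N (N - 2)\<bar> else 0)"
      using N unfolding 1 by (intro sum.cong refl) (auto simp: coord_index axis_def)
    then show ?thesis using lad w off by simp
  next
    case 2
    have "(\<Sum>j<N. cmod (coord_mat N a $$ (N - 1, j) - (if j = N - 1 then of_real (?e $ a) else 0))) = (\<Sum>j<N. if j = N - 2 then \<bar>ladder N (N - 2)\<bar> else 0)"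
      using N unfolding 2 by (intro sum.cong refl) (auto simp: coord_index axis_def norm_mult)
    then show ?thesis using lad w off by simp
  next
    case 3
    have "cmod (of_real (hbar N * weight N (N - 1)) - 1) = 1 - hbar N * weight N (N - 1)"
      using w norm_of_real[of "hbar N * weight N (N - 1) - 1", where 'a=complex] by simp
    then have "(\<Sum>j<N. cmod (coord_mat N a $$ (N - 1, j) - (if j = N - 1 then of_real (?e $ a) else 0))) = (\<Sum>j<N. if j = N - 1 then 1 - hbar N * weight N (N - 1) else 0)"
      using N unfolding 3 by (intro sum.cong refl) (auto simp: coord_index axis_def)
    then show ?thesis using lad w N hbar_pos[OF N] by simp
  qed
qed

text \<open>The distance of the last row from a multiple of the last basis vector. The last basis vector has
  the highest weight of \<open>X\<^sub>3\<close> and is concentrated at the north pole; it is nearly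
  an eigenvector of every family with a symbol, with the value of the symbol at the pole as
  eigenvalue.\<close>

definition last_row_dist :: "nat \<Rightarrow> complex mat \<Rightarrow> real \<Rightarrow> real" where
  "last_row_dist N A c = (\<Sum>j<N. cmod (A $$ (N - 1, j) - (if j = N - 1 then of_real c else 0)))"

lemma last_row_dist_nonneg: "0 \<le> last_row_dist N A c"
  by (simp add: last_row_dist_def sum_nonneg)

text \<open>In a product, the deviation of the row of the first factor is controlled by the row sums of the
  second.\<close>

lemma has_symbol_last_row: "has_symbol A p \<Longrightarrow> (\<lambda>N. last_row_dist N (A N) (p (axis 3 1))) \<longlonglongrightarrow> 0"
proof (induction rule: has_symbol.induct)
  case one
  have "\<forall>\<^sub>F N in sequentially. 0 = last_row_dist N (1\<^sub>m N) 1"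
    using eventually_ge_at_top[of 1] by eventually_elim (auto simp: last_row_dist_def intro!: sum.neutral)
  then show ?case by (rule Lim_transform_eventually[OF tendsto_const])
next
  case (coord a)
  have "\<forall>\<^sub>F N in sequentially. norm (last_row_dist N (coord_mat N a) (axis 3 1 $ a)) \<le> hbar N * sqrt (real N) + (1 - hbar N * weight N (N - 1))"
    using eventually_ge_at_top[of 2]
    by eventually_elim (use last_row_coord last_row_dist_nonneg in \<open>simp add: last_row_dist_def sum_nonneg\<close>)
  moreover have "(\<lambda>N. hbar N * sqrt (real N) + (1 - hbar N * weight N (N - 1))) \<longlonglongrightarrow> 0"
  proof -
    have "(\<lambda>N. 2 / sqrt ((real N)\<^sup>2 - 1) * sqrt (real N) + (1 - 2 / sqrt ((real N)\<^sup>2 - 1) * ((real N - 1) - (real N - 1) / 2))) \<longlonglongrightarrow> 0"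
      by real_asymp
    moreover have "\<forall>\<^sub>F N in sequentially. 2 / sqrt ((real N)\<^sup>2 - 1) * sqrt (real N) + (1 - 2 / sqrt ((real N)\<^sup>2 - 1) * ((real N - 1) - (real N - 1) / 2))
       = hbar N * sqrt (real N) + (1 - hbar N * weight N (N - 1))"
      using eventually_ge_at_top[of 1] by eventually_elim (simp add: hbar_def weight_def of_nat_diff)
    ultimately show ?thesis by (rule Lim_transform_eventually)
  qed
  ultimately show ?case by (rule Lim_null_comparison)
next
  case (add A p B q)
  have "\<forall>\<^sub>F N in sequentially. norm (last_row_dist N (A N + B N) (p (axis 3 1) + q (axis 3 1)))
      \<le> last_row_dist N (A N) (p (axis 3 1)) + last_row_dist N (B N) (q (axis 3 1))"
    using has_symbol_carrier[OF add.hyps(1)] has_symbol_carrier[OF add.hyps(2)] eventually_ge_at_top[of 1]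
  proof eventually_elim
    case (elim N)
    have "last_row_dist N (A N + B N) (p (axis 3 1) + q (axis 3 1))
      \<le> last_row_dist N (A N) (p (axis 3 1)) + last_row_dist N (B N) (q (axis 3 1))"
      unfolding last_row_dist_def sum.distrib[symmetric]
    proof (intro sum_mono)
      fix j assume "j \<in> {..<N}"
      then have "(A N + B N) $$ (N - 1, j) = A N $$ (N - 1, j) + B N $$ (N - 1, j)" using elim by auto
      then show "cmod ((A N + B N) $$ (N - 1, j) - (if j = N - 1 then of_real (p (axis 3 1) + q (axis 3 1)) else 0))
        \<le> cmod (A N $$ (N - 1, j) - (if j = N - 1 then of_real (p (axis 3 1)) else 0)) + cmod (B N $$ (N - 1, j) - (if j = N - 1 then of_real (q (axis 3 1)) else 0))"
        by (intro order_trans[OF _ norm_triangle_ineq]) (simp add: algebra_simps)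
    qed
    then show ?case by (simp add: last_row_dist_nonneg)
  qed
  then show ?case by (rule Lim_null_comparison) (rule tendsto_add_zero[OF add.IH])
next
  case (mult A p B q)
  let ?a = "p (axis 3 1)" and ?b = "q (axis 3 1)"
  obtain D where D: "\<forall>\<^sub>F N in sequentially. row_bound N (B N) D" using has_symbol_row_bound[OF mult.hyps(2)] by blast
  have "\<forall>\<^sub>F N in sequentially. norm (last_row_dist N (A N * B N) (?a * ?b)) \<le> last_row_dist N (A N) ?a * D + \<bar>?a\<bar> * last_row_dist N (B N) ?b"
    using has_symbol_carrier[OF mult.hyps(1)] has_symbol_carrier[OF mult.hyps(2)] D eventually_ge_at_top[of 1]
  proof eventually_elim
    case (elim N)
    let ?r = "\<lambda>k. A N $$ (N - 1, k) - (if k = N - 1 then of_real ?a else 0)"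
    let ?s = "\<lambda>j. B N $$ (N - 1, j) - (if j = N - 1 then of_real ?b else 0)"
    have N: "N - 1 < N" using elim by simp
    have eq: "(A N * B N) $$ (N - 1, j) - (if j = N - 1 then of_real (?a * ?b) else 0) = (\<Sum>k<N. ?r k * B N $$ (k, j)) + of_real ?a * ?s j" if "j < N" for j
    proof -
      have "(\<Sum>k<N. ?r k * B N $$ (k, j)) = (\<Sum>k<N. A N $$ (N - 1, k) * B N $$ (k, j)) - (\<Sum>k<N. if k = N - 1 then of_real ?a * B N $$ (N - 1, j) else 0)"
        unfolding sum_subtractf[symmetric] by (intro sum.cong refl) (auto simp: algebra_simps)
      also have "\<dots> = (A N * B N) $$ (N - 1, j) - of_real ?a * B N $$ (N - 1, j)"
        using mat_mult_index[OF elim(1,2) N that] elim by simp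
      finally show ?thesis by (simp add: algebra_simps)
    qed
    have "last_row_dist N (A N * B N) (?a * ?b) \<le> (\<Sum>j<N. (\<Sum>k<N. cmod (?r k) * cmod (B N $$ (k, j))) + \<bar>?a\<bar> * cmod (?s j))"
      unfolding last_row_dist_def
    proof (intro sum_mono)
      fix j assume "j \<in> {..<N}"
      then have j: "j < N" by simp
      have "cmod ((\<Sum>k<N. ?r k * B N $$ (k, j)) + of_real ?a * ?s j) \<le> cmod (\<Sum>k<N. ?r k * B N $$ (k, j)) + cmod (of_real ?a * ?s j)"
        by (rule norm_triangle_ineq)
      also have "cmod (\<Sum>k<N. ?r k * B N $$ (k, j)) \<le> (\<Sum>k<N. cmod (?r k) * cmod (B N $$ (k, j)))"
        by (rule order_trans[OF norm_sum]) (simp add: norm_mult)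
      finally show "cmod ((A N * B N) $$ (N - 1, j) - (if j = N - 1 then of_real (?a * ?b) else 0))
        \<le> (\<Sum>k<N. cmod (?r k) * cmod (B N $$ (k, j))) + \<bar>?a\<bar> * cmod (?s j)"
        unfolding eq[OF j] by (simp add: norm_mult)
    qed
    also have "\<dots> = (\<Sum>k<N. cmod (?r k) * (\<Sum>j<N. cmod (B N $$ (k, j)))) + \<bar>?a\<bar> * last_row_dist N (B N) ?b"
      unfolding sum.distrib last_row_dist_def by (subst sum.swap) (simp add: sum_distrib_left)
    also have "(\<Sum>k<N. cmod (?r k) * (\<Sum>j<N. cmod (B N $$ (k, j)))) \<le> (\<Sum>k<N. cmod (?r k) * D)"
      using elim(3) by (intro sum_mono mult_left_mono) (auto simp: row_bound_def)
    finally show ?case by (simp add: last_row_dist_nonneg last_row_dist_def[of N "A N"] sum_distrib_right)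
  qed
  then show ?case
    by (rule Lim_null_comparison) (intro tendsto_add_zero tendsto_mult_left_zero tendsto_mult_right_zero mult.IH)
next
  case (scale A p c c0)
  let ?a = "p (axis 3 1)"
  have "\<forall>\<^sub>F N in sequentially. norm (last_row_dist N (of_real (c N) \<cdot>\<^sub>m A N) (c0 * ?a)) \<le> \<bar>c N\<bar> * last_row_dist N (A N) ?a + \<bar>c N - c0\<bar> * \<bar>?a\<bar>"
    using has_symbol_carrier[OF scale.hyps(1)] eventually_ge_at_top[of 1]
  proof eventually_elim
    case (elim N)
    have "last_row_dist N (of_real (c N) \<cdot>\<^sub>m A N) (c0 * ?a) \<le> (\<Sum>j<N. \<bar>c N\<bar> * cmod (A N $$ (N - 1, j) - (if j = N - 1 then of_real ?a else 0)) + (if j = N - 1 then \<bar>c N - c0\<bar> * \<bar>?a\<bar> else 0))"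
      unfolding last_row_dist_def
    proof (intro sum_mono)
      fix j assume "j \<in> {..<N}"
      then have e: "(of_real (c N) \<cdot>\<^sub>m A N) $$ (N - 1, j) = of_real (c N) * A N $$ (N - 1, j)" using elim by auto
      have "(of_real (c N) \<cdot>\<^sub>m A N) $$ (N - 1, j) - (if j = N - 1 then of_real (c0 * ?a) else 0)
        = of_real (c N) * (A N $$ (N - 1, j) - (if j = N - 1 then of_real ?a else 0)) + (if j = N - 1 then of_real ((c N - c0) * ?a) else 0)"
        unfolding e by (auto simp: algebra_simps)
      also have "cmod \<dots> \<le> cmod (of_real (c N) * (A N $$ (N - 1, j) - (if j = N - 1 then of_real ?a else 0))) + cmod (if j = N - 1 then of_real ((c N - c0) * ?a) else 0)"
        by (rule norm_triangle_ineq)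
      also have "\<dots> = \<bar>c N\<bar> * cmod (A N $$ (N - 1, j) - (if j = N - 1 then of_real ?a else 0)) + (if j = N - 1 then \<bar>c N - c0\<bar> * \<bar>?a\<bar> else 0)"
        by (simp add: norm_mult abs_mult del: of_real_diff of_real_mult)
      finally show "cmod ((of_real (c N) \<cdot>\<^sub>m A N) $$ (N - 1, j) - (if j = N - 1 then of_real (c0 * ?a) else 0)) \<le> \<dots>" .
    qed
    also have "\<dots> = \<bar>c N\<bar> * last_row_dist N (A N) ?a + \<bar>c N - c0\<bar> * \<bar>?a\<bar>"
      using elim by (simp add: sum.distrib last_row_dist_def sum_distrib_left)
    finally show ?case by (simp add: last_row_dist_nonneg)
  qed
  moreover have "(\<lambda>N. \<bar>c N\<bar> * last_row_dist N (A N) ?a + \<bar>c N - c0\<bar> * \<bar>?a\<bar>) \<longlonglongrightarrow> \<bar>c0\<bar> * 0 + \<bar>c0 - c0\<bar> * \<bar>?a\<bar>"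
    by (intro tendsto_intros scale.IH scale.hyps(2))
  then have "(\<lambda>N. \<bar>c N\<bar> * last_row_dist N (A N) ?a + \<bar>c N - c0\<bar> * \<bar>?a\<bar>) \<longlonglongrightarrow> 0" by simp
  ultimately show ?case by (rule Lim_null_comparison)
next
  case (sphere A p q)
  have "p (axis 3 1) = q (axis 3 1)" by (rule sphere.hyps(3)) simp
  then show ?case using sphere.IH by simp
next
  case (eventually A p B)
  have "\<forall>\<^sub>F N in sequentially. last_row_dist N (A N) (p (axis 3 1)) = last_row_dist N (B N) (p (axis 3 1))"
    using eventually.hyps(2) by eventually_elim simp
  then show ?case by (rule Lim_transform_eventually[OF eventually.IH])
qed

lemma has_symbol_last_entry:
  assumes "has_symbol A p"
  shows "(\<lambda>N. A N $$ (N - 1, N - 1)) \<longlonglongrightarrow> of_real (p (axis 3 1))"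
proof -
  have "\<forall>\<^sub>F N in sequentially. norm (A N $$ (N - 1, N - 1) - of_real (p (axis 3 1))) \<le> last_row_dist N (A N) (p (axis 3 1))"
    using eventually_ge_at_top[of 1]
  proof eventually_elim
    case (elim N)
    let ?f = "\<lambda>j. cmod (A N $$ (N - 1, j) - (if j = N - 1 then of_real (p (axis 3 1)) else 0))"
    have "?f (N - 1) \<le> (\<Sum>j<N. ?f j)" using elim by (intro member_le_sum) auto
    then show ?case by (simp add: last_row_dist_def)
  qed
  then have "(\<lambda>N. A N $$ (N - 1, N - 1) - of_real (p (axis 3 1))) \<longlonglongrightarrow> 0"
    by (rule Lim_null_comparison) (rule has_symbol_last_row[OF assms])
  then show ?thesis by (simp add: LIM_zero_iff)
qed

section \<open>Legendre polynomials and their difference analogues\<close>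
abbreviation sphere_eigenvalue :: "nat \<Rightarrow> real" where "sphere_eigenvalue k \<equiv> real k * (real k + 1)"

definition degree_below :: "nat \<Rightarrow> real poly \<Rightarrow> bool" where
  "degree_below n q \<longleftrightarrow> (\<forall>i\<ge>n. poly.coeff q i = 0)"

text \<open>The properties that the Legendre operator and its difference analogue have in common: they are
  triangular on polynomials, with the diagonal entries \<open>-k(k + 1)\<close>.\<close>

definition lowers_degree :: "(real poly \<Rightarrow> real poly) \<Rightarrow> bool" where
  "lowers_degree J \<longleftrightarrow> (\<forall>p q. J (p + q) = J p + J q) \<and> (\<forall>a p. J (Polynomial.smult a p) = Polynomial.smult a (J p)) \<and>
     (\<forall>k q. degree_below (Suc k) q \<longrightarrow> degree_below k (J q + Polynomial.smult (sphere_eigenvalue k) q))"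

text \<open>The product of the factors \<open>J + i(i + 1)\<close> for \<open>i < k\<close>. Applied to a
  polynomial of degree \<open>k\<close> it removes the eigencomponents of smaller degree, and does
  so without dividing by differences of eigenvalues.\<close>

primrec eigen_filter :: "(real poly \<Rightarrow> real poly) \<Rightarrow> nat \<Rightarrow> real poly \<Rightarrow> real poly" where
  "eigen_filter J 0 q = q"
| "eigen_filter J (Suc k) q = eigen_filter J k (J q + Polynomial.smult (sphere_eigenvalue k) q)"

lemma degree_below_0: "degree_below 0 q \<longleftrightarrow> q = 0"
  by (simp add: degree_below_def poly_eq_iff)

lemma eigen_filter_zero: "lowers_degree J \<Longrightarrow> degree_below k q \<Longrightarrow> eigen_filter J k q = 0"
  by (induction k arbitrary: q) (auto simp: degree_below_0 lowers_degree_def)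

lemma eigen_filter_commute:
  assumes J: "lowers_degree J"
  shows "eigen_filter J k (J q + Polynomial.smult a q) = J (eigen_filter J k q) + Polynomial.smult a (eigen_filter J k q)"
proof (induction k arbitrary: q)
  case (Suc k)
  have add: "J (p + q) = J p + J q" and sm: "J (Polynomial.smult b p) = Polynomial.smult b (J p)" for p q b
    using J by (auto simp: lowers_degree_def)
  let ?q = "J q + Polynomial.smult (sphere_eigenvalue k) q"
  have "J (J q + Polynomial.smult a q) + Polynomial.smult (sphere_eigenvalue k) (J q + Polynomial.smult a q) = J ?q + Polynomial.smult a ?q"
    by (simp add: add sm smult_add_right mult.commute algebra_simps)
  then show ?case by (simp only: eigen_filter.simps Suc.IH)
qed simp

text \<open>Applying all factors \<open>J + i(i + 1)\<close> with \<open>i \<le> l\<close> to a polynomial of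
  degree \<open>l\<close> lowers the degree \<open>l + 1\<close> times and hence gives zero; the
  factors commute, so the one for \<open>l\<close> can be pulled out.\<close>

lemma eigen_filter_eigen:
  assumes J: "lowers_degree J"
  shows "J (eigen_filter J l (monom 1 l)) = Polynomial.smult (- sphere_eigenvalue l) (eigen_filter J l (monom 1 l))"
proof -
  have "degree_below (Suc l) (monom 1 l)" by (auto simp: degree_below_def)
  then have "degree_below l (J (monom 1 l) + Polynomial.smult (sphere_eigenvalue l) (monom 1 l))"
    using J unfolding lowers_degree_def by blast
  then have "eigen_filter J l (J (monom 1 l) + Polynomial.smult (sphere_eigenvalue l) (monom 1 l)) = 0"
    by (rule eigen_filter_zero[OF J])
  then have "J (eigen_filter J l (monom 1 l)) + Polynomial.smult (sphere_eigenvalue l) (eigen_filter J l (monom 1 l)) = 0"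
    unfolding eigen_filter_commute[OF J] .
  then show ?thesis by (simp add: eq_neg_iff_add_eq_0)
qed

lemma degree_below_Suc_decomp:
  assumes "degree_below (Suc k) q"
  shows "q = (\<Sum>i\<le>k. Polynomial.smult (poly.coeff q i) (monom 1 i))"
proof -
  have "degree q \<le> k" using assms by (intro degree_le) (auto simp: degree_below_def)
  then show ?thesis using poly_as_sum_of_monoms'[of q k] by (simp add: smult_monom)
qed

lemma degree_below_smult: "degree_below n p \<Longrightarrow> degree_below n (Polynomial.smult a p)"
  by (simp add: degree_below_def)

lemma degree_below_sum: "(\<And>i. i \<in> A \<Longrightarrow> degree_below n (f i)) \<Longrightarrow> degree_below n (sum f A)"
  by (simp add: degree_below_def coeff_sum)

lemma lowers_degreeI:
  assumes add: "\<And>p q. J (p + q) = J p + J q" and sm: "\<And>a p. J (Polynomial.smult a p) = Polynomial.smult a (J p)"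
    and mon: "\<And>n. degree_below n (J (monom 1 n) + Polynomial.smult (sphere_eigenvalue n) (monom 1 n))"
  shows "lowers_degree J"
  unfolding lowers_degree_def
proof (intro conjI allI impI add sm)
  fix k q assume q: "degree_below (Suc k) q"
  have J0: "J 0 = 0" using sm[of 0 0] by simp
  have Jsum: "J (sum f A) = (\<Sum>i\<in>A. J (f i))" if "finite A" for f and A :: "nat set"
    using that by (induction A rule: finite_induct) (auto simp: add J0)
  let ?c = "poly.coeff q"
  have "J q + Polynomial.smult (sphere_eigenvalue k) q = (\<Sum>i\<le>k. Polynomial.smult (?c i) (J (monom 1 i) + Polynomial.smult (sphere_eigenvalue k) (monom 1 i)))"
    by (subst (1 2) degree_below_Suc_decomp[OF q])
       (simp add: Jsum sm smult_sum2 smult_add_right sum.distrib smult_smult mult.commute)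
  also have "degree_below k \<dots>"
  proof (intro degree_below_sum degree_below_smult)
    fix i assume "i \<in> {..k}"
    then consider "i = k" | "i < k" by fastforce
    then show "degree_below k (J (monom 1 i) + Polynomial.smult (sphere_eigenvalue k) (monom 1 i))"
    proof cases
      case 1
      then show ?thesis using mon[of k] by simp
    next
      case 2
      show ?thesis unfolding degree_below_def
      proof (intro allI impI)
        fix j assume j: "k \<le> j"
        then have "poly.coeff (J (monom 1 i) + Polynomial.smult (sphere_eigenvalue i) (monom 1 i)) j = 0"
          using mon[of i, unfolded degree_below_def, rule_format, of j] 2 by linarith
        then show "poly.coeff (J (monom 1 i) + Polynomial.smult (sphere_eigenvalue k) (monom 1 i)) j = 0"
          using 2 j by simp
      qed
    qed
  qed
  finally show "degree_below k (J q + Polynomial.smult (sphere_eigenvalue k) q)" .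
qed

definition diff2 :: "real poly \<Rightarrow> real poly" where
  "diff2 q = pcompose q [:1, 1:] + pcompose q [:-1, 1:] - Polynomial.smult 2 q"

definition diff1 :: "real poly \<Rightarrow> real poly" where
  "diff1 q = pcompose q [:1, 1:] - pcompose q [:-1, 1:]"

text \<open>The Hoppe--Yau Laplacian on diagonal matrices whose entries are a polynomial in the weight
  (\<open>jacobi_diff_poly\<close> below), with \<open>c = l'(l' + 1)\<close>, where \<open>l' = (N
  - 1)/2\<close>.\<close>

definition jacobi_op :: "real \<Rightarrow> real poly \<Rightarrow> real poly" where
  "jacobi_op c q = Polynomial.smult c (diff2 q) - pCons 0 (pCons 0 (diff2 q)) - pCons 0 (diff1 q)"

lemma diff_pCons:
  "diff2 (pCons 0 q) = pCons 0 (diff2 q) + diff1 q"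
  "diff1 (pCons 0 q) = pCons 0 (diff1 q) + diff2 q + Polynomial.smult 2 q"
  by (simp_all add: diff1_def diff2_def pcompose_pCons algebra_simps)

text \<open>The two leading coefficients that survive in the combination defining \<open>jacobi_op\<close>.\<close>

lemma diff_monom:
  shows "(\<forall>i. i + 2 > n \<longrightarrow> poly.coeff (diff2 (monom 1 n)) i = 0) \<and>
    (\<forall>i. i + 2 = n \<longrightarrow> poly.coeff (diff2 (monom 1 n)) i = real n * (real n - 1)) \<and>
    (\<forall>i. i + 1 > n \<longrightarrow> poly.coeff (diff1 (monom 1 n)) i = 0) \<and>
    (\<forall>i. i + 1 = n \<longrightarrow> poly.coeff (diff1 (monom 1 n)) i = 2 * real n)"
proof (induction n)
  case 0
  have "diff2 (monom 1 0) = 0" "diff1 (monom 1 0) = 0"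
    by (simp_all add: diff1_def diff2_def monom_0 one_pCons[symmetric] pcompose_1 numeral_poly)
  then show ?case by simp
next
  case (Suc n)
  have m: "monom 1 (Suc n) = pCons 0 (monom (1::real) n)" by (simp add: monom_Suc)
  show ?case
    unfolding m diff_pCons
    using Suc.IH by (auto simp: coeff_pCons algebra_simps split: nat.splits)
qed

lemma lowers_degree_jacobi: "lowers_degree (jacobi_op c)"
proof (rule lowers_degreeI)
  show "jacobi_op c (p + q) = jacobi_op c p + jacobi_op c q" for p q
    by (simp add: jacobi_op_def diff1_def diff2_def pcompose_add smult_add_right smult_diff_right algebra_simps)
  show "jacobi_op c (Polynomial.smult a p) = Polynomial.smult a (jacobi_op c p)" for a p
    by (simp add: jacobi_op_def diff1_def diff2_def pcompose_smult smult_add_right smult_diff_right algebra_simps)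
  fix n
  show "degree_below n (jacobi_op c (monom 1 n) + Polynomial.smult (sphere_eigenvalue n) (monom 1 n))"
    unfolding degree_below_def
  proof (intro allI impI)
    fix i assume i: "n \<le> i"
    note D = diff_monom[of n]
    show "poly.coeff (jacobi_op c (monom 1 n) + Polynomial.smult (sphere_eigenvalue n) (monom 1 n)) i = 0"
    proof (cases "i = n")
      case True
      have "poly.coeff (pCons 0 (pCons 0 (diff2 (monom 1 n)))) n = real n * (real n - 1)"
        using D by (auto simp: coeff_pCons split: nat.splits)
      moreover have "poly.coeff (pCons 0 (diff1 (monom 1 n))) n = 2 * real n"
        using D by (auto simp: coeff_pCons split: nat.splits)
      moreover have "poly.coeff (diff2 (monom 1 n)) n = 0" using D by simp
      ultimately show ?thesis unfolding True jacobi_op_def coeff_add coeff_diff coeff_smult coeff_monom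
        by (simp add: algebra_simps)
    next
      case False
      have "poly.coeff (pCons 0 (pCons 0 (diff2 (monom 1 n)))) i = 0"
        using D i False by (auto simp: coeff_pCons split: nat.splits)
      moreover have "poly.coeff (pCons 0 (diff1 (monom 1 n))) i = 0"
        using D i False by (auto simp: coeff_pCons split: nat.splits)
      ultimately show ?thesis using D i False by (simp add: jacobi_op_def)
    qed
  qed
qed

lemma poly_jacobi_op:
  "poly (jacobi_op c q) w = (c - w\<^sup>2 - w) * (poly q (w + 1) - poly q w) - (c - w\<^sup>2 + w) * (poly q w - poly q (w - 1))"
  by (simp add: jacobi_op_def diff1_def diff2_def poly_pcompose power2_eq_square algebra_simps)

definition legendre_op :: "real poly \<Rightarrow> real poly" where
  "legendre_op q = [:1, 0, -1:] * pderiv (pderiv q) - [:0, 2:] * pderiv q"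

lemma coeff_legendre_op:
  "poly.coeff (legendre_op q) i = (real i + 2) * (real i + 1) * poly.coeff q (i + 2) - sphere_eigenvalue i * poly.coeff q i"
  by (cases i; cases "i - 1") (auto simp: legendre_op_def coeff_pderiv coeff_pCons algebra_simps split: nat.splits)

lemma lowers_degree_legendre: "lowers_degree legendre_op"
proof (rule lowers_degreeI)
  show "legendre_op (p + q) = legendre_op p + legendre_op q" for p q
    by (rule poly_eqI) (simp only: coeff_legendre_op coeff_add, simp add: algebra_simps)
  show "legendre_op (Polynomial.smult a p) = Polynomial.smult a (legendre_op p)" for a p
    by (rule poly_eqI) (simp only: coeff_legendre_op coeff_smult, simp add: algebra_simps)
  fix n show "degree_below n (legendre_op (monom 1 n) + Polynomial.smult (sphere_eigenvalue n) (monom 1 n))"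
    unfolding degree_below_def by (simp add: coeff_legendre_op)
qed

lemma poly_legendre_op:
  "poly (legendre_op q) x = (1 - x\<^sup>2) * poly (pderiv (pderiv q)) x - 2 * x * poly (pderiv q) x"
  by (simp add: legendre_op_def power2_eq_square algebra_simps)

text \<open>Comparing coefficients determines all coefficients from the leading one, since the eigenvalues are
  distinct.\<close>

lemma legendre_op_eigen_unique:
  assumes e: "legendre_op q = Polynomial.smult (- sphere_eigenvalue l) q" and b: "degree_below l q"
  shows "q = 0"
proof -
  have rec: "(real i + 2) * (real i + 1) * poly.coeff q (i + 2) = (sphere_eigenvalue i - sphere_eigenvalue l) * poly.coeff q i" for i
    using arg_cong[OF e, of "\<lambda>p. poly.coeff p i"] by (simp add: coeff_legendre_op algebra_simps)
  have "poly.coeff q i = 0" for i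
  proof (induction "l - i" arbitrary: i rule: less_induct)
    case less
    show ?case
    proof (cases "i \<ge> l")
      case True
      then show ?thesis using b by (simp add: degree_below_def)
    next
      case False
      have "poly.coeff q (i + 2) = 0"
        using False less.hyps[of "i + 2"] by auto
      then have "(sphere_eigenvalue i - sphere_eigenvalue l) * poly.coeff q i = 0" using rec[of i] by simp
      moreover have "sphere_eigenvalue i < sphere_eigenvalue l" using False by (intro mult_strict_mono) auto
      ultimately show ?thesis by simp
    qed
  qed
  then show ?thesis by (simp add: poly_eq_iff)
qed

lemma coeff_eigen_filter_legendre:
  assumes "degree_below (Suc l) q" "k \<le> l"
  shows "poly.coeff (eigen_filter legendre_op k q) l = (\<Prod>i<k. sphere_eigenvalue i - sphere_eigenvalue l) * poly.coeff q l \<and> degree_below (Suc l) (eigen_filter legendre_op k q)"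
  using assms
proof (induction k arbitrary: q)
  case (Suc k)
  have b: "degree_below (Suc l) (legendre_op q + Polynomial.smult (sphere_eigenvalue k) q)"
    using Suc.prems by (simp add: degree_below_def coeff_legendre_op)
  have "poly.coeff (legendre_op q + Polynomial.smult (sphere_eigenvalue k) q) l = (sphere_eigenvalue k - sphere_eigenvalue l) * poly.coeff q l"
    using Suc.prems by (simp add: degree_below_def coeff_legendre_op algebra_simps)
  then show ?case using Suc.IH[OF b] Suc.prems by simp
qed simp

text \<open>The coefficient form of \<open>(x\<^sup>2 - 1) u' = 2 l x u\<close> for \<open>u = (x\<^sup>2 -
  1)\<^sup>l\<close>, from which the Legendre equation follows by differentiating \<open>l\<close>
  times.\<close>

lemma rodrigues_base_coeff:
  defines "u \<equiv> \<lambda>l. [:-1, 0, 1 :: real:] ^ l"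
  shows "(real n + 2) * poly.coeff (u l) (n + 2) = (real n - 2 * real l) * poly.coeff (u l) n"
proof -
  have "[:-1, 0, 1:] * pderiv (u l) = Polynomial.smult (2 * real l) (pCons 0 (u l))"
  proof (cases l)
    case 0
    then show ?thesis by (simp add: u_def)
  next
    case (Suc m)
    have p: "pderiv [:-1, 0, 1 :: real:] = [:0, 2:]" by (simp add: pderiv_pCons)
    have "[:-1, 0, 1 :: real:] * pderiv ([:-1, 0, 1:] ^ Suc m) = [:0, 2:] * Polynomial.smult (real (Suc m)) ([:-1, 0, 1:] ^ Suc m)"
      unfolding pderiv_power_Suc p by (simp only: power_Suc mult_smult_left mult_smult_right mult_ac)
    also have "\<dots> = Polynomial.smult (2 * real (Suc m)) (pCons 0 ([:-1, 0, 1:] ^ Suc m))"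
    proof -
      have "[:0, 2:] * Polynomial.smult a X = Polynomial.smult (2 * a) (pCons 0 X)" for a and X :: "real poly" by (simp add: mult.commute)
      then show ?thesis .
    qed
    finally show ?thesis unfolding u_def Suc .
  qed
  moreover have "poly.coeff ([:-1, 0, 1:] * pderiv P) (Suc n) = real n * poly.coeff P n - (real n + 2) * poly.coeff P (n + 2)" for P :: "real poly"
  proof -
    have "[:-1, 0, 1:] * pderiv P = pCons 0 (pCons 0 (pderiv P)) - pderiv P" by simp
    then show ?thesis by (cases n) (simp_all add: coeff_pderiv)
  qed
  moreover have "poly.coeff (Polynomial.smult (2 * real l) (pCons 0 P)) (Suc n) = 2 * real l * poly.coeff P n" for P :: "real poly"
    by simp
  ultimately have "real n * poly.coeff (u l) n - (real n + 2) * poly.coeff (u l) (n + 2) = 2 * real l * poly.coeff (u l) n"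
    by metis
  then show ?thesis by (simp add: algebra_simps)
qed

lemma coeff_legendre_poly:
  "poly.coeff (legendre_poly l) i = (1 / (2 ^ l * fact l)) * (pochhammer (real (Suc i)) l * poly.coeff ([:-1, 0, 1:] ^ l) (i + l))"
  by (simp add: legendre_poly_def coeff_higher_pderiv)

lemma legendre_poly_recurrence:
  "(real i + 2) * (real i + 1) * poly.coeff (legendre_poly l) (i + 2) = (sphere_eigenvalue i - sphere_eigenvalue l) * poly.coeff (legendre_poly l) i"
proof -
  let ?u = "\<lambda>n. poly.coeff ([:-1, 0, 1 :: real:] ^ l) n"
  have "(real i + 1) * ((real i + 2) * pochhammer (real i + 3) l) = pochhammer (real i + 1) (Suc (Suc l))"
    unfolding pochhammer_rec[of "real i + 1"] pochhammer_rec[of "real i + 1 + 1"] by (simp add: algebra_simps)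
  also have "\<dots> = pochhammer (real i + 1) l * (real i + 1 + real l) * (real i + 2 + real l)"
    by (simp add: pochhammer_Suc algebra_simps)
  finally have P: "(real i + 1) * ((real i + 2) * pochhammer (real i + 3) l)
     = pochhammer (real i + 1) l * (real i + 1 + real l) * (real i + 2 + real l)" .
  have "(real i + 2) * (real i + 1) * (pochhammer (real i + 3) l * ?u (i + l + 2))
     = ((real i + 1) * ((real i + 2) * pochhammer (real i + 3) l)) * ?u (i + l + 2)"
    by (simp only: mult_ac)
  also have "\<dots> = pochhammer (real i + 1) l * (real i + 1 + real l) * ((real (i + l) + 2) * ?u (i + l + 2))"
    unfolding P by (simp only: mult_ac add_ac of_nat_add)
  also have "\<dots> = (sphere_eigenvalue i - sphere_eigenvalue l) * (pochhammer (real i + 1) l * ?u (i + l))"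
  proof -
    have e: "(real i + 1 + real l) * (real (i + l) - 2 * real l) = sphere_eigenvalue i - sphere_eigenvalue l" by (simp add: algebra_simps)
    have "pochhammer (real i + 1) l * (real i + 1 + real l) * ((real (i + l) - 2 * real l) * ?u (i + l))
      = ((real i + 1 + real l) * (real (i + l) - 2 * real l)) * (pochhammer (real i + 1) l * ?u (i + l))"
      by (simp only: mult_ac)
    then show ?thesis unfolding rodrigues_base_coeff e .
  qed
  finally have A: "(real i + 2) * (real i + 1) * (pochhammer (real i + 3) l * ?u (i + l + 2)) = (sphere_eigenvalue i - sphere_eigenvalue l) * (pochhammer (real i + 1) l * ?u (i + l))" .
  have e: "real (Suc (i + 2)) = real i + 3" "real (Suc i) = real i + 1" "i + 2 + l = i + l + 2" by simp_all
  show ?thesis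
    unfolding coeff_legendre_poly e using arg_cong[OF A, of "\<lambda>z. 1 / (2 ^ l * fact l) * z"] by (simp only: mult.left_commute)
qed

lemma legendre_poly_eigen: "legendre_op (legendre_poly l) = Polynomial.smult (- sphere_eigenvalue l) (legendre_poly l)"
proof (rule poly_eqI)
  fix n show "poly.coeff (legendre_op (legendre_poly l)) n = poly.coeff (Polynomial.smult (- sphere_eigenvalue l) (legendre_poly l)) n"
    unfolding coeff_legendre_op legendre_poly_recurrence by (simp add: algebra_simps)
qed

lemma legendre_poly_degree_below: "degree_below (Suc l) (legendre_poly l)"
proof -
  have "degree ([:-1, 0, 1 :: real:] ^ l) \<le> 2 * l" 
    by (rule order_trans[OF degree_power_le]) simp
  then show ?thesis unfolding degree_below_def coeff_legendre_poly by (auto simp: coeff_eq_0)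
qed

text \<open>Of the \<open>l\<close> derivatives in Rodrigues' formula each has to hit a factor \<open>x -
  1\<close> to contribute at \<open>1\<close>.\<close>

lemma legendre_poly_at_1: "poly (legendre_poly l) 1 = 1"
proof -
  have "\<exists>r. (pderiv ^^ k) ([:-1, 1 :: real:] ^ l * q) = [:-1, 1:] ^ (l - k) * r \<and> poly r 1 = fact l / fact (l - k) * poly q 1" if "k \<le> l" for k q
    using that
  proof (induction k)
    case 0
    then show ?case by auto
  next
    case (Suc k)
    then obtain r where r: "(pderiv ^^ k) ([:-1, 1 :: real:] ^ l * q) = [:-1, 1:] ^ (l - k) * r" "poly r 1 = fact l / fact (l - k) * poly q 1"
      by auto
    obtain m where m: "l - k = Suc m" "l - Suc k = m" using Suc.prems by (metis Suc_diff_Suc Suc_le_eq)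
    have p: "pderiv [:-1, 1 :: real:] = 1" by (simp add: pderiv_pCons one_pCons)
    let ?r = "Polynomial.smult (real (Suc m)) r + [:-1, 1:] * pderiv r"
    have "(pderiv ^^ Suc k) ([:-1, 1 :: real:] ^ l * q) = [:-1, 1:] ^ m * ?r"
      unfolding funpow.simps o_apply r m pderiv_mult pderiv_power_Suc p by (simp add: algebra_simps)
    moreover have "poly ?r 1 = fact l / fact m * poly q 1"
    proof -
      have "real (Suc m) * (fact l / fact (Suc m)) = (fact l / fact m :: real)"
        by (simp only: fact_Suc of_nat_mult) simp
      then show ?thesis using r(2) unfolding m by (simp add: mult.assoc[symmetric])
    qed
    ultimately show ?case using m by auto
  qed
  from this[of l "[:1, 1:] ^ l"]
  obtain r where r: "(pderiv ^^ l) ([:-1, 1 :: real:] ^ l * [:1, 1:] ^ l) = r" "poly r 1 = fact l * 2 ^ l"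
    by (auto simp: poly_power)
  have "[:-1, 0, 1 :: real:] = [:-1, 1:] * [:1, 1:]" by simp
  then have "[:-1, 0, 1 :: real:] ^ l = [:-1, 1:] ^ l * [:1, 1:] ^ l" by (simp only: power_mult_distrib)
  then show ?thesis using r by (simp add: legendre_poly_def)
qed

lemma legendre_poly_lead: "poly.coeff (legendre_poly l) l \<noteq> 0"
proof
  assume "poly.coeff (legendre_poly l) l = 0"
  then have "degree_below l (legendre_poly l)" using legendre_poly_degree_below[of l]
    unfolding degree_below_def by (metis Suc_le_eq le_neq_implies_less)
  then have "legendre_poly l = 0" by (rule legendre_op_eigen_unique[OF legendre_poly_eigen])
  then show False using legendre_poly_at_1[of l] by simp
qed

lemma legendre_poly_parity: "odd (l + i) \<Longrightarrow> poly.coeff (legendre_poly l) i = 0"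
proof -
  have "odd n \<Longrightarrow> poly.coeff ([:-1, 0, 1 :: real:] ^ l) n = 0" for n
  proof (induction l arbitrary: n)
    case (Suc l)
    then show ?case by (auto simp: coeff_pCons split: nat.splits)
  qed (auto simp: coeff_1 odd_pos)
  then show "odd (l + i) \<Longrightarrow> poly.coeff (legendre_poly l) i = 0"
    unfolding coeff_legendre_poly by (simp add: add.commute)
qed

lemma eigen_filter_legendre_eq:
  shows "\<exists>\<kappa>. \<kappa> \<noteq> 0 \<and> eigen_filter legendre_op l (monom 1 l) = Polynomial.smult \<kappa> (legendre_poly l)"
proof -
  let ?e = "eigen_filter legendre_op l (monom 1 l)"
  have b: "degree_below (Suc l) (monom (1::real) l)" by (auto simp: degree_below_def)
  have ne: "sphere_eigenvalue i - sphere_eigenvalue l \<noteq> 0" if "i < l" for i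
  proof -
    have "sphere_eigenvalue i < sphere_eigenvalue l" using that by (intro mult_strict_mono) auto
    then show ?thesis by simp
  qed
  have c: "poly.coeff ?e l = (\<Prod>i<l. sphere_eigenvalue i - sphere_eigenvalue l)" "degree_below (Suc l) ?e"
    using coeff_eigen_filter_legendre[OF b order_refl] by auto
  have nz: "poly.coeff ?e l \<noteq> 0" unfolding c(1) using ne by simp
  \<comment> \<open>with this factor the difference has degree less than \<open>l\<close>, and is
    an eigenvector for the eigenvalue of degree \<open>l\<close>\<close>
  define \<kappa> where "\<kappa> = poly.coeff ?e l / poly.coeff (legendre_poly l) l"
  let ?d = "?e - Polynomial.smult \<kappa> (legendre_poly l)"
  have "degree_below l ?d"
    unfolding degree_below_def
  proof (intro allI impI)
    fix i assume "l \<le> i"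
    then show "poly.coeff ?d i = 0"
      using c(2) legendre_poly_degree_below[of l] legendre_poly_lead[of l]
      by (cases "i = l") (auto simp: degree_below_def \<kappa>_def)
  qed
  moreover have "legendre_op ?d = Polynomial.smult (- sphere_eigenvalue l) ?d"
  proof -
    have "legendre_op ?d = legendre_op ?e - Polynomial.smult \<kappa> (legendre_op (legendre_poly l))"
      by (rule poly_eqI) (simp add: coeff_legendre_op algebra_simps)
    then show ?thesis unfolding eigen_filter_eigen[OF lowers_degree_legendre] legendre_poly_eigen
      by (simp add: smult_diff_right mult.commute)
  qed
  ultimately have "?d = 0" by (intro legendre_op_eigen_unique)
  moreover have "\<kappa> \<noteq> 0" using nz legendre_poly_lead[of l] by (simp add: \<kappa>_def)
  ultimately show ?thesis by auto
qed

section \<open>Quantized zonal functions\<close>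
lemma hoppe_yau_ad:
  assumes A: "A \<in> carrier_mat N N"
  shows "hoppe_yau N A = ad N 1 (ad N 1 A) + ad N 2 (ad N 2 A) + ad N 3 (ad N 3 A)"
proof -
  have 1: "ad N a (ad N a A) = of_real (1 / (hbar N)\<^sup>2) \<cdot>\<^sub>m commutator (quant_coord N a) (commutator (quant_coord N a) A)" for a
  proof -
    have C: "commutator (quant_coord N a) A \<in> carrier_mat N N" using A by simp
    have "commutator (quant_coord N a) (c \<cdot>\<^sub>m B) = c \<cdot>\<^sub>m commutator (quant_coord N a) B" if "B \<in> carrier_mat N N" for c :: complex and B
      unfolding commutator_def using that carrier_matD[OF that]
      by (intro eq_matI) (auto simp: mult_smult_distrib[of _ N N _ N] mult_smult_assoc_mat[of _ N N _ N] algebra_simps)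
    from this[OF C] show ?thesis unfolding ad_def
      by (intro eq_matI) (auto simp: power2_eq_square)
  qed
  have c: "commutator (quant_coord N a) (commutator (quant_coord N a) A) \<in> carrier_mat N N" for a using A by simp
  show ?thesis unfolding hoppe_yau_def 1
    using c by (simp add: add_smult_distrib_left_mat[of _ N N])
qed

lemma hoppe_yau_carrier [simp]: "A \<in> carrier_mat N N \<Longrightarrow> hoppe_yau N A \<in> carrier_mat N N"
  by (simp add: hoppe_yau_ad)

lemma hoppe_yau_smult: "A \<in> carrier_mat N N \<Longrightarrow> hoppe_yau N (c \<cdot>\<^sub>m A) = c \<cdot>\<^sub>m hoppe_yau N A"
  by (simp add: hoppe_yau_ad ad_smult add_smult_distrib_left_mat[of _ N N])

definition jacobi_diff :: "nat \<Rightarrow> (nat \<Rightarrow> real) \<Rightarrow> nat \<Rightarrow> real" where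
  "jacobi_diff N d j = (real N - 1 - real j) * (real j + 1) * (d (Suc j) - d j) - (real N - real j) * real j * (d j - d (j - 1))"

lemma commutator_diag:
  assumes "A \<in> carrier_mat N N" "j < N" "k < N"
  shows "commutator A (mat_diag N d) $$ (j, k) = A $$ (j, k) * (d k - d j)"
  using assms carrier_matD[OF assms(1)]
  by (simp add: commutator_def diag_mult_index algebra_simps del: index_mult_mat(1))

text \<open>The double commutator with \<open>X\<^sub>3\<close> vanishes on diagonal matrices; the
  off-diagonal parts of the other two cancel, which leaves a second order difference operator.\<close>

lemma hoppe_yau_diag:
  assumes N: "N \<ge> 2"
  shows "hoppe_yau N (mat_diag N (\<lambda>j. of_real (d j))) = mat_diag N (\<lambda>j. of_real (jacobi_diff N d j))"
proof -
  let ?D = "mat_diag N (\<lambda>j. complex_of_real (d j))" and ?x = "coord_mat N"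
  define b where "b j = ladder N j * (d (Suc j) - d j)" for j
  define M1 where "M1 = commutator (?x 1) ?D"
  define M2 where "M2 = commutator (?x 2) ?D"
  have h: "hbar N \<noteq> 0" using hbar_pos[OF N] by simp
  have Mc: "M1 \<in> carrier_mat N N" "M2 \<in> carrier_mat N N" by (simp_all add: M1_def M2_def)
  have M1: "M1 = Matrix.mat N N (\<lambda>(j, k). if k = Suc j then of_real (b j) else if j = Suc k then - of_real (b k) else 0)"
    by (rule eq_matI) (auto simp: M1_def commutator_diag coord_index b_def algebra_simps carrier_matD[OF commutator_carrier[OF coord_mat_carrier mat_diag_dim]])
  have M2: "M2 = Matrix.mat N N (\<lambda>(j, k). if k = Suc j then - \<i> * of_real (b j) else if j = Suc k then - \<i> * of_real (b k) else 0)"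
    by (rule eq_matI) (auto simp: M2_def commutator_diag coord_index b_def algebra_simps carrier_matD[OF commutator_carrier[OF coord_mat_carrier mat_diag_dim]])
  have "commutator (?x 3) ?D = 0\<^sub>m N N"
    by (rule eq_matI) (auto simp: commutator_diag coord_index carrier_matD[OF commutator_carrier[OF coord_mat_carrier mat_diag_dim]])
  then have 3: "ad N 3 ?D = 0\<^sub>m N N"
    by (simp add: ad_eq; auto intro!: eq_matI)
  have ad0: "ad N a (0\<^sub>m N N) = 0\<^sub>m N N" for a
    by (simp add: ad_eq commutator_def; auto intro!: eq_matI)
  have adad: "ad N a (ad N a ?D) = of_real (- 1 / (hbar N)\<^sup>2) \<cdot>\<^sub>m commutator (?x a) (commutator (?x a) ?D)" for a
  proof -
    have C: "commutator (?x a) ?D \<in> carrier_mat N N" by simp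
    show ?thesis
      by (subst ad_eq[of ?D]) (auto simp: ad_smult[OF C] ad_eq[OF C] power2_eq_square intro!: eq_matI)
  qed
  show ?thesis
  proof (rule eq_matI)
    fix j k assume "j < dim_row (mat_diag N (\<lambda>j. complex_of_real (jacobi_diff N d j)))" "k < dim_col (mat_diag N (\<lambda>j. complex_of_real (jacobi_diff N d j)))"
    then have jk: "j < N" "k < N" by auto
    have e1: "commutator (?x 1) M1 $$ (j, k) = (?x 1 * M1) $$ (j, k) - (M1 * ?x 1) $$ (j, k)"
      "commutator (?x 2) M2 $$ (j, k) = (?x 2 * M2) $$ (j, k) - (M2 * ?x 2) $$ (j, k)"
      using jk carrier_matD[OF Mc(1)] carrier_matD[OF Mc(2)] by (simp_all add: commutator_def del: index_mult_mat(1))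
    have "commutator (?x 1) M1 $$ (j, k) + commutator (?x 2) M2 $$ (j, k)
      = (if j = k then of_real (- 4 * ((if Suc j < N then ladder N j * b j else 0) - (if 0 < j then ladder N (j - 1) * b (j - 1) else 0))) else 0)"
      unfolding e1 tridiagonal_mult_1[OF Mc(1) jk] tridiagonal_mult_2[OF Mc(2) jk] tridiagonal_mult[OF M1 coord_mat_carrier jk] tridiagonal_mult[OF M2 coord_mat_carrier jk]
      using jk unfolding M1 M2
      by (cases j) (auto simp: coord_index imaginary_unit_mult algebra_simps cong: if_cong)
    also have "- 4 * ((if Suc j < N then ladder N j * b j else 0) - (if 0 < j then ladder N (j - 1) * b (j - 1) else 0))
       = - ((4 * (if Suc j < N then (ladder N j)\<^sup>2 else 0)) * (d (Suc j) - d j) - (4 * (if 0 < j then (ladder N (j - 1))\<^sup>2 else 0)) * (d j - d (j - 1)))"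
      by (cases j) (auto simp: b_def power2_eq_square algebra_simps)
    also have "\<dots> = - (hbar N)\<^sup>2 * jacobi_diff N d j"
      unfolding ladder_sq_up[OF jk(1)] ladder_sq_down[OF jk(1)] by (simp add: jacobi_diff_def algebra_simps)
    finally have e: "commutator (?x 1) M1 $$ (j, k) + commutator (?x 2) M2 $$ (j, k) = (if j = k then of_real (- (hbar N)\<^sup>2 * jacobi_diff N d j) else 0)" .
    have "hoppe_yau N ?D $$ (j, k) = of_real (- 1 / (hbar N)\<^sup>2) * (commutator (?x 1) M1 $$ (j, k) + commutator (?x 2) M2 $$ (j, k))"
      unfolding hoppe_yau_ad[OF mat_diag_dim] 3 ad0 adad[of 1] adad[of 2] M1_def[symmetric] M2_def[symmetric]
      using jk Mc carrier_matD[of "commutator (?x 1) M1" N N] carrier_matD[of "commutator (?x 2) M2" N N]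
      by (simp add: distrib_left)
    then show "hoppe_yau N ?D $$ (j, k) = mat_diag N (\<lambda>j. complex_of_real (jacobi_diff N d j)) $$ (j, k)"
      unfolding e using jk h by (simp add: mat_diag_def)
  qed (auto simp: carrier_matD[OF hoppe_yau_carrier[OF mat_diag_dim]])
qed

lemma jacobi_diff_poly:
  "jacobi_diff N (\<lambda>j. poly q (weight N j)) j = poly (jacobi_op (((real N)\<^sup>2 - 1) / 4) q) (weight N j)"
proof (cases j)
  case 0
  have "weight N (Suc j) = weight N j + 1" by (simp add: weight_def)
  moreover have "((real N)\<^sup>2 - 1) / 4 - (weight N j)\<^sup>2 - weight N j = (real N - 1 - real j) * (real j + 1)"
    "((real N)\<^sup>2 - 1) / 4 - (weight N j)\<^sup>2 + weight N j = (real N - real j) * real j"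
    by (simp_all add: weight_def power2_eq_square field_simps)
  ultimately show ?thesis using 0 by (simp add: jacobi_diff_def poly_jacobi_op)
next
  case (Suc i)
  have "weight N (Suc j) = weight N j + 1" "weight N (j - 1) = weight N j - 1" using Suc by (simp_all add: weight_def)
  moreover have "((real N)\<^sup>2 - 1) / 4 - (weight N j)\<^sup>2 - weight N j = (real N - 1 - real j) * (real j + 1)"
    "((real N)\<^sup>2 - 1) / 4 - (weight N j)\<^sup>2 + weight N j = (real N - real j) * real j"
    by (simp_all add: weight_def power2_eq_square field_simps)
  ultimately show ?thesis by (simp only: jacobi_diff_def poly_jacobi_op)
qed

text \<open>The eigenvalue equation in row \<open>j + 1\<close> expresses the entry \<open>j\<close> by the
  two following ones, with a nonzero coefficient, so an eigenvector is determined by its last entry.\<close>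

lemma jacobi_diff_eigen_unique:
  assumes e: "\<And>j. j < N \<Longrightarrow> jacobi_diff N f j = a * f j" and z: "f (N - 1) = 0"
  shows "j < N \<Longrightarrow> f j = 0"
proof (induction "N - j" arbitrary: j rule: less_induct)
  case less
  show ?case
  proof (cases "j = N - 1")
    case False
    then have j: "Suc j < N" using less.prems by simp
    have f1: "f (Suc j) = 0" using less.hyps[of "Suc j"] j by simp
    have f2: "(real N - 1 - real (Suc j)) * f (Suc (Suc j)) = 0"
    proof (cases "Suc (Suc j) < N")
      case True
      then show ?thesis using less.hyps[of "Suc (Suc j)"] by simp
    next
      case False
      then have "N = Suc (Suc j)" using j by simp
      then show ?thesis by simp
    qed
    then have "(real N - 1 - real (Suc j)) * (real (Suc j) + 1) * f (Suc (Suc j)) = 0"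
      by (metis mult_eq_0_iff)
    then have "jacobi_diff N f (Suc j) = (real N - real (Suc j)) * real (Suc j) * f j"
      unfolding jacobi_diff_def f1 by simp
    then have "(real N - real (Suc j)) * real (Suc j) * f j = 0" using e[OF j] f1 by simp
    then show ?thesis using j by simp
  qed (use z in simp)
qed

primrec eigen_filter_mat :: "nat \<Rightarrow> nat \<Rightarrow> complex mat \<Rightarrow> complex mat" where
  "eigen_filter_mat N 0 A = A"
| "eigen_filter_mat N (Suc k) A = eigen_filter_mat N k (hoppe_yau N A + of_real (sphere_eigenvalue k) \<cdot>\<^sub>m A)"

text \<open>On the sphere this is the spherical Laplacian, written through rotations so that it corresponds to
  the Hoppe--Yau Laplacian term by term.\<close>

definition casimir :: "(real^3 \<Rightarrow> real) \<Rightarrow> real^3 \<Rightarrow> real" where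
  "casimir p x = rot_deriv 1 (rot_deriv 1 p) x + rot_deriv 2 (rot_deriv 2 p) x + rot_deriv 3 (rot_deriv 3 p) x"

primrec eigen_filter_fun :: "nat \<Rightarrow> (real^3 \<Rightarrow> real) \<Rightarrow> real^3 \<Rightarrow> real" where
  "eigen_filter_fun 0 p = p"
| "eigen_filter_fun (Suc k) p = eigen_filter_fun k (\<lambda>x. casimir p x + sphere_eigenvalue k * p x)"

lemma has_symbol_hoppe_yau:
  assumes "has_symbol A p" shows "has_symbol (\<lambda>N. hoppe_yau N (A N)) (casimir p)"
proof -
  have "has_symbol (\<lambda>N. ad N 1 (ad N 1 (A N)) + ad N 2 (ad N 2 (A N)) + ad N 3 (ad N 3 (A N))) (\<lambda>x. rot_deriv 1 (rot_deriv 1 p) x + rot_deriv 2 (rot_deriv 2 p) x + rot_deriv 3 (rot_deriv 3 p) x)"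
    by (intro has_symbol.add has_symbol_ad assms)
  moreover have "\<forall>\<^sub>F N in sequentially. ad N 1 (ad N 1 (A N)) + ad N 2 (ad N 2 (A N)) + ad N 3 (ad N 3 (A N)) = hoppe_yau N (A N)"
    using has_symbol_carrier[OF assms] by eventually_elim (simp add: hoppe_yau_ad)
  ultimately show ?thesis unfolding casimir_def[abs_def] by (rule has_symbol.eventually)
qed

lemma has_symbol_eigen_filter: "has_symbol A p \<Longrightarrow> has_symbol (\<lambda>N. eigen_filter_mat N k (A N)) (eigen_filter_fun k p)"
proof (induction k arbitrary: A p)
  case (Suc k)
  have "has_symbol (\<lambda>N. hoppe_yau N (A N) + of_real (sphere_eigenvalue k) \<cdot>\<^sub>m A N) (\<lambda>x. casimir p x + sphere_eigenvalue k * p x)"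
    by (intro has_symbol.add has_symbol_hoppe_yau has_symbol_cmult Suc.prems)
  from Suc.IH[OF this] show ?case by simp
qed simp

lemma eigen_filter_mat_diag:
  assumes N: "N \<ge> 2"
  shows "eigen_filter_mat N k (mat_diag N (\<lambda>j. of_real (poly q (weight N j))))
     = mat_diag N (\<lambda>j. of_real (poly (eigen_filter (jacobi_op (((real N)\<^sup>2 - 1) / 4)) k q) (weight N j)))"
proof (induction k arbitrary: q)
  case (Suc k)
  let ?J = "jacobi_op (((real N)\<^sup>2 - 1) / 4)"
  have "hoppe_yau N (mat_diag N (\<lambda>j. of_real (poly q (weight N j)))) + of_real (sphere_eigenvalue k) \<cdot>\<^sub>m mat_diag N (\<lambda>j. of_real (poly q (weight N j)))
    = mat_diag N (\<lambda>j. of_real (poly (?J q + Polynomial.smult (sphere_eigenvalue k) q) (weight N j)))"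
    unfolding hoppe_yau_diag[OF N] jacobi_diff_poly by (rule eq_matI) (auto simp: mat_diag_def)
  then show ?case by (simp only: eigen_filter_mat.simps eigen_filter.simps Suc.IH)
qed simp

lemma dir_deriv_poly_coord:
  "dir_deriv v (\<lambda>x. poly q (x $ 3)) x = poly (pderiv q) (x $ 3) * v $ 3"
proof (rule dir_deriv_eqI)
  have "((\<lambda>x. x $ 3) has_derivative (\<lambda>h. h $ 3)) (at x)"
    by (intro bounded_linear_imp_has_derivative bounded_linear_vec_nth)
  from has_derivative_compose[OF this, of "poly q" "\<lambda>h. poly (pderiv q) (x $ 3) * h"]
  show "((\<lambda>x. poly q (x $ 3)) has_derivative (\<lambda>v. poly (pderiv q) (x $ 3) * v $ 3)) (at x)"
    using poly_DERIV[of q "x $ 3"] by (simp add: has_field_derivative_def)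
qed

lemma rpoly_poly_coord: "rpoly (\<lambda>x. poly q (x $ 3))"
proof (induction q)
  case 0
  then show ?case using real_polynomial_function.intros(2)[of 0] by simp
next
  case (pCons a q)
  have "rpoly (\<lambda>x. a + x $ 3 * poly q (x $ 3))"
    by (intro real_polynomial_function.intros(2,3,4) rpoly_coord pCons)
  then show ?case by simp
qed

lemma casimir_zonal:
  assumes x: "x \<in> S2"
  shows "casimir (\<lambda>x. poly q (x $ 3)) x = poly (legendre_op q) (x $ 3)"
proof -
  let ?z = "\<lambda>q x. poly q (x $ 3) :: real"
  have l: "rot_deriv 1 (?z q) = (\<lambda>x. (- 1) * (x $ 2 * ?z (pderiv q) x))" "rot_deriv 2 (?z q) = (\<lambda>x. x $ 1 * ?z (pderiv q) x)" "rot_deriv 3 (?z q) = (\<lambda>x. 0)" for q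
    by (auto simp: fun_eq_iff rot_deriv_def dir_deriv_poly_coord cross3_nth axis_def)
  have r: "rpoly (\<lambda>x. x $ a * ?z q x)" for a q by (intro real_polynomial_function.intros(4) rpoly_coord rpoly_poly_coord)
  have xx: "x $ 1 * x $ 1 + x $ 2 * x $ 2 = 1 - x $ 3 * x $ 3"
    using x by (simp add: norm_eq_1 inner_vec_def sum_3)
  have "rot_deriv 1 (\<lambda>x. (- 1) * (x $ 2 * ?z (pderiv q) x)) x = - x $ 3 * ?z (pderiv q) x + x $ 2 * x $ 2 * ?z (pderiv (pderiv q)) x"
    unfolding rot_deriv_cmult[OF r] rot_deriv_mult[OF rpoly_coord rpoly_poly_coord] rot_deriv_coord l by (simp add: cross3_nth axis_def)
  moreover have "rot_deriv 2 (\<lambda>x. x $ 1 * ?z (pderiv q) x) x = - x $ 3 * ?z (pderiv q) x + x $ 1 * x $ 1 * ?z (pderiv (pderiv q)) x"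
    unfolding rot_deriv_mult[OF rpoly_coord rpoly_poly_coord] rot_deriv_coord l by (simp add: cross3_nth axis_def)
  moreover have "rot_deriv 3 (\<lambda>x. 0) x = 0" by (rule rot_deriv_const)
  ultimately have "casimir (?z q) x = (x $ 1 * x $ 1 + x $ 2 * x $ 2) * ?z (pderiv (pderiv q)) x - 2 * x $ 3 * ?z (pderiv q) x"
    unfolding casimir_def l by (simp add: algebra_simps)
  then show ?thesis unfolding xx poly_legendre_op by (simp add: power2_eq_square)
qed

lemma rpoly_casimir: "rpoly p \<Longrightarrow> rpoly (casimir p)"
  unfolding casimir_def[abs_def] by (intro real_polynomial_function.intros(3) rpoly_rot_deriv)

lemma casimir_cong_sphere:
  assumes "rpoly p" "rpoly q" "\<And>x. x \<in> S2 \<Longrightarrow> p x = q x" "x \<in> S2"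
  shows "casimir p x = casimir q x"
  unfolding casimir_def using assms
  by (intro arg_cong2[where f="(+)"] rot_deriv_cong_sphere[where p="rot_deriv _ p" and q="rot_deriv _ q"] rpoly_rot_deriv) (auto intro: rot_deriv_cong_sphere)

lemma eigen_filter_fun_zonal:
  assumes "rpoly p" "\<And>x. x \<in> S2 \<Longrightarrow> p x = poly q (x $ 3)"
  shows "x \<in> S2 \<Longrightarrow> eigen_filter_fun k p x = poly (eigen_filter legendre_op k q) (x $ 3)"
  using assms
proof (induction k arbitrary: p q)
  case (Suc k)
  have "eigen_filter_fun k (\<lambda>x. casimir p x + sphere_eigenvalue k * p x) x = poly (eigen_filter legendre_op k (legendre_op q + Polynomial.smult (sphere_eigenvalue k) q)) (x $ 3)"
  proof (rule Suc.IH[OF Suc.prems(1)])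
    show "rpoly (\<lambda>x. casimir p x + sphere_eigenvalue k * p x)"
      using Suc.prems by (intro real_polynomial_function.intros(3) rpoly_casimir rpoly_cmult)
    fix x assume x: "x \<in> S2"
    have "casimir p x = casimir (\<lambda>x. poly q (x $ 3)) x"
      by (rule casimir_cong_sphere[OF Suc.prems(2) rpoly_poly_coord Suc.prems(3) x])
    then show "casimir p x + sphere_eigenvalue k * p x = poly (legendre_op q + Polynomial.smult (sphere_eigenvalue k) q) (x $ 3)"
      using casimir_zonal[OF x, of q] Suc.prems(3)[OF x] by simp
  qed
  then show ?case by simp
qed simp

text \<open>The same filter is applied to the power of the third coordinate matrix as to the monomial
  \<open>x\<^sub>3\<^sup>l\<close>. So the symbol is a multiple of the Legendre function, while the
  matrix is an exact eigenvector for each \<open>N\<close>.\<close>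

definition zonal_mat :: "nat \<Rightarrow> nat \<Rightarrow> complex mat" where
  "zonal_mat l N = eigen_filter_mat N l (coord_mat N 3 ^\<^sub>m l)"

lemma mat_diag_pow: "mat_diag N d ^\<^sub>m k = mat_diag N (\<lambda>j. (d j :: complex) ^ k)"
  by (induction k) (simp_all add: mult.commute)

lemma zonal_mat_diag:
  assumes N: "N \<ge> 2"
  shows "\<exists>e. zonal_mat l N = mat_diag N (\<lambda>j. of_real (e j)) \<and> (\<forall>j. jacobi_diff N e j = - sphere_eigenvalue l * e j)"
proof -
  let ?J = "jacobi_op (((real N)\<^sup>2 - 1) / 4)"
  let ?q = "Polynomial.smult (hbar N ^ l) (monom 1 l)"
  define q where "q = eigen_filter ?J l ?q"
  have sm: "eigen_filter ?J k (Polynomial.smult a q) = Polynomial.smult a (eigen_filter ?J k q)" for k a q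
  proof (induction k arbitrary: q)
    case (Suc k)
    have "?J (Polynomial.smult a q) + Polynomial.smult (sphere_eigenvalue k) (Polynomial.smult a q) = Polynomial.smult a (?J q + Polynomial.smult (sphere_eigenvalue k) q)"
      using lowers_degree_jacobi[of "((real N)\<^sup>2 - 1) / 4"] by (simp add: lowers_degree_def smult_add_right mult.commute)
    then show ?case by (simp only: eigen_filter.simps Suc)
  qed simp
  have "coord_mat N 3 ^\<^sub>m l = mat_diag N (\<lambda>j. of_real (poly ?q (weight N j)))"
    unfolding coord_mat_3 mat_diag_pow by (simp add: poly_monom power_mult_distrib)
  then have "zonal_mat l N = mat_diag N (\<lambda>j. of_real (poly q (weight N j)))"
    unfolding zonal_mat_def q_def by (simp only: eigen_filter_mat_diag[OF N])
  moreover have "?J q = Polynomial.smult (- sphere_eigenvalue l) q"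
    using lowers_degree_jacobi[of "((real N)\<^sup>2 - 1) / 4"] eigen_filter_eigen[OF lowers_degree_jacobi, of "((real N)\<^sup>2 - 1) / 4" l]
    unfolding q_def sm by (simp add: lowers_degree_def mult.commute)
  then have "jacobi_diff N (\<lambda>j. poly q (weight N j)) j = - sphere_eigenvalue l * poly q (weight N j)" for j
    unfolding jacobi_diff_poly by simp
  ultimately show ?thesis by (intro exI[of _ "\<lambda>j. poly q (weight N j)"]) simp
qed

abbreviation zonal :: "nat \<Rightarrow> real^3 \<Rightarrow> real" where
  "zonal l \<equiv> \<lambda>x. poly (legendre_poly l) (x $ 3)"

lemma has_symbol_zonal_mat:
  shows "\<exists>\<kappa>. \<kappa> \<noteq> 0 \<and> has_symbol (zonal_mat l) (\<lambda>x. \<kappa> * zonal l x)"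
proof -
  obtain \<kappa> where k: "\<kappa> \<noteq> 0" "eigen_filter legendre_op l (monom 1 l) = Polynomial.smult \<kappa> (legendre_poly l)"
    using eigen_filter_legendre_eq by blast
  have "has_symbol (\<lambda>N. eigen_filter_mat N l (coord_mat N 3 ^\<^sub>m l)) (eigen_filter_fun l (\<lambda>x. x $ 3 ^ l))"
    by (intro has_symbol_eigen_filter has_symbol_pow has_symbol.coord)
  moreover have "rpoly (\<lambda>x. \<kappa> * zonal l x)" by (intro rpoly_cmult rpoly_poly_coord)
  moreover have "eigen_filter_fun l (\<lambda>x. x $ 3 ^ l) x = \<kappa> * zonal l x" if "x \<in> S2" for x
  proof -
    have "rpoly (\<lambda>x. x $ 3 ^ l)" by (intro real_polynomial_function_power rpoly_coord)
    from eigen_filter_fun_zonal[OF this, of "monom 1 l" x l] that show ?thesis by (simp add: poly_monom k)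
  qed
  ultimately have "has_symbol (\<lambda>N. eigen_filter_mat N l (coord_mat N 3 ^\<^sub>m l)) (\<lambda>x. \<kappa> * zonal l x)"
    by (rule has_symbol.sphere)
  then show ?thesis using k unfolding zonal_mat_def[abs_def] by blast
qed

section \<open>Generation of polynomials from zonal functions\<close>
lemma rot_deriv_1_2: "rot_deriv 1 (\<lambda>x. x $ 2) x = x $ 3" "rot_deriv 1 (\<lambda>x. x $ 3) x = - x $ 2" "rot_deriv 1 (\<lambda>x. x $ 1) x = 0"
  "rot_deriv 2 (\<lambda>x. x $ 2) x = 0" "rot_deriv 2 (\<lambda>x. x $ 3) x = x $ 1" "rot_deriv 2 (\<lambda>x. x $ 1) x = - x $ 3"
  by (simp_all add: rot_deriv_coord cross3_nth axis_def)

lemma rpoly_power: "rpoly p \<Longrightarrow> rpoly (\<lambda>x. p x ^ n)"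
  by (rule real_polynomial_function_power)

lemma rot_deriv_power: "rpoly p \<Longrightarrow> rot_deriv a (\<lambda>x. p x ^ n) x = real n * p x ^ (n - 1) * rot_deriv a p x"
proof (induction n)
  case 0
  then show ?case by (simp add: rot_deriv_const)
next
  case (Suc n)
  have "rot_deriv a (\<lambda>x. p x * p x ^ n) x = rot_deriv a p x * p x ^ n + p x * rot_deriv a (\<lambda>x. p x ^ n) x"
    by (rule rot_deriv_mult[OF Suc.prems rpoly_power[OF Suc.prems]])
  then show ?case using Suc by (cases n) (simp_all add: algebra_simps)
qed

text \<open>The order of the factors suits the product rule in the induction below: the first rotation leaves
  \<open>x\<^sub>1\<close> fixed and the second \<open>x\<^sub>2\<close>.\<close>

definition monomial3 :: "nat \<Rightarrow> nat \<Rightarrow> nat \<Rightarrow> real^3 \<Rightarrow> real" where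
  "monomial3 a b c x = x $ 1 ^ a * (x $ 2 ^ b * x $ 3 ^ c)"

lemma rpoly_monomial3: "rpoly (monomial3 a b c)"
  unfolding monomial3_def[abs_def] by (intro real_polynomial_function.intros(4) rpoly_power rpoly_coord)

lemma rot_deriv_monomial3:
  "rot_deriv 1 (monomial3 0 b (Suc c)) x = real b * monomial3 0 (b - 1) (c + 2) x - real (Suc c) * monomial3 0 (Suc b) c x"
  "rot_deriv 2 (monomial3 a b (Suc c)) x = real (Suc c) * monomial3 (Suc a) b c x - real a * monomial3 (a - 1) b (c + 2) x"
proof -
  note r = rpoly_power[OF rpoly_coord]
  have r23: "rpoly (\<lambda>x. x $ 2 ^ b * x $ 3 ^ Suc c)" by (intro real_polynomial_function.intros(4) r)
  show "rot_deriv 1 (monomial3 0 b (Suc c)) x = real b * monomial3 0 (b - 1) (c + 2) x - real (Suc c) * monomial3 0 (Suc b) c x"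
    unfolding monomial3_def[abs_def] power_0 mult_1
    unfolding rot_deriv_mult[OF r r] rot_deriv_power[OF rpoly_coord] rot_deriv_1_2
    by (simp add: algebra_simps)
  show "rot_deriv 2 (monomial3 a b (Suc c)) x = real (Suc c) * monomial3 (Suc a) b c x - real a * monomial3 (a - 1) b (c + 2) x"
    unfolding monomial3_def[abs_def] rot_deriv_mult[OF r r23] rot_deriv_mult[OF r r] rot_deriv_power[OF rpoly_coord] rot_deriv_1_2
    by (simp add: algebra_simps)
qed

text \<open>Polynomials in \<open>x\<^sub>3\<close> are combinations of Legendre functions. The rotation about
  the first axis turns one factor \<open>x\<^sub>3\<close> into \<open>x\<^sub>2\<close> and
  otherwise only produces monomials with fewer factors \<open>x\<^sub>2\<close>; this yields all
  monomials in \<open>x\<^sub>2\<close> and \<open>x\<^sub>3\<close>. The rotation about the second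
  axis then introduces \<open>x\<^sub>1\<close> in the same way.\<close>

lemma rpoly_zonal_induct:
  assumes zon: "\<And>l. P (zonal l)"
    and add: "\<And>p q. rpoly p \<Longrightarrow> rpoly q \<Longrightarrow> P p \<Longrightarrow> P q \<Longrightarrow> P (\<lambda>x. p x + q x)"
    and cm: "\<And>c p. rpoly p \<Longrightarrow> P p \<Longrightarrow> P (\<lambda>x. c * p x)"
    and rot: "\<And>a p. rpoly p \<Longrightarrow> P p \<Longrightarrow> P (rot_deriv a p)"
    and p: "rpoly p"
  shows "P p"
proof -
  have zq: "P (\<lambda>x. poly q (x $ 3))" if "degree_below n q" for n q
    using that
  proof (induction n arbitrary: q)
    case 0
    then have "q = 0" by (simp add: degree_below_0)
    then show ?case using cm[OF rpoly_poly_coord zon, of 0 0] by simp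
  next
    case (Suc n)
    define c where "c = poly.coeff q n / poly.coeff (legendre_poly n) n"
    have "degree_below n (q - Polynomial.smult c (legendre_poly n))"
      unfolding degree_below_def
    proof (intro allI impI)
      fix i assume "n \<le> i"
      then show "poly.coeff (q - Polynomial.smult c (legendre_poly n)) i = 0"
        using Suc.prems legendre_poly_degree_below[of n] legendre_poly_lead[of n]
        by (cases "i = n") (auto simp: degree_below_def c_def)
    qed
    from add[OF rpoly_poly_coord rpoly_cmult[OF rpoly_poly_coord] Suc.IH[OF this] cm[OF rpoly_poly_coord zon[of n], of c]]
    show ?case by simp
  qed
  have step: "P (monomial3 a b c)" if "\<And>x. monomial3 a b c x = u * rot_deriv i f x + v * g x" "rpoly f" "P f" "rpoly g" "P g" for a b c u v i f g
  proof -
    have "P (\<lambda>x. u * rot_deriv i f x + v * g x)"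
      by (intro add cm rot rpoly_cmult rpoly_rot_deriv that)
    moreover have "monomial3 a b c = (\<lambda>x. u * rot_deriv i f x + v * g x)" using that(1) by auto
    ultimately show ?thesis by simp
  qed
  have m0: "P (monomial3 0 b c)" for b c
  proof (induction b arbitrary: c rule: less_induct)
    case (less b)
    show ?case
    proof (cases b)
      case 0
      have "degree_below (Suc c) (monom 1 c)" by (auto simp: degree_below_def)
      from zq[OF this] have "P (\<lambda>x. x $ 3 ^ c)" by (simp add: poly_monom)
      moreover have "monomial3 0 b c = (\<lambda>x. x $ 3 ^ c)" using 0 by (auto simp: monomial3_def)
      ultimately show ?thesis by simp
    next
      case (Suc b')
      have "monomial3 0 b c x = (- 1 / real (Suc c)) * rot_deriv 1 (monomial3 0 b' (Suc c)) x + (real b' / real (Suc c)) * monomial3 0 (b' - 1) (c + 2) x" for x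
      proof -
        have "real (Suc c) * monomial3 0 (Suc b') c x = real b' * monomial3 0 (b' - 1) (c + 2) x - rot_deriv 1 (monomial3 0 b' (Suc c)) x"
          unfolding rot_deriv_monomial3(1) by simp
        then show ?thesis unfolding Suc by (simp add: field_simps del: of_nat_Suc)
      qed
      then show ?thesis by (rule step) (use Suc in \<open>auto intro: rpoly_monomial3 less.IH\<close>)
    qed
  qed
  have m: "P (monomial3 a b c)" for a b c
  proof (induction a arbitrary: c rule: less_induct)
    case (less a)
    show ?case
    proof (cases a)
      case 0
      then show ?thesis using m0 by simp
    next
      case (Suc a')
      have "monomial3 a b c x = (1 / real (Suc c)) * rot_deriv 2 (monomial3 a' b (Suc c)) x + (real a' / real (Suc c)) * monomial3 (a' - 1) b (c + 2) x" for x
      proof -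
        have "real (Suc c) * monomial3 (Suc a') b c x = rot_deriv 2 (monomial3 a' b (Suc c)) x + real a' * monomial3 (a' - 1) b (c + 2) x"
          unfolding rot_deriv_monomial3(2) by simp
        then show ?thesis unfolding Suc by (simp add: field_simps del: of_nat_Suc)
      qed
      then show ?thesis by (rule step) (use Suc in \<open>auto intro: rpoly_monomial3 less.IH\<close>)
    qed
  qed
  \<comment> \<open>testing against all monomials makes the set of functions closed under
    multiplication by coordinates\<close>
  define K where "K = {q. rpoly q \<and> (\<forall>a b c. P (\<lambda>x. q x * monomial3 a b c x))}"
  have Kadd: "(\<lambda>x. f x + g x) \<in> K" if "f \<in> K" "g \<in> K" for f g
  proof -
    have r: "rpoly f" "rpoly g" using that by (auto simp: K_def)
    have "P (\<lambda>x. f x * monomial3 a b c x + g x * monomial3 a b c x)" for a b c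
      using that r by (intro add real_polynomial_function.intros(4) rpoly_monomial3) (auto simp: K_def)
    then show ?thesis using r by (auto simp: K_def distrib_right intro: real_polynomial_function.intros(3))
  qed
  have Kcm: "(\<lambda>x. u * f x) \<in> K" if "f \<in> K" for f u
  proof -
    have r: "rpoly f" using that by (auto simp: K_def)
    have "P (\<lambda>x. u * (f x * monomial3 a b c x))" for a b c
      using that r by (intro cm real_polynomial_function.intros(4) rpoly_monomial3) (auto simp: K_def)
    then show ?thesis using r by (auto simp: K_def mult.assoc intro: rpoly_cmult)
  qed
  have Kx: "(\<lambda>x. x $ i * f x) \<in> K" if "f \<in> K" for f i
  proof -
    have r: "rpoly f" using that by (auto simp: K_def)
    have e: "x $ 1 * monomial3 a b c x = monomial3 (Suc a) b c x" "x $ 2 * monomial3 a b c x = monomial3 a (Suc b) c x" "x $ 3 * monomial3 a b c x = monomial3 a b (Suc c) x" for a b c x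
      by (simp_all add: monomial3_def mult_ac)
    have ex: "\<exists>a' b' c'. \<forall>x. x $ i * monomial3 a b c x = monomial3 a' b' c' x" for a b c
      using exhaust_3[of i]
    proof (elim disjE)
      assume "i = 1" then show ?thesis using e(1) by blast
    next
      assume "i = 2" then show ?thesis using e(2) by blast
    next
      assume "i = 3" then show ?thesis using e(3) by blast
    qed
    have "P (\<lambda>x. x $ i * f x * monomial3 a b c x)" for a b c
    proof -
      obtain a' b' c' where "\<And>x. x $ i * monomial3 a b c x = monomial3 a' b' c' x" using ex by blast
      then have "(\<lambda>x. x $ i * f x * monomial3 a b c x) = (\<lambda>x. f x * monomial3 a' b' c' x)"
        by (simp only: mult.assoc mult.left_commute[of _ "f _"])
      then show ?thesis using that by (simp add: K_def)
    qed
    then show ?thesis using r by (auto simp: K_def intro: real_polynomial_function.intros(4) rpoly_coord)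
  qed
  have "(\<lambda>x. p x * q x) \<in> K" if "q \<in> K" for q
    using p that
  proof (induction p arbitrary: q rule: real_polynomial_function.induct)
    case (linear f)
    have l: "linear f" using linear.hyps bounded_linear.linear by blast
    have "f x = f (axis 1 1) * x $ 1 + f (axis 2 1) * x $ 2 + f (axis 3 1) * x $ 3" for x
      by (subst sum_3_axis[of x]) (simp add: linear_add[OF l] linear_scale[OF l] mult.commute)
    then have "f x * q x = (f (axis 1 1) * x $ 1 + f (axis 2 1) * x $ 2 + f (axis 3 1) * x $ 3) * q x" for x
      by (rule arg_cong)
    then have e: "(\<lambda>x. f x * q x) = (\<lambda>x. (f (axis 1 1) * (x $ 1 * q x) + f (axis 2 1) * (x $ 2 * q x)) + f (axis 3 1) * (x $ 3 * q x))"
      by (simp only: distrib_right mult.assoc)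
    show ?case unfolding e by (intro Kadd Kcm Kx linear.prems)
  next
    case (const c)
    then show ?case by (intro Kcm)
  next
    case (add f g)
    then show ?case using Kadd by (simp add: distrib_right)
  next
    case (mult f g)
    then show ?case by (simp add: mult.assoc)
  qed
  moreover have "(\<lambda>x. 1) \<in> K" using m real_polynomial_function.intros(2)[of 1] by (auto simp: K_def)
  ultimately have "(\<lambda>x. p x * 1) \<in> K" by blast
  then have "P (\<lambda>x. p x * 1 * monomial3 0 0 0 x)" by (auto simp: K_def)
  then show ?thesis by (simp add: monomial3_def)
qed

section \<open>Solid harmonics\<close>

text \<open>The sum of the second partial derivatives as total derivatives, for which the calculus of
  polynomials is available; on polynomials it agrees with \<open>laplacian\<close>.\<close>

definition poly_laplacian :: "(real^3 \<Rightarrow> real) \<Rightarrow> real^3 \<Rightarrow> real" where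
  "poly_laplacian p x = (\<Sum>i\<in>UNIV. dir_deriv (axis i 1) (dir_deriv (axis i 1) p) x)"

lemma deriv_along_line:
  assumes "rpoly p" shows "deriv (\<lambda>t. p (x + t *\<^sub>R v)) t = dir_deriv v p (x + t *\<^sub>R v)"
proof (rule DERIV_imp_deriv)
  have l: "linear (\<lambda>u. dir_deriv u p y)" for y using rpoly_has_derivative[OF assms] has_derivative_linear by blast
  have "((\<lambda>t. x + t *\<^sub>R v) has_derivative (\<lambda>h. h *\<^sub>R v)) (at t)" by (auto intro!: derivative_eq_intros)
  from has_derivative_compose[OF this rpoly_has_derivative[OF assms]]
  show "((\<lambda>t. p (x + t *\<^sub>R v)) has_real_derivative dir_deriv v p (x + t *\<^sub>R v)) (at t)"
    unfolding has_field_derivative_def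
    by (rule has_derivative_eq_rhs) (simp add: linear_scale[OF l] fun_eq_iff)
qed

lemma laplacian_rpoly: "rpoly p \<Longrightarrow> laplacian p x = poly_laplacian p x"
proof -
  assume p: "rpoly p"
  have "deriv (\<lambda>t. p (x + t *\<^sub>R v)) = (\<lambda>t. dir_deriv v p (x + t *\<^sub>R v))" for v
    using deriv_along_line[OF p] by auto
  then have "(deriv ^^ 2) (\<lambda>t. p (x + t *\<^sub>R v)) 0 = dir_deriv v (dir_deriv v p) x" for v
    using deriv_along_line[OF rpoly_dir_deriv[OF p], where x=x and v=v and t=0] by (simp add: numeral_2_eq_2)
  then show ?thesis by (simp add: laplacian_def poly_laplacian_def)
qed

lemma dir_deriv_commute: "rpoly p \<Longrightarrow> dir_deriv u (dir_deriv v p) x = dir_deriv v (dir_deriv u p) x"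
proof (induction p rule: real_polynomial_function.induct)
  case (linear f)
  then have "dir_deriv w f = (\<lambda>x. f w)" for w by (auto simp: dir_deriv_linear)
  then show ?case by (simp add: dir_deriv_const)
next
  case (const c)
  have "dir_deriv w (\<lambda>x. c) = (\<lambda>x. 0)" for w by (auto simp: dir_deriv_const)
  then show ?case by (simp add: dir_deriv_const)
next
  case (add f g)
  then have "dir_deriv w (\<lambda>x. f x + g x) = (\<lambda>x. dir_deriv w f x + dir_deriv w g x)" for w by (auto simp: dir_deriv_add)
  then show ?case using add by (simp add: dir_deriv_add rpoly_dir_deriv)
next
  case (mult f g)
  then have "dir_deriv w (\<lambda>x. f x * g x) = (\<lambda>x. dir_deriv w f x * g x + f x * dir_deriv w g x)" for w by (auto simp: dir_deriv_mult)
  then show ?case using mult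
    by (simp add: dir_deriv_add dir_deriv_mult rpoly_dir_deriv real_polynomial_function.intros(4) algebra_simps)
qed

lemma poly_laplacian_add: "rpoly p \<Longrightarrow> rpoly q \<Longrightarrow> poly_laplacian (\<lambda>x. p x + q x) x = poly_laplacian p x + poly_laplacian q x"
proof -
  assume r: "rpoly p" "rpoly q"
  then have "dir_deriv w (\<lambda>x. p x + q x) = (\<lambda>x. dir_deriv w p x + dir_deriv w q x)" for w by (auto simp: dir_deriv_add)
  then show ?thesis using r by (simp add: poly_laplacian_def dir_deriv_add rpoly_dir_deriv sum.distrib)
qed

lemma poly_laplacian_cmult: "rpoly p \<Longrightarrow> poly_laplacian (\<lambda>x. c * p x) x = c * poly_laplacian p x"
proof -
  assume r: "rpoly p"
  then have "dir_deriv w (\<lambda>x. c * p x) = (\<lambda>x. c * dir_deriv w p x)" for w by (auto simp: dir_deriv_cmult)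
  then show ?thesis using r by (simp add: poly_laplacian_def dir_deriv_cmult rpoly_dir_deriv sum_distrib_left)
qed

lemma poly_laplacian_mult:
  assumes "rpoly p" "rpoly q"
  shows "poly_laplacian (\<lambda>x. p x * q x) x = poly_laplacian p x * q x + 2 * (\<Sum>i\<in>UNIV. dir_deriv (axis i 1) p x * dir_deriv (axis i 1) q x) + p x * poly_laplacian q x"
proof -
  have "dir_deriv w (\<lambda>x. p x * q x) = (\<lambda>x. dir_deriv w p x * q x + p x * dir_deriv w q x)" for w using assms by (auto simp: dir_deriv_mult)
  then have "dir_deriv w (dir_deriv w (\<lambda>x. p x * q x)) x = dir_deriv w (dir_deriv w p) x * q x + 2 * (dir_deriv w p x * dir_deriv w q x) + p x * dir_deriv w (dir_deriv w q) x" for w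
    using assms by (simp add: dir_deriv_add dir_deriv_mult rpoly_dir_deriv real_polynomial_function.intros(4) algebra_simps)
  then show ?thesis by (simp add: poly_laplacian_def sum.distrib sum_distrib_left sum_distrib_right)
qed

lemma poly_laplacian_coord: "poly_laplacian (\<lambda>x. x $ a) x = 0"
proof -
  have "dir_deriv w (\<lambda>x. x $ a) = (\<lambda>x. w $ a)" for w by (auto simp: dir_deriv_coord)
  then show ?thesis by (simp add: poly_laplacian_def dir_deriv_const)
qed

lemma poly_laplacian_coord_mult:
  assumes "rpoly q"
  shows "poly_laplacian (\<lambda>x. x $ a * q x) x = x $ a * poly_laplacian q x + 2 * dir_deriv (axis a 1) q x"
proof -
  have "(\<Sum>i\<in>UNIV. dir_deriv (axis i 1) (\<lambda>x. x $ a) x * dir_deriv (axis i 1) q x) = (\<Sum>i\<in>UNIV. if i = a then dir_deriv (axis a 1) q x else 0)"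
    by (intro sum.cong) (auto simp: dir_deriv_coord axis_def)
  then show ?thesis using poly_laplacian_mult[OF rpoly_coord assms, of a x] by (simp add: poly_laplacian_coord)
qed

lemma poly_laplacian_dir_deriv: "rpoly p \<Longrightarrow> poly_laplacian (dir_deriv v p) x = dir_deriv v (poly_laplacian p) x"
proof -
  assume p: "rpoly p"
  have c: "dir_deriv (axis i 1) (dir_deriv v p) = dir_deriv v (dir_deriv (axis i 1) p)" for i
    using dir_deriv_commute[OF p] by auto
  have "dir_deriv v (poly_laplacian p) x = (\<Sum>i\<in>UNIV. dir_deriv v (dir_deriv (axis i 1) (dir_deriv (axis i 1) p)) x)"
    unfolding poly_laplacian_def[abs_def] sum_3 using p
    by (simp add: dir_deriv_add rpoly_dir_deriv real_polynomial_function.intros(3))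
  also have "\<dots> = poly_laplacian (dir_deriv v p) x"
    unfolding poly_laplacian_def c using dir_deriv_commute[OF rpoly_dir_deriv[OF p]] by auto
  finally show ?thesis by simp
qed

definition solid_harmonic :: "nat \<Rightarrow> (real^3 \<Rightarrow> real) \<Rightarrow> bool" where
  "solid_harmonic l p \<longleftrightarrow> rpoly p \<and> (\<forall>c x. p (c *\<^sub>R x) = c ^ l * p x) \<and> (\<forall>x. poly_laplacian p x = 0)"

lemma spherical_harmonics_iff: "Y \<in> spherical_harmonics l \<longleftrightarrow> (\<exists>p. solid_harmonic l p \<and> (\<forall>x\<in>S2. Y x = p x))"
  unfolding spherical_harmonics_def solid_harmonic_def using laplacian_rpoly by auto

lemma solid_harmonic_add: "solid_harmonic l p \<Longrightarrow> solid_harmonic l q \<Longrightarrow> solid_harmonic l (\<lambda>x. p x + q x)"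
  by (auto simp: solid_harmonic_def poly_laplacian_add algebra_simps intro: real_polynomial_function.intros(3))

lemma solid_harmonic_cmult: "solid_harmonic l p \<Longrightarrow> solid_harmonic l (\<lambda>x. c * p x)"
  by (auto simp: solid_harmonic_def poly_laplacian_cmult intro: rpoly_cmult)

lemma solid_harmonic_zero: "solid_harmonic l (\<lambda>x. 0)"
proof -
  have "dir_deriv v (\<lambda>x. 0) = (\<lambda>x. 0)" for v by (auto simp: dir_deriv_const)
  then show ?thesis by (auto simp: solid_harmonic_def poly_laplacian_def dir_deriv_const)
qed

text \<open>Rotations commute with the Laplacian and with dilations.\<close>

lemma solid_harmonic_rot_deriv:
  assumes h: "solid_harmonic l p" shows "solid_harmonic l (rot_deriv a p)"
  unfolding solid_harmonic_def
proof (intro conjI allI)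
  have p: "rpoly p" and hom: "\<And>c x. p (c *\<^sub>R x) = c ^ l * p x" and lp: "poly_laplacian p = (\<lambda>x. 0)"
    using h by (auto simp: solid_harmonic_def)
  show "rpoly (rot_deriv a p)" using p by (rule rpoly_rot_deriv)
  fix c x
  have "dir_deriv (c *\<^sub>R v) p (c *\<^sub>R x) = c ^ l * dir_deriv v p x" for v
  proof -
    have "((\<lambda>x. c *\<^sub>R x) has_derivative (\<lambda>h. c *\<^sub>R h)) (at x)" by (auto intro!: derivative_eq_intros)
    from has_derivative_compose[OF this rpoly_has_derivative[OF p]]
    have "((\<lambda>x. c ^ l * p x) has_derivative (\<lambda>h. dir_deriv (c *\<^sub>R h) p (c *\<^sub>R x))) (at x)" by (simp add: hom)
    from dir_deriv_eqI[OF this, of v] show ?thesis using dir_deriv_cmult[OF p] by simp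
  qed
  from this[of "cross3 x (axis a 1)"] show "rot_deriv a p (c *\<^sub>R x) = c ^ l * rot_deriv a p x"
    by (simp add: rot_deriv_def cross_mult_left)
next
  fix x
  have p: "rpoly p" and lp: "poly_laplacian p = (\<lambda>x. 0)"
    using h by (auto simp: solid_harmonic_def)
  have z: "poly_laplacian (dir_deriv v p) x = 0" for v using poly_laplacian_dir_deriv[OF p] by (simp add: lp dir_deriv_const)
  have "poly_laplacian (\<lambda>x. x $ i * dir_deriv (axis j 1) p x - x $ j * dir_deriv (axis i 1) p x) x = 0" for i j
  proof -
    have r: "rpoly (\<lambda>x. x $ i * dir_deriv (axis j 1) p x)" for i j by (intro real_polynomial_function.intros(4) rpoly_coord rpoly_dir_deriv p)
    have e: "(\<lambda>x. x $ i * dir_deriv (axis j 1) p x - x $ j * dir_deriv (axis i 1) p x) = (\<lambda>x. x $ i * dir_deriv (axis j 1) p x + (-1) * (x $ j * dir_deriv (axis i 1) p x))"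
      by auto
    show ?thesis
      unfolding e poly_laplacian_add[OF r rpoly_cmult[OF r]] poly_laplacian_cmult[OF r] poly_laplacian_coord_mult[OF rpoly_dir_deriv[OF p]] z
      using dir_deriv_commute[OF p, of "axis i 1" "axis j 1" x] by simp
  qed
  note L = this
  have e: "rot_deriv 1 p = (\<lambda>x. x $ 3 * dir_deriv (axis 2 1) p x - x $ 2 * dir_deriv (axis 3 1) p x)"
    "rot_deriv 2 p = (\<lambda>x. x $ 1 * dir_deriv (axis 3 1) p x - x $ 3 * dir_deriv (axis 1 1) p x)"
    "rot_deriv 3 p = (\<lambda>x. x $ 2 * dir_deriv (axis 1 1) p x - x $ 1 * dir_deriv (axis 2 1) p x)"
    by (auto simp: fun_eq_iff rot_deriv_expand[OF p])
  show "poly_laplacian (rot_deriv a p) x = 0" using exhaust_3[of a] by (elim disjE) (simp_all only: e L)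
qed

definition norm_square :: "real^3 \<Rightarrow> real" where "norm_square x = inner x x"

lemma norm_square_eq: "norm_square = (\<lambda>x. x $ 1 * x $ 1 + x $ 2 * x $ 2 + x $ 3 * x $ 3)"
  by (simp add: fun_eq_iff norm_square_def inner_vec_def sum_3)

lemma rpoly_norm_square: "rpoly norm_square"
  unfolding norm_square_eq by (intro real_polynomial_function.intros(3,4) rpoly_coord)

lemma dir_deriv_norm_square: "dir_deriv (axis i 1) norm_square x = 2 * x $ i"
proof -
  have "(norm_square has_derivative (\<lambda>h. 2 * inner x h)) (at x)"
    unfolding norm_square_def[abs_def] by (auto intro!: derivative_eq_intros simp: inner_commute)
  then have "dir_deriv (axis i 1) norm_square x = 2 * inner x (axis i 1)" by (rule dir_deriv_eqI)
  then show ?thesis by (simp add: inner_axis)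
qed

lemma dir_deriv_power: "rpoly p \<Longrightarrow> dir_deriv v (\<lambda>x. p x ^ n) x = real n * p x ^ (n - 1) * dir_deriv v p x"
proof (induction n)
  case 0
  then show ?case by (simp add: dir_deriv_const)
next
  case (Suc n)
  have "dir_deriv v (\<lambda>x. p x * p x ^ n) x = dir_deriv v p x * p x ^ n + p x * dir_deriv v (\<lambda>x. p x ^ n) x"
    by (rule dir_deriv_mult[OF Suc.prems rpoly_power[OF Suc.prems]])
  then show ?case using Suc by (cases n) (simp_all add: algebra_simps)
qed

lemma poly_laplacian_power: "rpoly p \<Longrightarrow> poly_laplacian (\<lambda>x. p x ^ n) x = real n * p x ^ (n - 1) * poly_laplacian p x
    + real n * (real n - 1) * p x ^ (n - 2) * (\<Sum>i\<in>UNIV. (dir_deriv (axis i 1) p x)\<^sup>2)"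
proof -
  assume p: "rpoly p"
  have "dir_deriv w (\<lambda>x. p x ^ n) = (\<lambda>x. real n * (p x ^ (n - 1) * dir_deriv w p x))" for w
    by (auto simp: dir_deriv_power[OF p])
  then have "dir_deriv w (dir_deriv w (\<lambda>x. p x ^ n)) x = real n * (real (n - 1) * p x ^ (n - 2) * dir_deriv w p x * dir_deriv w p x + p x ^ (n - 1) * dir_deriv w (dir_deriv w p) x)" for w
    using p by (simp add: dir_deriv_cmult dir_deriv_mult dir_deriv_power rpoly_power rpoly_dir_deriv real_polynomial_function.intros(4) numeral_2_eq_2)
  moreover have "real n * real (n - 1) = real n * (real n - 1)" by (cases n) auto
  ultimately have "dir_deriv w (dir_deriv w (\<lambda>x. p x ^ n)) x = real n * p x ^ (n - 1) * dir_deriv w (dir_deriv w p) x + real n * (real n - 1) * p x ^ (n - 2) * (dir_deriv w p x)\<^sup>2" for w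
    by (simp add: distrib_left power2_eq_square mult.assoc[symmetric])
  then show ?thesis by (simp add: poly_laplacian_def sum.distrib sum_distrib_left)
qed

lemma poly_laplacian_norm_square: "poly_laplacian norm_square x = 6"
proof -
  have "dir_deriv (axis i 1) norm_square = (\<lambda>x. 2 * x $ i)" for i by (auto simp: dir_deriv_norm_square)
  then show ?thesis by (simp add: poly_laplacian_def dir_deriv_cmult rpoly_coord dir_deriv_coord)
qed

lemma poly_laplacian_monomial:
  "poly_laplacian (\<lambda>x. x $ 3 ^ m * norm_square x ^ j) x =
     real m * (real m - 1) * x $ 3 ^ (m - 2) * norm_square x ^ j + (4 * real m * real j + 2 * real j * (2 * real j + 1)) * x $ 3 ^ m * norm_square x ^ (j - 1)"
proof -
  have g1: "(\<Sum>i\<in>UNIV. (dir_deriv (axis i 1) (\<lambda>x. x $ 3) x)\<^sup>2) = 1"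
    by (simp add: dir_deriv_coord sum_3 axis_def)
  have g2: "(\<Sum>i\<in>UNIV. (dir_deriv (axis i 1) norm_square x)\<^sup>2) = 4 * norm_square x"
    unfolding dir_deriv_norm_square sum_3 by (simp add: norm_square_def inner_vec_def sum_3 power2_eq_square)
  have g3: "(\<Sum>i\<in>UNIV. dir_deriv (axis i 1) (\<lambda>x. x $ 3 ^ m) x * dir_deriv (axis i 1) (\<lambda>x. norm_square x ^ j) x) = real m * x $ 3 ^ (m - 1) * (real j * norm_square x ^ (j - 1) * (2 * x $ 3))"
    by (simp add: dir_deriv_power rpoly_coord rpoly_norm_square dir_deriv_coord dir_deriv_norm_square sum_3) (simp add: axis_def)
  have a: "real m * x $ 3 ^ (m - 1) * x $ 3 = real m * x $ 3 ^ m" by (cases m) auto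
  have b: "real j * (real j - 1) * norm_square x ^ (j - 2) * norm_square x = real j * (real j - 1) * norm_square x ^ (j - 1)"
    by (cases j; cases "j - 1") auto
  have "poly_laplacian (\<lambda>x. x $ 3 ^ m * norm_square x ^ j) x = real m * (real m - 1) * x $ 3 ^ (m - 2) * norm_square x ^ j
    + 4 * (real m * x $ 3 ^ (m - 1) * x $ 3) * (real j * norm_square x ^ (j - 1))
    + x $ 3 ^ m * (6 * real j * norm_square x ^ (j - 1) + 4 * (real j * (real j - 1) * norm_square x ^ (j - 2) * norm_square x))"
    unfolding poly_laplacian_mult[OF rpoly_power[OF rpoly_coord] rpoly_power[OF rpoly_norm_square]] poly_laplacian_power[OF rpoly_coord] poly_laplacian_power[OF rpoly_norm_square] poly_laplacian_coord poly_laplacian_norm_square g1 g2 g3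
    by (simp add: algebra_simps)
  then show ?thesis unfolding a b by (simp add: algebra_simps)
qed

text \<open>The homogeneous extension of the Legendre function of \<open>x\<^sub>3\<close>: the missing degree
  of each term is filled up by powers of \<open>|x|\<^sup>2\<close>. As only exponents of the parity
  of \<open>l\<close> occur, the halved exponents are exact.\<close>

definition solid_zonal :: "nat \<Rightarrow> real^3 \<Rightarrow> real" where
  "solid_zonal l x = (\<Sum>m\<le>l. poly.coeff (legendre_poly l) m * (x $ 3 ^ m * norm_square x ^ ((l - m) div 2)))"

text \<open>The Laplacian of the term of index \<open>m\<close> contributes to the monomials of index \<open>m
  - 2\<close> and \<open>m\<close> in \<open>x\<^sub>3\<close>; collecting terms, the coefficients
  cancel by the recurrence that expresses Legendre's equation.\<close>

lemma solid_harmonic_zonal: "solid_harmonic l (solid_zonal l)"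
  unfolding solid_harmonic_def
proof (intro conjI allI)
  let ?a = "poly.coeff (legendre_poly l)"
  let ?j = "\<lambda>m. (l - m) div 2"
  have r: "rpoly (\<lambda>x. x $ 3 ^ m * norm_square x ^ j)" for m j
    by (intro real_polynomial_function.intros(4) rpoly_power rpoly_coord rpoly_norm_square)
  have rs: "rpoly (\<lambda>x. \<Sum>m\<in>M. ?a m * (x $ 3 ^ m * norm_square x ^ ?j m))" if "finite M" for M
    using that by (intro real_polynomial_function_sum rpoly_cmult r)
  show "rpoly (solid_zonal l)" unfolding solid_zonal_def[abs_def] by (rule rs) simp
  fix c and x :: "real^3"
  show "solid_zonal l (c *\<^sub>R x) = c ^ l * solid_zonal l x"
    unfolding solid_zonal_def sum_distrib_left
  proof (intro sum.cong refl)
    fix m assume "m \<in> {..l}"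
    show "?a m * ((c *\<^sub>R x) $ 3 ^ m * norm_square (c *\<^sub>R x) ^ ?j m) = c ^ l * (?a m * (x $ 3 ^ m * norm_square x ^ ?j m))"
    proof (cases "even (l + m)")
      case True
      then have e: "m + 2 * ?j m = l" using \<open>m \<in> {..l}\<close> by auto
      have "(c *\<^sub>R x) $ 3 ^ m * norm_square (c *\<^sub>R x) ^ ?j m = c ^ (m + 2 * ?j m) * (x $ 3 ^ m * norm_square x ^ ?j m)"
        by (simp add: norm_square_def power_mult_distrib power_add power_mult power2_eq_square mult_ac)
      then show ?thesis unfolding e by simp
    qed (simp add: legendre_poly_parity)
  qed
  have "poly_laplacian (solid_zonal l) x = (\<Sum>m\<le>l. ?a m * poly_laplacian (\<lambda>x. x $ 3 ^ m * norm_square x ^ ?j m) x)"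
  proof -
    have "poly_laplacian (\<lambda>x. \<Sum>m\<in>M. ?a m * (x $ 3 ^ m * norm_square x ^ ?j m)) x = (\<Sum>m\<in>M. ?a m * poly_laplacian (\<lambda>x. x $ 3 ^ m * norm_square x ^ ?j m) x)" if "finite M" for M
      using that
    proof (induction M rule: finite_induct)
      case empty
      then show ?case using solid_harmonic_zero[of 0] by (simp add: solid_harmonic_def)
    next
      case (insert m M)
      have "poly_laplacian (\<lambda>x. ?a m * (x $ 3 ^ m * norm_square x ^ ?j m) + (\<Sum>m\<in>M. ?a m * (x $ 3 ^ m * norm_square x ^ ?j m))) x
        = poly_laplacian (\<lambda>x. ?a m * (x $ 3 ^ m * norm_square x ^ ?j m)) x + poly_laplacian (\<lambda>x. \<Sum>m\<in>M. ?a m * (x $ 3 ^ m * norm_square x ^ ?j m)) x"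
        by (rule poly_laplacian_add[OF rpoly_cmult[OF r] rs[OF insert.hyps(1)]])
      then show ?case using insert by (simp add: poly_laplacian_cmult[OF r])
    qed
    then show ?thesis unfolding solid_zonal_def[abs_def] by simp
  qed
  also have "\<dots> = (\<Sum>m\<le>l. ?a m * (real m * (real m - 1)) * x $ 3 ^ (m - 2) * norm_square x ^ ?j m)
       + (\<Sum>m\<le>l. ?a m * ((sphere_eigenvalue l - sphere_eigenvalue m) * x $ 3 ^ m * norm_square x ^ (?j m - 1)))"
    unfolding sum.distrib[symmetric]
  proof (intro sum.cong refl)
    fix m assume m: "m \<in> {..l}"
    show "?a m * poly_laplacian (\<lambda>x. x $ 3 ^ m * norm_square x ^ ?j m) x = ?a m * (real m * (real m - 1)) * x $ 3 ^ (m - 2) * norm_square x ^ ?j m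
      + ?a m * ((sphere_eigenvalue l - sphere_eigenvalue m) * x $ 3 ^ m * norm_square x ^ (?j m - 1))"
    proof (cases "even (l + m)")
      case True
      then have e: "m + 2 * ?j m = l" using m by auto
      then have "real l = real m + 2 * real (?j m)" by (metis of_nat_add of_nat_mult of_nat_numeral)
      then have K: "4 * real m * real (?j m) + 2 * real (?j m) * (2 * real (?j m) + 1) = sphere_eigenvalue l - sphere_eigenvalue m"
        by (simp add: algebra_simps)
      show ?thesis unfolding poly_laplacian_monomial K by (simp add: distrib_left mult.assoc)
    qed (simp add: legendre_poly_parity)
  qed
  also have "(\<Sum>m\<le>l. ?a m * (real m * (real m - 1)) * x $ 3 ^ (m - 2) * norm_square x ^ ?j m)
     = (\<Sum>m\<le>l. ?a (m + 2) * ((real m + 2) * (real m + 1)) * x $ 3 ^ m * norm_square x ^ ?j (m + 2))"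
  proof -
    let ?g = "\<lambda>m. ?a m * (real m * (real m - 1)) * x $ 3 ^ (m - 2) * norm_square x ^ ?j m"
    have hi: "?a m = 0" if "m > l" for m using legendre_poly_degree_below[of l] that by (simp add: degree_below_def)
    have "(\<Sum>m\<le>l. ?g m) = (\<Sum>m\<le>Suc (Suc l). ?g m)" by (simp add: hi)
    also have "\<dots> = ?g 0 + (?g (Suc 0) + (\<Sum>m\<le>l. ?g (Suc (Suc m))))"
      unfolding sum.atMost_Suc_shift ..
    also have "\<dots> = (\<Sum>m\<le>l. ?g (Suc (Suc m)))" by simp
    finally show ?thesis by (simp add: add_ac)
  qed
  also have "\<dots> = (\<Sum>m\<le>l. (sphere_eigenvalue m - sphere_eigenvalue l) * ?a m * x $ 3 ^ m * norm_square x ^ (?j m - 1))"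
  proof (intro sum.cong refl)
    fix m assume m: "m \<in> {..l}"
    have "?j (m + 2) = ?j m - 1" by auto
    then show "?a (m + 2) * ((real m + 2) * (real m + 1)) * x $ 3 ^ m * norm_square x ^ ?j (m + 2) = (sphere_eigenvalue m - sphere_eigenvalue l) * ?a m * x $ 3 ^ m * norm_square x ^ (?j m - 1)"
      using legendre_poly_recurrence[of m l] by (simp add: mult_ac)
  qed
  finally show "poly_laplacian (solid_zonal l) x = 0"
    by (simp add: sum.distrib[symmetric] algebra_simps)
qed

lemma zonal_eq_solid: "x \<in> S2 \<Longrightarrow> zonal l x = solid_zonal l x"
proof -
  assume "x \<in> S2"
  then have s: "norm_square x = 1" by (simp add: norm_square_def norm_eq_1)
  have "degree (legendre_poly l) \<le> l" using legendre_poly_degree_below[of l] by (intro degree_le) (auto simp: degree_below_def)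
  then have "poly (legendre_poly l) (x $ 3) = (\<Sum>m\<le>l. poly.coeff (legendre_poly l) m * x $ 3 ^ m)"
  proof -
    have "poly (legendre_poly l) (x $ 3) = (\<Sum>m\<le>degree (legendre_poly l). poly.coeff (legendre_poly l) m * x $ 3 ^ m)"
      by (rule poly_altdef)
    also have "\<dots> = (\<Sum>m\<le>l. poly.coeff (legendre_poly l) m * x $ 3 ^ m)"
      using \<open>degree (legendre_poly l) \<le> l\<close> by (intro sum.mono_neutral_left) (auto simp: coeff_eq_0)
    finally show ?thesis .
  qed
  then show ?thesis by (simp add: solid_zonal_def s)
qed

text \<open>Zonal functions are harmonics, and the spaces of harmonics are invariant under rotations, so this
  follows from the generation of all polynomials by rotations. Stating the sum for all large
  \<open>m\<close> allows two decompositions to be added.\<close>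

lemma harmonic_decomposition:
  assumes "rpoly p"
  shows "\<exists>n Y. (\<forall>l. solid_harmonic l (Y l)) \<and> (\<forall>m\<ge>n. \<forall>x\<in>S2. p x = (\<Sum>l<m. Y l x))"
  using assms
proof (rule rpoly_zonal_induct[rotated -1])
  fix l
  let ?Y = "\<lambda>k. if k = l then solid_zonal l else (\<lambda>x. 0)"
  have "zonal l x = (\<Sum>k<m. ?Y k x)" if "m \<ge> Suc l" "x \<in> S2" for m x
  proof -
    have "(\<Sum>k<m. ?Y k x) = (\<Sum>k<m. if k = l then solid_zonal l x else 0)" by (intro sum.cong) auto
    then show ?thesis using that by (simp add: zonal_eq_solid)
  qed
  then show "\<exists>n Y. (\<forall>l. solid_harmonic l (Y l)) \<and> (\<forall>m\<ge>n. \<forall>x\<in>S2. zonal l x = (\<Sum>l<m. Y l x))"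
    by (intro exI[of _ "Suc l"] exI[of _ ?Y]) (auto simp: solid_harmonic_zonal solid_harmonic_zero)
next
  fix p q :: "real^3 \<Rightarrow> real"
  assume "\<exists>n Y. (\<forall>l. solid_harmonic l (Y l)) \<and> (\<forall>m\<ge>n. \<forall>x\<in>S2. p x = (\<Sum>l<m. Y l x))"
    "\<exists>n Y. (\<forall>l. solid_harmonic l (Y l)) \<and> (\<forall>m\<ge>n. \<forall>x\<in>S2. q x = (\<Sum>l<m. Y l x))"
  then obtain n Y n' Y' where "\<forall>l. solid_harmonic l (Y l)" "\<forall>m\<ge>n. \<forall>x\<in>S2. p x = (\<Sum>l<m. Y l x)"
    "\<forall>l. solid_harmonic l (Y' l)" "\<forall>m\<ge>n'. \<forall>x\<in>S2. q x = (\<Sum>l<m. Y' l x)" by blast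
  then show "\<exists>n Y. (\<forall>l. solid_harmonic l (Y l)) \<and> (\<forall>m\<ge>n. \<forall>x\<in>S2. p x + q x = (\<Sum>l<m. Y l x))"
    by (intro exI[of _ "max n n'"] exI[of _ "\<lambda>l x. Y l x + Y' l x"]) (auto simp: sum.distrib intro: solid_harmonic_add)
next
  fix c and p :: "real^3 \<Rightarrow> real"
  assume "\<exists>n Y. (\<forall>l. solid_harmonic l (Y l)) \<and> (\<forall>m\<ge>n. \<forall>x\<in>S2. p x = (\<Sum>l<m. Y l x))"
  then obtain n Y where "\<forall>l. solid_harmonic l (Y l)" "\<forall>m\<ge>n. \<forall>x\<in>S2. p x = (\<Sum>l<m. Y l x)" by blast
  then show "\<exists>n Y. (\<forall>l. solid_harmonic l (Y l)) \<and> (\<forall>m\<ge>n. \<forall>x\<in>S2. c * p x = (\<Sum>l<m. Y l x))"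
    by (intro exI[of _ n] exI[of _ "\<lambda>l x. c * Y l x"]) (auto simp: sum_distrib_left intro: solid_harmonic_cmult)
next
  fix a and p :: "real^3 \<Rightarrow> real"
  assume p: "rpoly p" and "\<exists>n Y. (\<forall>l. solid_harmonic l (Y l)) \<and> (\<forall>m\<ge>n. \<forall>x\<in>S2. p x = (\<Sum>l<m. Y l x))"
  then obtain n Y where Y: "\<And>l. solid_harmonic l (Y l)" and d: "\<forall>m\<ge>n. \<forall>x\<in>S2. p x = (\<Sum>l<m. Y l x)" by blast
  have rY: "rpoly (Y l)" for l using Y by (simp add: solid_harmonic_def)
  have rs: "rpoly (\<lambda>x. \<Sum>l<m. Y l x)" for m :: nat using rY by (intro real_polynomial_function_sum) auto
  have ls: "rot_deriv a (\<lambda>x. \<Sum>l<m. Y l x) x = (\<Sum>l<m. rot_deriv a (Y l) x)" for m :: nat and x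
  proof (induction m)
    case (Suc m)
    have "rot_deriv a (\<lambda>x. (\<Sum>l<m. Y l x) + Y m x) x = rot_deriv a (\<lambda>x. \<Sum>l<m. Y l x) x + rot_deriv a (Y m) x"
      by (rule rot_deriv_add[OF rs rY])
    then show ?case using Suc by simp
  qed (simp add: rot_deriv_const)
  have "rot_deriv a p x = (\<Sum>l<m. rot_deriv a (Y l) x)" if "m \<ge> n" "x \<in> S2" for m x
    unfolding ls[symmetric] using d that by (intro rot_deriv_cong_sphere[OF p rs]) auto
  then show "\<exists>n Y. (\<forall>l. solid_harmonic l (Y l)) \<and> (\<forall>m\<ge>n. \<forall>x\<in>S2. rot_deriv a p x = (\<Sum>l<m. Y l x))"
    using Y by (intro exI[of _ n] exI[of _ "\<lambda>l. rot_deriv a (Y l)"]) (auto intro: solid_harmonic_rot_deriv)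
qed

section \<open>Quantization maps on polynomials\<close>
lemma continuous_sphere_L2: "continuous_on S2 f \<Longrightarrow> f \<in> sphere_L2"
  unfolding sphere_L2_def
  using continuous_measurable_sphere[of f] sphere_integral(1)[of "\<lambda>x. (f x)\<^sup>2"] by (auto intro: continuous_intros)

lemma rpoly_sphere_L2: "rpoly f \<Longrightarrow> f \<in> sphere_L2"
  by (intro continuous_sphere_L2 rpoly_continuous_on)

lemma continuous_on_sphere_cong:
  assumes "\<And>x. x \<in> S2 \<Longrightarrow> f x = g x" "continuous_on S2 g"
  shows "continuous_on S2 f"
  using assms continuous_on_cong by blast

lemma skew_hermD: "A \<in> skew_herm N \<Longrightarrow> A \<in> carrier_mat N N \<and> mat_adjoint A = - A"
  by (simp add: skew_herm_def)

lemma skew_inner_area_trace: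
  "A \<in> carrier_mat N N \<Longrightarrow> B \<in> carrier_mat N N \<Longrightarrow> skew_inner N A B = - Re (area_trace N (A * B))"
  by (simp add: skew_inner_def area_trace_def mat_trace_def)

lemma skew_inner_frobenius:
  assumes "A \<in> skew_herm N"
  shows "skew_inner N A A = 4 * pi / real N * frobenius_sq N A"
proof -
  have A: "A \<in> carrier_mat N N" "mat_adjoint A = - A" using skew_hermD[OF assms] by auto
  have "of_real (frobenius_sq N A) = mat_trace N (- A * A)" using frobenius_sq_eq_tr(1)[OF A(1)] A(2) by simp
  also have "\<dots> = - mat_trace N (A * A)" using A(1) carrier_matD[OF A(1)] by (simp add: mat_trace_def sum_negf)
  finally have "mat_trace N (A * A) = - of_real (frobenius_sq N A)" by simp
  then show ?thesis using A(1) by (simp add: skew_inner_area_trace area_trace_def)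
qed

lemma frobenius_sq_nonneg: "0 \<le> frobenius_sq N A"
  by (simp add: frobenius_sq_def sum_nonneg)

lemma skew_norm_sq: "A \<in> skew_herm N \<Longrightarrow> (skew_norm N A)\<^sup>2 = 4 * pi / real N * frobenius_sq N A"
  by (simp add: skew_norm_def skew_inner_frobenius frobenius_sq_nonneg)

lemma skew_norm_zero:
  assumes "A \<in> skew_herm N" "skew_norm N A = 0" "N > 0"
  shows "A = 0\<^sub>m N N"
proof -
  have A: "A \<in> carrier_mat N N" using assms skew_hermD by blast
  have "frobenius_sq N A = 0" using skew_norm_sq[OF assms(1)] assms by simp
  then have "\<forall>i<N. (\<Sum>j<N. (cmod (A $$ (i, j)))\<^sup>2) = 0"
    unfolding frobenius_sq_def by (subst (asm) sum_nonneg_eq_0_iff) (auto intro: sum_nonneg)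
  then have "\<forall>i<N. \<forall>j<N. A $$ (i, j) = 0"
    by (subst (asm) sum_nonneg_eq_0_iff) auto
  then show ?thesis using A by (intro eq_matI) auto
qed

lemma L2_norm_sq: "(L2_norm f)\<^sup>2 = (\<integral>x. (f x)\<^sup>2 \<partial>sphere_area)"
  by (simp add: L2_norm_def)

lemma L2_norm_nonneg: "0 \<le> L2_norm f"
  by (simp add: L2_norm_def)

lemma quantizationD:
  assumes "is_quantization N T"
  shows "f \<in> sphere_L2 \<Longrightarrow> T f \<in> skew_herm N"
    and "f \<in> sphere_L2 \<Longrightarrow> g \<in> sphere_L2 \<Longrightarrow> T (\<lambda>x. a * f x + b * g x) = of_real a \<cdot>\<^sub>m T f + of_real b \<cdot>\<^sub>m T g"
    and "\<exists>C. \<forall>f\<in>sphere_L2. skew_norm N (T f) \<le> C * L2_norm f"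
    and "l \<ge> N \<Longrightarrow> f \<in> spherical_harmonics l \<Longrightarrow> T f = 0\<^sub>m N N"
    and "l < N \<Longrightarrow> T ` spherical_harmonics l = hoppe_yau_eigenspace N l"
    and "l < N \<Longrightarrow> f \<in> spherical_harmonics l \<Longrightarrow> skew_norm N (T f) = L2_norm f"
    and "Ck_sphere 1 f \<Longrightarrow> T (poisson_bracket (\<lambda>x. x $ \<alpha>) f) = of_real (1 / hbar N) \<cdot>\<^sub>m commutator (quant_coord N \<alpha>) (T f)"
    and "l < N \<Longrightarrow> \<exists>d :: nat \<Rightarrow> real. T (zonal l) = mat_diag N (\<lambda>j. \<i> * of_real (d j)) \<and> d (N - 1) > 0"
proof -
  note D = assms[unfolded is_quantization_def]
  note D1 = D[THEN conjunct1] and D2 = D[THEN conjunct2]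
  note E1 = D2[THEN conjunct1] and E2 = D2[THEN conjunct2]
  note F1 = E2[THEN conjunct1] and F2 = E2[THEN conjunct2]
  note G1 = F2[THEN conjunct1] and G2 = F2[THEN conjunct2]
  note H1 = G2[THEN conjunct1] and H2 = G2[THEN conjunct2]
  note I1 = H2[THEN conjunct1] and I2 = H2[THEN conjunct2]
  show "f \<in> sphere_L2 \<Longrightarrow> T f \<in> skew_herm N" using D1 by simp
  show "f \<in> sphere_L2 \<Longrightarrow> g \<in> sphere_L2 \<Longrightarrow> T (\<lambda>x. a * f x + b * g x) = of_real a \<cdot>\<^sub>m T f + of_real b \<cdot>\<^sub>m T g"
    using E1 by simp
  show "\<exists>C. \<forall>f\<in>sphere_L2. skew_norm N (T f) \<le> C * L2_norm f" by (rule F1)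
  show "l \<ge> N \<Longrightarrow> f \<in> spherical_harmonics l \<Longrightarrow> T f = 0\<^sub>m N N" using G1 by simp
  show "l < N \<Longrightarrow> T ` spherical_harmonics l = hoppe_yau_eigenspace N l" using H1 by simp
  show "l < N \<Longrightarrow> f \<in> spherical_harmonics l \<Longrightarrow> skew_norm N (T f) = L2_norm f" using H1 by simp
  show "Ck_sphere 1 f \<Longrightarrow> T (poisson_bracket (\<lambda>x. x $ \<alpha>) f) = of_real (1 / hbar N) \<cdot>\<^sub>m commutator (quant_coord N \<alpha>) (T f)"
    using I1 by blast
  show "l < N \<Longrightarrow> \<exists>d :: nat \<Rightarrow> real. T (zonal l) = mat_diag N (\<lambda>j. \<i> * of_real (d j)) \<and> d (N - 1) > 0"
    using I2 by blast
qed

lemma quantization_carrier: "is_quantization N T \<Longrightarrow> f \<in> sphere_L2 \<Longrightarrow> T f \<in> carrier_mat N N"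
  using quantizationD(1) skew_hermD by blast

lemma quantization_add: "is_quantization N T \<Longrightarrow> f \<in> sphere_L2 \<Longrightarrow> g \<in> sphere_L2 \<Longrightarrow> T (\<lambda>x. f x + g x) = T f + T g"
  using quantizationD(2)[of N T f g 1 1] quantization_carrier[of N T f] quantization_carrier[of N T g] by (auto intro!: eq_matI)

lemma quantization_diff:
  assumes "is_quantization N T" "f \<in> sphere_L2" "g \<in> sphere_L2"
  shows "T (\<lambda>x. f x - g x) = T f - T g"
  using quantizationD(2)[OF assms, of 1 "-1"] quantization_carrier[OF assms(1,2)] quantization_carrier[OF assms(1,3)]
  by (auto intro!: eq_matI)

lemma quantization_cmult:
  assumes "is_quantization N T" "f \<in> sphere_L2"
  shows "T (\<lambda>x. c * f x) = of_real c \<cdot>\<^sub>m T f"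
  using quantizationD(2)[OF assms assms(2), of c 0] quantization_carrier[OF assms]
  by (auto intro!: eq_matI)

text \<open>By continuity the image only depends on the class of the function in \<open>L\<^sup>2\<close>, in
  particular only on the values on the sphere.\<close>

lemma quantization_cong:
  assumes Q: "is_quantization N T" and N: "N > 0" and f: "f \<in> sphere_L2" "g \<in> sphere_L2"
    and eq: "\<And>x. x \<in> S2 \<Longrightarrow> f x = g x" and d: "(\<lambda>x. f x - g x) \<in> sphere_L2"
  shows "T f = T g"
proof -
  obtain C where "\<forall>f\<in>sphere_L2. skew_norm N (T f) \<le> C * L2_norm f" using quantizationD(3)[OF Q] by blast
  then have "skew_norm N (T (\<lambda>x. f x - g x)) \<le> C * L2_norm (\<lambda>x. f x - g x)" using d by blast
  moreover have "L2_norm (\<lambda>x. f x - g x) = 0"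
  proof -
    have "(\<integral>x. (f x - g x)\<^sup>2 \<partial>sphere_area) = (\<integral>x. 0 \<partial>sphere_area)"
      by (rule Bochner_Integration.integral_cong) (auto simp: eq)
    then show ?thesis by (simp add: L2_norm_def)
  qed
  moreover have "skew_norm N A \<ge> 0" if "A \<in> skew_herm N" for A
    using that by (simp add: skew_norm_def skew_inner_frobenius frobenius_sq_nonneg)
  ultimately have "skew_norm N (T (\<lambda>x. f x - g x)) = 0"
    using quantizationD(1)[OF Q d] by (simp add: antisym)
  then have "T f - T g = 0\<^sub>m N N"
    using skew_norm_zero[OF quantizationD(1)[OF Q d] _ N] by (simp add: quantization_diff[OF Q f])
  then have "\<forall>i<N. \<forall>j<N. (T f - T g) $$ (i, j) = 0" by simp
  then show ?thesis using quantization_carrier[OF Q f(1)] quantization_carrier[OF Q f(2)] by (intro eq_matI) auto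
qed

lemma quantization_cong_continuous:
  assumes Q: "is_quantization N T" and N: "N > 0" and g: "continuous_on S2 g"
    and eq: "\<And>x. x \<in> S2 \<Longrightarrow> f x = g x"
  shows "T f = T g"
proof (rule quantization_cong[OF Q N _ _ eq])
  have f: "continuous_on S2 f" by (rule continuous_on_sphere_cong[OF eq g])
  show "f \<in> sphere_L2" "g \<in> sphere_L2" using f g continuous_sphere_L2 by auto
  show "(\<lambda>x. f x - g x) \<in> sphere_L2" by (intro continuous_sphere_L2 continuous_on_diff f g)
qed

text \<open>The bracket relation, with the bracket replaced by the polynomial that it equals on the sphere.\<close>

lemma quantization_rot_deriv:
  assumes Q: "is_quantization N T" and N: "N > 0" and f: "rpoly f"
  shows "T (rot_deriv a f) = ad N a (T f)"
proof -
  have "T (poisson_bracket (\<lambda>x. x $ a) f) = T (rot_deriv a f)"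
    by (rule quantization_cong_continuous[OF Q N]) (auto intro: rpoly_continuous_on rpoly_rot_deriv f simp: poisson_bracket_coord[OF f])
  then show ?thesis using quantizationD(7)[OF Q Ck_sphere_rpoly[OF f], of a] by (simp add: ad_def)
qed

lemma zonal_harmonic: "zonal l \<in> spherical_harmonics l"
  unfolding spherical_harmonics_iff using solid_harmonic_zonal zonal_eq_solid by blast

lemma solid_in_spherical: "solid_harmonic l p \<Longrightarrow> p \<in> spherical_harmonics l"
  unfolding spherical_harmonics_iff by blast

lemma jacobi_diff_linear: "jacobi_diff N (\<lambda>j. u * d j - v * e j) j = u * jacobi_diff N d j - v * jacobi_diff N e j"
  by (simp add: jacobi_diff_def algebra_simps)

lemma area_trace_diag: "area_trace N (mat_diag N (\<lambda>j. of_real (d j)) * mat_diag N (\<lambda>j. of_real (d j))) = of_real (4 * pi / real N * (\<Sum>j<N. (d j)\<^sup>2))"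
  by (simp add: area_trace_def mat_trace_def power2_eq_square) (simp add: mat_diag_def)

text \<open>Both diagonals are eigenvectors of the same difference operator, hence proportional; the isometry
  property fixes the square of the factor, the positivity of the last entry its sign.\<close>

lemma zonal_proportional:
  assumes Q: "is_quantization N T" and N: "N \<ge> 2" and l: "l < N" and nz: "Re (zonal_mat l N $$ (N - 1, N - 1)) \<noteq> 0"
  shows "\<exists>c. (- \<i>) \<cdot>\<^sub>m T (zonal l) = of_real c \<cdot>\<^sub>m zonal_mat l N \<and> c * Re (zonal_mat l N $$ (N - 1, N - 1)) > 0 \<and>
     c\<^sup>2 * Re (area_trace N (zonal_mat l N * zonal_mat l N)) = (\<integral>x. (zonal l x)\<^sup>2 \<partial>sphere_area)
     \<and> (\<integral>x. (zonal l x)\<^sup>2 \<partial>sphere_area) > 0"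
proof -
  obtain d where d: "T (zonal l) = mat_diag N (\<lambda>j. \<i> * of_real (d j))" "d (N - 1) > (0::real)"
    using quantizationD(8)[OF Q l] by blast
  obtain e where e: "zonal_mat l N = mat_diag N (\<lambda>j. of_real (e j))" "\<And>j. jacobi_diff N e j = - sphere_eigenvalue l * e j"
    using zonal_mat_diag[OF N] by blast
  have N1: "N - 1 < N" using N by simp
  have eN: "Re (zonal_mat l N $$ (N - 1, N - 1)) = e (N - 1)" using N1 by (simp add: e(1) mat_diag_def)
  have D: "T (zonal l) = \<i> \<cdot>\<^sub>m mat_diag N (\<lambda>j. of_real (d j))" unfolding d(1) by (rule eq_matI) (auto simp: mat_diag_def)
  have "T (zonal l) \<in> hoppe_yau_eigenspace N l"
    using quantizationD(5)[OF Q l] zonal_harmonic by blast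
  then have "hoppe_yau N (T (zonal l)) = of_real (- sphere_eigenvalue l) \<cdot>\<^sub>m T (zonal l)"
    by (simp add: hoppe_yau_eigenspace_def)
  then have "\<i> \<cdot>\<^sub>m mat_diag N (\<lambda>j. of_real (jacobi_diff N d j)) = of_real (- sphere_eigenvalue l) \<cdot>\<^sub>m (\<i> \<cdot>\<^sub>m mat_diag N (\<lambda>j. of_real (d j)))"
    unfolding D hoppe_yau_smult[OF mat_diag_dim] hoppe_yau_diag[OF N] .
  then have "(\<i> \<cdot>\<^sub>m mat_diag N (\<lambda>j. of_real (jacobi_diff N d j))) $$ (j, j) = (of_real (- sphere_eigenvalue l) \<cdot>\<^sub>m (\<i> \<cdot>\<^sub>m mat_diag N (\<lambda>j. of_real (d j)))) $$ (j, j)" for j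
    by simp
  note entry = this
  have jd: "jacobi_diff N d j = - sphere_eigenvalue l * d j" if j: "j < N" for j
  proof -
    have "(\<i> \<cdot>\<^sub>m mat_diag N (\<lambda>j. of_real (jacobi_diff N d j))) $$ (j, j) = \<i> * of_real (jacobi_diff N d j)"
      using j by (simp add: mat_diag_def)
    moreover have "(of_real (- sphere_eigenvalue l) \<cdot>\<^sub>m (\<i> \<cdot>\<^sub>m mat_diag N (\<lambda>j. complex_of_real (d j)))) $$ (j, j) = of_real (- sphere_eigenvalue l) * (\<i> * of_real (d j))"
      using j by (simp add: mat_diag_def)
    ultimately have "\<i> * complex_of_real (jacobi_diff N d j) = \<i> * of_real (- sphere_eigenvalue l * d j)"
      using entry[of j] by (simp only: of_real_mult mult.left_commute)
    then have "complex_of_real (jacobi_diff N d j) = of_real (- sphere_eigenvalue l * d j)" by (simp only: mult_cancel_left complex_i_not_zero simp_thms)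
    then show ?thesis by (simp only: of_real_eq_iff)
  qed
  \<comment> \<open>the combination of the two eigenvectors whose last entry vanishes\<close>
  define f where "f = (\<lambda>j. e (N - 1) * d j - d (N - 1) * e j)"
  have jf: "jacobi_diff N f j = - sphere_eigenvalue l * f j" if "j < N" for j
    unfolding f_def jacobi_diff_linear jd[OF that] e(2) by (simp add: algebra_simps)
  have f0: "f (N - 1) = 0" by (simp add: f_def)
  have "f j = 0" if "j < N" for j
    using jacobi_diff_eigen_unique[of N f "- sphere_eigenvalue l" j] jf f0 that by blast
  then have de: "d j = d (N - 1) / e (N - 1) * e j" if "j < N" for j
    using that nz[unfolded eN] by (simp add: f_def field_simps)
  let ?c = "d (N - 1) / e (N - 1)"
  have 1: "(- \<i>) \<cdot>\<^sub>m T (zonal l) = of_real ?c \<cdot>\<^sub>m zonal_mat l N"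
    unfolding D e(1)
  proof (rule eq_matI)
    fix i j assume "i < dim_row (of_real ?c \<cdot>\<^sub>m mat_diag N (\<lambda>j. complex_of_real (e j)))" "j < dim_col (of_real ?c \<cdot>\<^sub>m mat_diag N (\<lambda>j. complex_of_real (e j)))"
    then have ij: "i < N" "j < N" by auto
    then show "((- \<i>) \<cdot>\<^sub>m (\<i> \<cdot>\<^sub>m mat_diag N (\<lambda>j. complex_of_real (d j)))) $$ (i, j) = (of_real ?c \<cdot>\<^sub>m mat_diag N (\<lambda>j. complex_of_real (e j))) $$ (i, j)"
      using arg_cong[OF de[OF ij(2)], of complex_of_real] by (simp add: mat_diag_def)
  qed auto
  have 2: "?c * e (N - 1) > 0" using d(2) nz[unfolded eN] by simp
  have tz: "T (zonal l) \<in> skew_herm N" by (rule quantizationD(1)[OF Q rpoly_sphere_L2[OF rpoly_poly_coord]])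
  have Tc: "mat_diag N (\<lambda>j. complex_of_real (d j)) \<in> carrier_mat N N" by simp
  have "(\<integral>x. (zonal l x)\<^sup>2 \<partial>sphere_area) = (skew_norm N (T (zonal l)))\<^sup>2"
    using quantizationD(6)[OF Q l zonal_harmonic] by (simp add: L2_norm_sq)
  also have "\<dots> = skew_inner N (T (zonal l)) (T (zonal l))"
    unfolding skew_norm_sq[OF tz] skew_inner_frobenius[OF tz] ..
  also have "\<dots> = - Re (area_trace N (T (zonal l) * T (zonal l)))"
    using tz skew_hermD by (intro skew_inner_area_trace) auto
  also have "T (zonal l) * T (zonal l) = (- 1) \<cdot>\<^sub>m (mat_diag N (\<lambda>j. of_real (d j)) * mat_diag N (\<lambda>j. of_real (d j)))"
    unfolding D mult_smult_distrib[OF smult_carrier_mat[OF Tc] Tc] mult_smult_assoc_mat[OF Tc Tc]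
    by (rule eq_matI) auto
  also have "- Re (area_trace N \<dots>) = 4 * pi / real N * (\<Sum>j<N. (d j)\<^sup>2)"
    by (subst area_trace_smult) (simp_all only: mult_carrier_square mat_diag_dim area_trace_diag, simp)
  finally have m: "(\<integral>x. (zonal l x)\<^sup>2 \<partial>sphere_area) = 4 * pi / real N * (\<Sum>j<N. (d j)\<^sup>2)" .
  have "(\<Sum>j<N. (d j)\<^sup>2) = (\<Sum>j<N. ?c\<^sup>2 * (e j)\<^sup>2)"
    using de by (intro sum.cong refl) (metis lessThan_iff power_mult_distrib)
  then have 3: "?c\<^sup>2 * Re (area_trace N (zonal_mat l N * zonal_mat l N)) = (\<integral>x. (zonal l x)\<^sup>2 \<partial>sphere_area)"
    unfolding m e(1) area_trace_diag Re_complex_of_real by (simp only: sum_distrib_left[symmetric] mult.left_commute)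
  have "(\<Sum>j<N. (d j)\<^sup>2) > 0" using d(2) N1 by (intro sum_pos2[of _ "N - 1"]) auto
  then have 4: "(\<integral>x. (zonal l x)\<^sup>2 \<partial>sphere_area) > 0" unfolding m using N by simp
  show ?thesis by (intro exI[of _ ?c] conjI 1 3 4) (use 2 eN in simp)
qed

text \<open>The factors of proportionality converge: their squares by the convergence of traces, their signs
  because the last entry of the zonal matrix converges to the value of its symbol at the north pole.\<close>

lemma has_symbol_quantized_zonal:
  assumes Q: "\<And>N. N \<ge> 2 \<Longrightarrow> is_quantization N (T N)"
  shows "has_symbol (\<lambda>N. (- \<i>) \<cdot>\<^sub>m T N (zonal l)) (zonal l)"
proof -
  obtain \<kappa> where k: "\<kappa> \<noteq> 0" and q: "has_symbol (zonal_mat l) (\<lambda>x. \<kappa> * zonal l x)" using has_symbol_zonal_mat by blast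
  let ?e = "\<lambda>N. Re (zonal_mat l N $$ (N - 1, N - 1))" and ?s = "\<lambda>N. Re (area_trace N (zonal_mat l N * zonal_mat l N))"
  define m where "m = (\<integral>x. (zonal l x)\<^sup>2 \<partial>sphere_area)"
  have "(\<lambda>N. zonal_mat l N $$ (N - 1, N - 1)) \<longlonglongrightarrow> of_real \<kappa>"
    using has_symbol_last_entry[OF q] by (simp add: axis_def legendre_poly_at_1)
  then have e: "?e \<longlonglongrightarrow> \<kappa>" using tendsto_Re by fastforce
  have "(\<lambda>N. area_trace N (zonal_mat l N * zonal_mat l N)) \<longlonglongrightarrow> of_real (\<integral>x. \<kappa> * zonal l x * (\<kappa> * zonal l x) \<partial>sphere_area)"
    by (rule has_symbol_trace[OF has_symbol.mult[OF q q]])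
  also have "(\<integral>x. \<kappa> * zonal l x * (\<kappa> * zonal l x) \<partial>sphere_area) = (\<integral>x. \<kappa>\<^sup>2 * (zonal l x)\<^sup>2 \<partial>sphere_area)"
    by (simp add: power2_eq_square mult_ac)
  also have "\<dots> = \<kappa>\<^sup>2 * m" by (simp add: m_def)
  finally have s: "?s \<longlonglongrightarrow> \<kappa>\<^sup>2 * m" using tendsto_Re by fastforce
  \<comment> \<open>the last entry of the zonal matrix eventually has the sign of
    \<open>\<kappa>\<close>, as the Legendre polynomial is \<open>1\<close> at the
    pole\<close>
  have ek: "\<forall>\<^sub>F N in sequentially. ?e N * \<kappa> > 0"
  proof -
    have "(\<lambda>N. ?e N * \<kappa>) \<longlonglongrightarrow> \<kappa> * \<kappa>" by (intro tendsto_mult e tendsto_const)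
    moreover have "\<kappa> * \<kappa> > 0" using k by (metis not_square_less_zero linorder_neqE_linordered_idom mult_eq_0_iff)
    ultimately show ?thesis by (rule order_tendstoD(1))
  qed
  let ?P = "\<lambda>N c. (- \<i>) \<cdot>\<^sub>m T N (zonal l) = of_real c \<cdot>\<^sub>m zonal_mat l N \<and> c * ?e N > 0 \<and> c\<^sup>2 * ?s N = m \<and> m > 0"
  have ex: "\<forall>\<^sub>F N in sequentially. \<exists>c. ?P N c"
    using ek eventually_gt_at_top[of "max 2 l"]
  proof eventually_elim
    case (elim N)
    have "is_quantization N (T N)" "2 \<le> N" "l < N" "?e N \<noteq> 0" using elim by (auto intro: Q)
    from zonal_proportional[OF this] show ?case unfolding m_def .
  qed
  define c where "c N = (SOME c. ?P N c)" for N
  have c: "\<forall>\<^sub>F N in sequentially. ?P N (c N)"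
    using ex by eventually_elim (unfold c_def, rule someI_ex)
  have m: "m > 0" using eventually_happens[OF ex] by auto
  have "(\<lambda>N. sgn \<kappa> * sqrt (m / ?s N)) \<longlonglongrightarrow> sgn \<kappa> * sqrt (m / (\<kappa>\<^sup>2 * m))"
    using k m by (intro tendsto_intros s) auto
  moreover have "sgn \<kappa> * sqrt (m / (\<kappa>\<^sup>2 * m)) = 1 / \<kappa>"
    using k m by (simp add: real_sqrt_divide sgn_real_def)
  moreover have "\<forall>\<^sub>F N in sequentially. sgn \<kappa> * sqrt (m / ?s N) = c N"
    using c ek
  proof eventually_elim
    case (elim N)
    have sn: "?s N \<noteq> 0" using elim m by auto
    have "(c N)\<^sup>2 = m / ?s N" using elim sn by (simp add: field_simps)
    then have "sqrt (m / ?s N) = \<bar>c N\<bar>" by (metis real_sqrt_abs)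
    have "c N * ?e N > 0" "?e N * \<kappa> > 0" using elim by blast+
    then have "c N * ?e N * (?e N * \<kappa>) > 0" by (rule mult_pos_pos)
    then have "(c N * \<kappa>) * (?e N)\<^sup>2 > 0" by (simp add: power2_eq_square mult_ac)
    then have "c N * \<kappa> > 0" by (simp add: zero_less_mult_iff)
    then have "sgn \<kappa> * \<bar>c N\<bar> = c N"
      by (cases "\<kappa> > 0") (auto simp: zero_less_mult_iff sgn_real_def)
    with \<open>sqrt (m / ?s N) = \<bar>c N\<bar>\<close> show ?case by (simp only:)
  qed
  ultimately have "c \<longlonglongrightarrow> 1 / \<kappa>" using Lim_transform_eventually[of "\<lambda>N. sgn \<kappa> * sqrt (m / ?s N)"] by (simp only:)
  from has_symbol.scale[OF q this]
  have "has_symbol (\<lambda>N. of_real (c N) \<cdot>\<^sub>m zonal_mat l N) (\<lambda>x. 1 / \<kappa> * (\<kappa> * zonal l x))" .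
  moreover have "(\<lambda>x. 1 / \<kappa> * (\<kappa> * zonal l x)) = zonal l" using k by auto
  moreover have "\<forall>\<^sub>F N in sequentially. of_real (c N) \<cdot>\<^sub>m zonal_mat l N = (- \<i>) \<cdot>\<^sub>m T N (zonal l)"
    using c by eventually_elim simp
  ultimately show ?thesis using has_symbol.eventually by metis
qed

text \<open>The property is inherited by linear combinations and, through the bracket relation, by rotation
  derivatives, so it spreads from the zonal functions to all polynomials.\<close>

lemma has_symbol_quantized_poly:
  assumes Q: "\<And>N. N \<ge> 2 \<Longrightarrow> is_quantization N (T N)" and p: "rpoly p"
  shows "has_symbol (\<lambda>N. (- \<i>) \<cdot>\<^sub>m T N p) p"
  using p
proof (rule rpoly_zonal_induct[rotated -1])
  show "has_symbol (\<lambda>N. (- \<i>) \<cdot>\<^sub>m T N (zonal l)) (zonal l)" for l by (rule has_symbol_quantized_zonal[OF Q])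
next
  fix p q assume r: "rpoly p" "rpoly q" and q: "has_symbol (\<lambda>N. (- \<i>) \<cdot>\<^sub>m T N p) p" "has_symbol (\<lambda>N. (- \<i>) \<cdot>\<^sub>m T N q) q"
  have "\<forall>\<^sub>F N in sequentially. (- \<i>) \<cdot>\<^sub>m T N p + (- \<i>) \<cdot>\<^sub>m T N q = (- \<i>) \<cdot>\<^sub>m T N (\<lambda>x. p x + q x)"
    using eventually_ge_at_top[of 2]
  proof eventually_elim
    case (elim N)
    note c = quantization_carrier[OF Q[OF elim] rpoly_sphere_L2[OF r(1)]] quantization_carrier[OF Q[OF elim] rpoly_sphere_L2[OF r(2)]]
    show ?case unfolding quantization_add[OF Q[OF elim] rpoly_sphere_L2[OF r(1)] rpoly_sphere_L2[OF r(2)]]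
      by (rule add_smult_distrib_left_mat[OF c, symmetric])
  qed
  then show "has_symbol (\<lambda>N. (- \<i>) \<cdot>\<^sub>m T N (\<lambda>x. p x + q x)) (\<lambda>x. p x + q x)"
    by (rule has_symbol.eventually[OF has_symbol.add[OF q]])
next
  fix c p assume r: "rpoly p" and q: "has_symbol (\<lambda>N. (- \<i>) \<cdot>\<^sub>m T N p) p"
  have "\<forall>\<^sub>F N in sequentially. of_real c \<cdot>\<^sub>m ((- \<i>) \<cdot>\<^sub>m T N p) = (- \<i>) \<cdot>\<^sub>m T N (\<lambda>x. c * p x)"
    using eventually_ge_at_top[of 2]
    by eventually_elim (auto simp: quantization_cmult[OF Q rpoly_sphere_L2[OF r]] intro!: eq_matI)
  then show "has_symbol (\<lambda>N. (- \<i>) \<cdot>\<^sub>m T N (\<lambda>x. c * p x)) (\<lambda>x. c * p x)"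
    by (rule has_symbol.eventually[OF has_symbol_cmult[OF q]])
next
  fix a p assume r: "rpoly p" and q: "has_symbol (\<lambda>N. (- \<i>) \<cdot>\<^sub>m T N p) p"
  have "\<forall>\<^sub>F N in sequentially. ad N a ((- \<i>) \<cdot>\<^sub>m T N p) = (- \<i>) \<cdot>\<^sub>m T N (rot_deriv a p)"
    using eventually_ge_at_top[of 2]
  proof eventually_elim
    case (elim N)
    then have "N > 0" by simp
    then show ?case using ad_smult[OF quantization_carrier[OF Q[OF elim] rpoly_sphere_L2[OF r]]] quantization_rot_deriv[OF Q[OF elim] _ r] by simp
  qed
  then show "has_symbol (\<lambda>N. (- \<i>) \<cdot>\<^sub>m T N (rot_deriv a p)) (rot_deriv a p)"
    by (rule has_symbol.eventually[OF has_symbol_ad[OF q]])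
qed

section \<open>Contraction\<close>

lemma area_trace_ad_skew:
  assumes A: "A \<in> carrier_mat N N" and B: "B \<in> carrier_mat N N"
  shows "area_trace N (ad N a A * B) = - area_trace N (A * ad N a B)"
proof -
  have "0 = area_trace N (ad N a (A * B))" using area_trace_ad[of "A * B" N a] A B by simp
  also have "\<dots> = area_trace N (ad N a A * B) + area_trace N (A * ad N a B)" using A B by (simp add: ad_mult area_trace_linear)
  finally show ?thesis by (simp add: eq_neg_iff_add_eq_0)
qed

lemma area_trace_hoppe_yau_sym:
  assumes A: "A \<in> carrier_mat N N" and B: "B \<in> carrier_mat N N"
  shows "area_trace N (hoppe_yau N A * B) = area_trace N (A * hoppe_yau N B)"
proof -
  have 1: "area_trace N (ad N a (ad N a A) * B) = area_trace N (A * ad N a (ad N a B))" for a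
    using A B by (simp add: area_trace_ad_skew)
  show ?thesis using A B
    by (simp add: hoppe_yau_ad add_mult_distrib_mat[of _ N N _ _ N] mult_add_distrib_mat[of _ N N _ N] area_trace_linear 1)
qed

text \<open>The adjoint action is skew for the trace form, so the Hoppe--Yau Laplacian is symmetric.\<close>

lemma eigenspace_orthogonal:
  assumes A: "A \<in> hoppe_yau_eigenspace N l" and B: "B \<in> hoppe_yau_eigenspace N m" and lm: "l \<noteq> m"
  shows "area_trace N (A * B) = 0"
proof -
  have c: "A \<in> carrier_mat N N" "B \<in> carrier_mat N N" using A B by (auto simp: hoppe_yau_eigenspace_def skew_herm_def)
  have h: "hoppe_yau N A = of_real (- sphere_eigenvalue l) \<cdot>\<^sub>m A" "hoppe_yau N B = of_real (- sphere_eigenvalue m) \<cdot>\<^sub>m B"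
    using A B by (auto simp: hoppe_yau_eigenspace_def)
  have "of_real (- sphere_eigenvalue l) * area_trace N (A * B) = of_real (- sphere_eigenvalue m) * area_trace N (A * B)"
    using area_trace_hoppe_yau_sym[OF c] c unfolding h
    by (simp add: mult_smult_distrib[of _ N N _ N] mult_smult_assoc_mat[of _ N N _ N] area_trace_smult)
  moreover have "sphere_eigenvalue l \<noteq> sphere_eigenvalue m"
  proof -
    have "sphere_eigenvalue i < sphere_eigenvalue j" if "i < j" for i j using that by (intro mult_strict_mono) auto
    then show ?thesis using lm by (metis linorder_neqE_nat less_irrefl)
  qed
  then have "complex_of_real (- sphere_eigenvalue l) \<noteq> of_real (- sphere_eigenvalue m)" by (metis of_real_eq_iff neg_equal_iff_equal)
  ultimately show ?thesis by (metis mult_right_cancel)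
qed

lemma quantization_solid_eigenspace:
  assumes "is_quantization N T" "l < N" "solid_harmonic l p"
  shows "T p \<in> hoppe_yau_eigenspace N l"
  using quantizationD(5)[OF assms(1,2)] solid_in_spherical[OF assms(3)] by blast

text \<open>Orthogonality on the sphere is inherited from the matrices: the traces of the products vanish for
  all large \<open>N\<close> and converge to the integral.\<close>

lemma solid_harmonic_orthogonal:
  assumes Q: "\<And>N. N \<ge> 2 \<Longrightarrow> is_quantization N (T N)" and p: "solid_harmonic l p" and q: "solid_harmonic m q" and lm: "l \<noteq> m"
  shows "(\<integral>x. p x * q x \<partial>sphere_area) = 0"
proof -
  have r: "rpoly p" "rpoly q" using p q by (auto simp: solid_harmonic_def)
  have L: "(\<lambda>N. area_trace N ((- \<i>) \<cdot>\<^sub>m T N p * ((- \<i>) \<cdot>\<^sub>m T N q))) \<longlonglongrightarrow> of_real (\<integral>x. p x * q x \<partial>sphere_area)"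
    by (rule has_symbol_trace[OF has_symbol.mult[OF has_symbol_quantized_poly[OF Q r(1)] has_symbol_quantized_poly[OF Q r(2)]]])
  have "\<forall>\<^sub>F N in sequentially. area_trace N ((- \<i>) \<cdot>\<^sub>m T N p * ((- \<i>) \<cdot>\<^sub>m T N q)) = 0"
    using eventually_gt_at_top[of "max 2 (max l m)"]
  proof eventually_elim
    case (elim N)
    then have N: "is_quantization N (T N)" "l < N" "m < N" by (auto intro: Q)
    have "T N p \<in> carrier_mat N N" "T N q \<in> carrier_mat N N" using quantization_carrier[OF N(1) rpoly_sphere_L2] r by auto
    moreover have "area_trace N (T N p * T N q) = 0"
      by (rule eigenspace_orthogonal[OF quantization_solid_eigenspace[OF N(1,2) p] quantization_solid_eigenspace[OF N(1,3) q] lm])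
    ultimately show ?case by (simp add: mult_smult_distrib[of _ N N _ N] mult_smult_assoc_mat[of _ N N _ N] area_trace_smult)
  qed
  from Lim_transform_eventually[OF L this] have "complex_of_real (\<integral>x. p x * q x \<partial>sphere_area) = 0"
    using LIMSEQ_unique tendsto_const by blast
  then show ?thesis by simp
qed

text \<open>Parseval's identity on both sides: the components of different degrees are orthogonal before and
  after quantization, those of degree less than \<open>N\<close> keep their norm and the others are
  mapped to zero.\<close>

lemma quantization_contraction_rpoly:
  assumes Q: "\<And>N. N \<ge> 2 \<Longrightarrow> is_quantization N (T N)" and N: "N \<ge> 2" and p: "rpoly p"
  shows "skew_norm N (T N p) \<le> L2_norm p"
proof -
  obtain n Y where Y: "\<And>l. solid_harmonic l (Y l)" and d: "\<And>x. x \<in> S2 \<Longrightarrow> p x = (\<Sum>l<n. Y l x)"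
    using harmonic_decomposition[OF p] by blast
  note QN = Q[OF N]
  have N0: "N > 0" using N by simp
  have rY: "rpoly (Y l)" for l using Y by (simp add: solid_harmonic_def)
  let ?h = "\<lambda>k x. \<Sum>l<k. Y l x"
  have rh: "rpoly (?h k)" for k :: nat using rY by (intro real_polynomial_function_sum) auto
  have TY: "T N (Y l) \<in> hoppe_yau_eigenspace N l \<or> T N (Y l) = 0\<^sub>m N N" for l
    using quantization_solid_eigenspace[OF QN _ Y] quantizationD(4)[OF QN _ solid_in_spherical[OF Y]] by (cases "l < N") auto
  have Th: "T N (?h k) \<in> carrier_mat N N" for k by (rule quantization_carrier[OF QN rpoly_sphere_L2[OF rh]])
  have TYc: "T N (Y k) \<in> carrier_mat N N" for k by (rule quantization_carrier[OF QN rpoly_sphere_L2[OF rY]])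
  have step: "T N (?h (Suc k)) = T N (?h k) + T N (Y k)" for k
    using quantization_add[OF QN rpoly_sphere_L2[OF rh] rpoly_sphere_L2[OF rY], of k k] by simp
  have T0: "T N (?h 0) = 0\<^sub>m N N"
    using quantization_cmult[OF QN rpoly_sphere_L2[OF rY], of 0 0] TYc[of 0] by (auto intro!: eq_matI)
  have orth: "area_trace N (T N (?h k) * B) = 0" if "B \<in> hoppe_yau_eigenspace N m" "k \<le> m" for k m B
    using that(2)
  proof (induction k)
    case 0
    have "B \<in> carrier_mat N N" using that by (auto simp: hoppe_yau_eigenspace_def skew_herm_def)
    then show ?case unfolding T0 by (simp add: left_mult_zero_mat)
  next
    case (Suc k)
    have B: "B \<in> carrier_mat N N" using that by (auto simp: hoppe_yau_eigenspace_def skew_herm_def)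
    have "area_trace N (T N (Y k) * B) = 0"
      using TY[of k] eigenspace_orthogonal[OF _ that(1), of "T N (Y k)" k] Suc.prems B
      by (auto simp: left_mult_zero_mat)
    then show ?case unfolding step using Suc Th TYc B
      by (simp add: add_mult_distrib_mat[of _ N N _ _ N] area_trace_linear)
  qed
  have iorth: "(\<integral>x. ?h k x * Y k x \<partial>sphere_area) = 0" for k
  proof -
    have "(\<integral>x. ?h k x * Y k x \<partial>sphere_area) = (\<integral>x. (\<Sum>l<k. Y l x * Y k x) \<partial>sphere_area)"
      by (simp add: sum_distrib_right)
    also have "\<dots> = (\<Sum>l<k. \<integral>x. Y l x * Y k x \<partial>sphere_area)"
      by (intro Bochner_Integration.integral_sum sphere_integral(1) rpoly_continuous_on real_polynomial_function.intros(4) rY)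
    also have "\<dots> = 0" by (intro sum.neutral ballI solid_harmonic_orthogonal[OF Q Y Y]) auto
    finally show ?thesis .
  qed
  have ri: "integrable sphere_area (\<lambda>x. u x * v x)" if "rpoly u" "rpoly v" for u v
    using that by (intro sphere_integral(1) rpoly_continuous_on real_polynomial_function.intros(4))
  have main: "- Re (area_trace N (T N (?h k) * T N (?h k))) \<le> (\<integral>x. (?h k x)\<^sup>2 \<partial>sphere_area)" for k
  proof (induction k)
    case 0
    show ?case unfolding T0 by simp
  next
    case (Suc k)
    let ?X = "T N (?h k)" and ?Y = "T N (Y k)"
    have XY: "area_trace N (?X * ?Y) = 0"
      using TY[of k] orth[of ?Y k k] Th[of k] by (auto simp: right_mult_zero_mat)
    then have YX: "area_trace N (?Y * ?X) = 0" using area_trace_comm[OF Th TYc] by metis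
    have YY: "- Re (area_trace N (?Y * ?Y)) \<le> (\<integral>x. (Y k x)\<^sup>2 \<partial>sphere_area)"
    proof (cases "k < N")
      case True
      have "- Re (area_trace N (?Y * ?Y)) = (skew_norm N ?Y)\<^sup>2"
        using skew_inner_area_trace[OF TYc TYc, of k k] skew_norm_sq[OF quantizationD(1)[OF QN rpoly_sphere_L2[OF rY]], of k]
          skew_inner_frobenius[OF quantizationD(1)[OF QN rpoly_sphere_L2[OF rY]], of k] by simp
      also have "\<dots> = (L2_norm (Y k))\<^sup>2" using quantizationD(6)[OF QN True solid_in_spherical[OF Y]] by simp
      finally show ?thesis by (simp add: L2_norm_sq)
    next
      case False
      then have "?Y = 0\<^sub>m N N" using quantizationD(4)[OF QN _ solid_in_spherical[OF Y]] by simp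
      then show ?thesis by simp
    qed
    have "area_trace N ((?X + ?Y) * (?X + ?Y)) = area_trace N (?X * ?X) + area_trace N (?X * ?Y) + (area_trace N (?Y * ?X) + area_trace N (?Y * ?Y))"
      using Th[of k] TYc[of k] by (simp add: add_mult_distrib_mat[of _ N N _ _ N] mult_add_distrib_mat[of _ N N _ N] area_trace_linear)
    then have "- Re (area_trace N (T N (?h (Suc k)) * T N (?h (Suc k)))) = - Re (area_trace N (?X * ?X)) + (- Re (area_trace N (?Y * ?Y)))"
      unfolding step by (simp add: XY YX)
    also have "\<dots> \<le> (\<integral>x. (?h k x)\<^sup>2 \<partial>sphere_area) + (\<integral>x. (Y k x)\<^sup>2 \<partial>sphere_area)"
      using Suc.IH YY by linarith
    also have "\<dots> = (\<integral>x. ?h k x * ?h k x \<partial>sphere_area) + 2 * (\<integral>x. ?h k x * Y k x \<partial>sphere_area) + (\<integral>x. Y k x * Y k x \<partial>sphere_area)"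
      unfolding iorth by (simp add: power2_eq_square)
    also have "\<dots> = (\<integral>x. ?h k x * ?h k x + 2 * (?h k x * Y k x) + Y k x * Y k x \<partial>sphere_area)"
      using ri[OF rh rh, of k k] ri[OF rh rY, of k k] ri[OF rY rY, of k k] by (simp add: Bochner_Integration.integral_add)
    also have "\<dots> = (\<integral>x. (?h (Suc k) x)\<^sup>2 \<partial>sphere_area)"
      by (intro Bochner_Integration.integral_cong refl) (simp add: power2_eq_square algebra_simps)
    finally show ?case .
  qed
  have "T N p = T N (?h n)"
    by (rule quantization_cong_continuous[OF QN N0]) (use rh d in \<open>auto intro: rpoly_continuous_on\<close>)
  then have "(skew_norm N (T N p))\<^sup>2 = - Re (area_trace N (T N (?h n) * T N (?h n)))"
    using skew_inner_area_trace[OF Th Th, of n n] skew_norm_sq[OF quantizationD(1)[OF QN rpoly_sphere_L2[OF rh]], of n]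
      skew_inner_frobenius[OF quantizationD(1)[OF QN rpoly_sphere_L2[OF rh]], of n] by simp
  also have "\<dots> \<le> (\<integral>x. (?h n x)\<^sup>2 \<partial>sphere_area)" by (rule main)
  also have "\<dots> = (\<integral>x. (p x)\<^sup>2 \<partial>sphere_area)"
    by (rule Bochner_Integration.integral_cong) (auto simp: d)
  finally have "(skew_norm N (T N p))\<^sup>2 \<le> (L2_norm p)\<^sup>2" by (simp add: L2_norm_sq)
  then show ?thesis using L2_norm_nonneg power2_le_imp_le by blast
qed

section \<open>Convergence of spectral measures\<close>
text \<open>Interchange of limits, for the three approximation steps below.\<close>

lemma limit_by_approximation:
  fixes s :: "nat \<Rightarrow> real"
  assumes "\<And>e. e > 0 \<Longrightarrow> \<exists>t L. t \<longlonglongrightarrow> L \<and> (\<forall>\<^sub>F N in sequentially. \<bar>s N - t N\<bar> \<le> e) \<and> \<bar>S - L\<bar> \<le> e"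
  shows "s \<longlonglongrightarrow> S"
proof (rule tendstoI)
  fix e :: real assume e: "e > 0"
  obtain t L where t: "t \<longlonglongrightarrow> L" "\<forall>\<^sub>F N in sequentially. \<bar>s N - t N\<bar> \<le> e / 4" "\<bar>S - L\<bar> \<le> e / 4"
    using assms[of "e / 4"] e by auto
  have "\<forall>\<^sub>F N in sequentially. dist (t N) L < e / 4" using tendstoD[OF t(1), of "e / 4"] e by simp
  with t(2) show "\<forall>\<^sub>F N in sequentially. dist (s N) S < e"
    by eventually_elim (use t(3) e in \<open>unfold dist_real_def, linarith\<close>)
qed

lemma continuous_on_compact_abs_bound:
  fixes f :: "'a::topological_space \<Rightarrow> real"
  assumes "compact S" "continuous_on S f"
  shows "\<exists>B. \<forall>x\<in>S. \<bar>f x\<bar> \<le> B"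
  using compact_imp_bounded[OF compact_continuous_image[OF assms(2,1)]] unfolding bounded_iff by auto

lemma sphere_integral_bound:
  assumes h: "continuous_on S2 h" and b: "\<And>x. x \<in> S2 \<Longrightarrow> \<bar>h x\<bar> \<le> c"
  shows "\<bar>\<integral>x. h x \<partial>sphere_area\<bar> \<le> 4 * pi * c"
proof -
  have "norm (\<integral>x. h x \<partial>sphere_area) \<le> (\<integral>x. norm (h x) \<partial>sphere_area)" by (rule integral_norm_bound)
  also have "\<dots> \<le> (\<integral>x. c * 1 \<partial>sphere_area)"
    by (intro integral_mono sphere_integral(1) continuous_intros h) (use b in auto)
  also have "\<dots> = c * (4 * pi)" unfolding sphere_area_total[symmetric] by (rule Bochner_Integration.integral_mult_right_zero)
  finally show ?thesis by (simp add: mult_ac)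
qed

lemma L2_norm_bound:
  assumes h: "continuous_on S2 h" and b: "\<And>x. x \<in> S2 \<Longrightarrow> \<bar>h x\<bar> \<le> c" and c: "0 \<le> c"
  shows "L2_norm h \<le> sqrt (4 * pi) * c"
proof -
  have "\<bar>\<integral>x. (h x)\<^sup>2 \<partial>sphere_area\<bar> \<le> 4 * pi * c\<^sup>2"
    by (rule sphere_integral_bound) (use b c h in \<open>auto intro!: continuous_intros simp: abs_le_square_iff[symmetric]\<close>)
  then have "L2_norm h \<le> sqrt (4 * pi * c\<^sup>2)" unfolding L2_norm_def by (intro real_sqrt_le_mono) auto
  then show ?thesis using c by (simp add: real_sqrt_mult)
qed

lemma frobenius_sq_L2: "sqrt (frobenius_sq N A) = L2_set (\<lambda>p. cmod (A $$ p)) ({..<N} \<times> {..<N})"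
  by (simp add: frobenius_sq_def L2_set_def sum.cartesian_product case_prod_unfold)

lemma skew_norm_frobenius: "A \<in> skew_herm N \<Longrightarrow> skew_norm N A = sqrt (4 * pi / real N) * sqrt (frobenius_sq N A)"
  unfolding skew_norm_def by (simp only: skew_inner_frobenius real_sqrt_mult)

lemma skew_norm_triangle:
  assumes "A \<in> skew_herm N" "B \<in> skew_herm N" "A + B \<in> skew_herm N"
  shows "skew_norm N (A + B) \<le> skew_norm N A + skew_norm N B"
proof -
  have c: "A \<in> carrier_mat N N" "B \<in> carrier_mat N N" using assms skew_hermD by blast+
  have "sqrt (frobenius_sq N (A + B)) \<le> L2_set (\<lambda>p. cmod (A $$ p) + cmod (B $$ p)) ({..<N} \<times> {..<N})"
    unfolding frobenius_sq_L2
    by (intro L2_set_mono) (use c in \<open>auto intro: norm_triangle_ineq\<close>)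
  also have "\<dots> \<le> sqrt (frobenius_sq N A) + sqrt (frobenius_sq N B)" unfolding frobenius_sq_L2 by (rule L2_set_triangle_ineq)
  finally show ?thesis using assms by (simp add: skew_norm_frobenius mult_left_mono flip: distrib_left)
qed

text \<open>The contraction estimate extends from polynomials to continuous functions by the continuity of the
  single map. The bound in the definition of a quantization map depends on \<open>N\<close>, but
  enters only with an arbitrarily small factor.\<close>

lemma quantization_bound_continuous:
  assumes Q: "\<And>N. N \<ge> 2 \<Longrightarrow> is_quantization N (T N)" and N: "N \<ge> 2"
    and h: "continuous_on S2 h" and b: "\<And>x. x \<in> S2 \<Longrightarrow> \<bar>h x\<bar> \<le> c" and c: "0 \<le> c"
  shows "skew_norm N (T N h) \<le> sqrt (4 * pi) * c"
proof -
  note QN = Q[OF N]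
  obtain C where C: "\<And>f. f \<in> sphere_L2 \<Longrightarrow> skew_norm N (T N f) \<le> C * L2_norm f" using quantizationD(3)[OF QN] by blast
  have "skew_norm N (T N h) \<le> sqrt (4 * pi) * c + (sqrt (4 * pi) * (1 + \<bar>C\<bar>)) * e" if e: "e > 0" for e
  proof -
    obtain q where q: "rpoly q" "\<And>x. x \<in> S2 \<Longrightarrow> \<bar>h x - q x\<bar> < e"
      using Stone_Weierstrass_real_polynomial_function[OF compact_sphere h e] by blast
    have qc: "continuous_on S2 q" using q(1) by (rule rpoly_continuous_on)
    have hq: "(\<lambda>x. h x - q x) \<in> sphere_L2" by (intro continuous_sphere_L2 continuous_on_diff h qc)
    have qL: "q \<in> sphere_L2" "h \<in> sphere_L2" using qc h continuous_sphere_L2 by auto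
    have "T N h = T N q + T N (\<lambda>x. h x - q x)"
      using quantization_add[OF QN qL(1) hq] by simp
    then have "skew_norm N (T N h) \<le> skew_norm N (T N q) + skew_norm N (T N (\<lambda>x. h x - q x))"
      using skew_norm_triangle[OF quantizationD(1)[OF QN qL(1)] quantizationD(1)[OF QN hq]] quantizationD(1)[OF QN qL(2)] by simp
    also have "skew_norm N (T N q) \<le> L2_norm q" by (rule quantization_contraction_rpoly[OF Q N q(1)])
    also have "L2_norm q \<le> sqrt (4 * pi) * (c + e)"
    proof (rule L2_norm_bound[OF qc])
      fix x assume x: "x \<in> S2" show "\<bar>q x\<bar> \<le> c + e" using b[OF x] q(2)[OF x] by linarith
    qed (use c e in simp)
    also have "skew_norm N (T N (\<lambda>x. h x - q x)) \<le> \<bar>C\<bar> * (sqrt (4 * pi) * e)"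
    proof -
      have "skew_norm N (T N (\<lambda>x. h x - q x)) \<le> C * L2_norm (\<lambda>x. h x - q x)" by (rule C[OF hq])
      also have "\<dots> \<le> \<bar>C\<bar> * L2_norm (\<lambda>x. h x - q x)" by (intro mult_right_mono L2_norm_nonneg) auto
      also have "L2_norm (\<lambda>x. h x - q x) \<le> sqrt (4 * pi) * e"
        by (rule L2_norm_bound) (use q(2) e in \<open>auto intro!: continuous_intros h qc less_imp_le\<close>)
      finally show ?thesis by (simp add: mult_left_mono)
    qed
    finally show ?thesis by (simp add: algebra_simps)
  qed
  note E = this
  show ?thesis
  proof (rule field_le_epsilon)
    fix e :: real assume e: "e > 0"
    define k where "k = sqrt (4 * pi) * (1 + \<bar>C\<bar>)"
    have k: "k > 0" by (simp add: k_def)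
    show "skew_norm N (T N h) \<le> sqrt (4 * pi) * c + e"
      using E[of "e / k"] e k unfolding k_def[symmetric] by simp
  qed
qed

definition unitarily_diagonal :: "nat \<Rightarrow> complex mat \<Rightarrow> complex mat \<Rightarrow> (nat \<Rightarrow> real) \<Rightarrow> bool" where
  "unitarily_diagonal N A U l \<longleftrightarrow> unitary_mat N U \<and> A = U * mat_diag N (\<lambda>i. of_real (l i)) * mat_adjoint U"

lemma skew_unitarily_diagonal:
  assumes "W \<in> skew_herm N"
  shows "\<exists>U l. unitarily_diagonal N ((- \<i>) \<cdot>\<^sub>m W) U l"
proof -
  have W: "W \<in> carrier_mat N N" "mat_adjoint W = - W" using skew_hermD[OF assms] by auto
  have "mat_adjoint ((- \<i>) \<cdot>\<^sub>m W) = (- \<i>) \<cdot>\<^sub>m W"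
  proof (rule eq_matI)
    fix i j assume "i < dim_row ((- \<i>) \<cdot>\<^sub>m W)" "j < dim_col ((- \<i>) \<cdot>\<^sub>m W)"
    then have ij: "i < N" "j < N" using W by auto
    have "cnj (W $$ (j, i)) = mat_adjoint W $$ (i, j)" using W(1) ij by simp
    also have "\<dots> = - W $$ (i, j)" unfolding W(2) using W(1) ij by simp
    finally show "mat_adjoint ((- \<i>) \<cdot>\<^sub>m W) $$ (i, j) = ((- \<i>) \<cdot>\<^sub>m W) $$ (i, j)"
      using W(1) ij by simp
  qed (use W in auto)
  then show ?thesis using hermitian_diagonalization[of "(- \<i>) \<cdot>\<^sub>m W" N] W unfolding unitarily_diagonal_def by auto
qed

lemma integral_spectral_measure_skew:
  assumes W: "W \<in> carrier_mat N N" and s: "unitarily_diagonal N ((- \<i>) \<cdot>\<^sub>m W) U l" and g: "continuous_on UNIV (g :: real \<Rightarrow> real)"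
  shows "(\<integral>r. g r \<partial>empirical_spectral_measure W) = 4 * pi / real N * (\<Sum>i<N. g (l i))"
proof -
  have "\<i> \<cdot>\<^sub>m ((- \<i>) \<cdot>\<^sub>m W) = W" by (rule eq_matI) auto
  then show ?thesis
    using integral_empirical_spectral_measure[of N U "(- \<i>) \<cdot>\<^sub>m W" l g] s borel_measurable_continuous_onI[OF g]
    unfolding unitarily_diagonal_def by simp
qed

text \<open>The eigenvalue equation is evaluated at a largest entry of the eigenvector.\<close>

lemma eigenvalue_row_bound:
  assumes s: "unitarily_diagonal N A U l" and b: "row_bound N A C" and i: "i < N"
  shows "\<bar>l i\<bar> \<le> C"
proof -
  have U: "U \<in> carrier_mat N N" "mat_adjoint U * U = 1\<^sub>m N" "unitary_mat N U"
    and A: "A = U * mat_diag N (\<lambda>i. of_real (l i)) * mat_adjoint U"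
    using s by (auto simp: unitarily_diagonal_def unitary_mat_def)
  have Ac: "A \<in> carrier_mat N N" using U by (simp add: A)
  have "A * U = U * mat_diag N (\<lambda>i. of_real (l i)) * (mat_adjoint U * U)"
    using U(1) by (simp add: A assoc_mult_mat[of _ N N _ N _ N])
  then have AU: "A * U = U * mat_diag N (\<lambda>i. of_real (l i))" using U by simp
  have ev: "(\<Sum>k<N. A $$ (j, k) * U $$ (k, i)) = U $$ (j, i) * of_real (l i)" if "j < N" for j
    using mat_mult_index[OF Ac U(1) that i] diag_mult_index(2)[OF U(1) that i, of "\<lambda>i. of_real (l i)"] by (simp add: AU)
  let ?u = "(\<lambda>j. cmod (U $$ (j, i))) ` {..<N}"
  have "finite ?u" "?u \<noteq> {}" using i by auto
  from Max_in[OF this] Max_ge[OF this(1)]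
  obtain j where j: "j < N" "\<And>k. k < N \<Longrightarrow> cmod (U $$ (k, i)) \<le> cmod (U $$ (j, i))" by force
  have pos: "cmod (U $$ (j, i)) > 0"
  proof (rule ccontr)
    assume "\<not> cmod (U $$ (j, i)) > 0"
    then have "U $$ (k, i) = 0" if "k < N" for k using j(2)[OF that] by simp
    then have "(\<Sum>k<N. cnj (U $$ (k, i)) * U $$ (k, i)) = 0" by simp
    then show False using unitary_rows(2)[OF U(3) i i] by simp
  qed
  have "cmod (U $$ (j, i)) * \<bar>l i\<bar> = cmod (\<Sum>k<N. A $$ (j, k) * U $$ (k, i))"
    unfolding ev[OF j(1)] by (simp add: norm_mult)
  also have "\<dots> \<le> (\<Sum>k<N. cmod (A $$ (j, k)) * cmod (U $$ (k, i)))"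
    by (rule order_trans[OF norm_sum]) (simp add: norm_mult)
  also have "\<dots> \<le> (\<Sum>k<N. cmod (A $$ (j, k)) * cmod (U $$ (j, i)))"
    using j(2) by (intro sum_mono mult_left_mono) auto
  also have "\<dots> \<le> C * cmod (U $$ (j, i))"
    using b j(1) unfolding row_bound_def sum_distrib_right[symmetric] by (intro mult_right_mono) auto
  finally show ?thesis using pos by (simp add: mult.commute)
qed

lemma spectral_mean_bound:
  assumes "\<And>i. i < N \<Longrightarrow> \<bar>u i\<bar> \<le> c" "N \<ge> 1"
  shows "\<bar>4 * pi / real N * (\<Sum>i<N. u i)\<bar> \<le> 4 * pi * (c :: real)"
proof -
  have "\<bar>\<Sum>i<N. u i\<bar> \<le> (\<Sum>i<N. c)"
    using assms(1) by (intro order_trans[OF sum_abs] sum_mono) auto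
  then have "4 * pi / real N * \<bar>\<Sum>i<N. u i\<bar> \<le> 4 * pi / real N * (real N * c)"
    by (intro mult_left_mono) auto
  then show ?thesis using assms(2) by (simp add: abs_mult)
qed

lemma area_trace_pow_spec:
  assumes "unitarily_diagonal N A U l"
  shows "area_trace N (A ^\<^sub>m k) = of_real (4 * pi / real N * (\<Sum>i<N. l i ^ k))"
  using assms mat_trace_pow_hermitian[of N U A l k] unfolding unitarily_diagonal_def area_trace_def by simp

text \<open>The method of moments. The symbol of a power is the power of the symbol, so all moments of the
  spectral measures converge; the eigenvalues stay in a fixed interval, on which the test function
  is uniformly approximated by polynomials.\<close>

lemma has_symbol_spectral_convergence:
  assumes q: "has_symbol A p" and s: "\<And>N. N \<ge> 2 \<Longrightarrow> unitarily_diagonal N (A N) (U N) (l N)"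
    and g: "continuous_on UNIV (g :: real \<Rightarrow> real)"
  shows "(\<lambda>N. 4 * pi / real N * (\<Sum>i<N. g (l N i))) \<longlonglongrightarrow> (\<integral>x. g (p x) \<partial>sphere_area)"
proof (rule limit_by_approximation)
  fix e :: real assume e: "e > 0"
  obtain C where C: "\<forall>\<^sub>F N in sequentially. row_bound N (A N) C" using has_symbol_row_bound[OF q] by blast
  have pc: "continuous_on S2 p" by (rule rpoly_continuous_on[OF has_symbol_rpoly[OF q]])
  obtain M where M: "\<And>x. x \<in> S2 \<Longrightarrow> \<bar>p x\<bar> \<le> M"
    using continuous_on_compact_abs_bound[OF compact_sphere pc] by blast
  \<comment> \<open>both the eigenvalues, for large \<open>N\<close>, and the values of the symbol
    lie in the interval from \<open>-R\<close> to \<open>R\<close>\<close>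
  define R where "R = max C M"
  define d where "d = e / (4 * pi)"
  have d: "d > 0" using e by (simp add: d_def)
  have gc: "continuous_on {-R..R} g" using g continuous_on_subset by blast
  obtain h where h: "real_polynomial_function h" "\<And>x. x \<in> {-R..R} \<Longrightarrow> \<bar>g x - h x\<bar> < d"
    using Stone_Weierstrass_real_polynomial_function[OF compact_Icc gc d] by blast
  obtain a n where an: "h = (\<lambda>x. \<Sum>k\<le>n. a k * x ^ k)"
    using h(1) unfolding real_polynomial_function_iff_sum by blast
  have hc: "continuous_on S h" for S unfolding an by (intro continuous_intros)
  let ?t = "\<lambda>N. 4 * pi / real N * (\<Sum>i<N. h (l N i))"
  have pow: "(\<lambda>N. 4 * pi / real N * (\<Sum>i<N. l N i ^ k)) \<longlonglongrightarrow> (\<integral>x. p x ^ k \<partial>sphere_area)" for k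
  proof -
    have "(\<lambda>N. Re (area_trace N (A N ^\<^sub>m k))) \<longlonglongrightarrow> Re (of_real (\<integral>x. p x ^ k \<partial>sphere_area))"
      by (rule tendsto_Re[OF has_symbol_trace[OF has_symbol_pow[OF q]]])
    moreover have "\<forall>\<^sub>F N in sequentially. Re (area_trace N (A N ^\<^sub>m k)) = 4 * pi / real N * (\<Sum>i<N. l N i ^ k)"
      using eventually_ge_at_top[of 2] by eventually_elim (simp only: area_trace_pow_spec[OF s] Re_complex_of_real)
    ultimately show ?thesis by (simp add: Lim_transform_eventually)
  qed
  have "(\<lambda>N. \<Sum>k\<le>n. a k * (4 * pi / real N * (\<Sum>i<N. l N i ^ k))) \<longlonglongrightarrow> (\<Sum>k\<le>n. a k * (\<integral>x. p x ^ k \<partial>sphere_area))"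
    by (intro tendsto_sum tendsto_mult tendsto_const pow)
  moreover have "(\<Sum>k\<le>n. a k * (4 * pi / real N * (\<Sum>i<N. l N i ^ k))) = ?t N" for N
    unfolding an by (subst sum.swap) (simp add: sum_distrib_left sum_divide_distrib mult_ac)
  moreover have "(\<Sum>k\<le>n. a k * (\<integral>x. p x ^ k \<partial>sphere_area)) = (\<integral>x. h (p x) \<partial>sphere_area)"
    unfolding an
    by (subst Bochner_Integration.integral_sum) (auto intro!: sphere_integral(1) continuous_intros pc)
  ultimately have t: "?t \<longlonglongrightarrow> (\<integral>x. h (p x) \<partial>sphere_area)" by simp
  moreover have "\<forall>\<^sub>F N in sequentially. \<bar>4 * pi / real N * (\<Sum>i<N. g (l N i)) - ?t N\<bar> \<le> e"
    using C eventually_ge_at_top[of 2]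
  proof eventually_elim
    case (elim N)
    have "\<bar>4 * pi / real N * (\<Sum>i<N. g (l N i) - h (l N i))\<bar> \<le> 4 * pi * d"
    proof (rule spectral_mean_bound)
      fix i assume "i < N"
      then have "\<bar>l N i\<bar> \<le> C" by (rule eigenvalue_row_bound[OF s[OF elim(2)] elim(1)])
      then have "l N i \<in> {-R..R}" unfolding R_def by auto
      then show "\<bar>g (l N i) - h (l N i)\<bar> \<le> d" using h(2) less_imp_le by blast
    qed (use elim in simp)
    then show ?case by (simp add: d_def sum_subtractf right_diff_distrib diff_divide_distrib)
  qed
  moreover have "\<bar>(\<integral>x. g (p x) \<partial>sphere_area) - (\<integral>x. h (p x) \<partial>sphere_area)\<bar> \<le> e"
  proof -
    have gp: "continuous_on S2 (\<lambda>x. g (p x))" using continuous_on_compose2[OF g pc] by simp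
    have hp: "continuous_on S2 (\<lambda>x. h (p x))" using continuous_on_compose2[OF hc[of UNIV] pc] by simp
    have "\<bar>\<integral>x. g (p x) - h (p x) \<partial>sphere_area\<bar> \<le> 4 * pi * d"
    proof (rule sphere_integral_bound)
      fix x assume "x \<in> S2"
      then have "p x \<in> {-R..R}" using M[of x] unfolding R_def by auto
      then show "\<bar>g (p x) - h (p x)\<bar> \<le> d" using h(2) less_imp_le by blast
    qed (intro continuous_intros gp hp)
    then show ?thesis
      using sphere_integral(1)[OF gp] sphere_integral(1)[OF hp] by (simp add: d_def)
  qed
  ultimately show "\<exists>t L. t \<longlonglongrightarrow> L \<and> (\<forall>\<^sub>F N in sequentially. \<bar>4 * pi / real N * (\<Sum>i<N. g (l N i)) - t N\<bar> \<le> e)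
      \<and> \<bar>(\<integral>x. g (p x) \<partial>sphere_area) - L\<bar> \<le> e" by blast
qed

text \<open>Replacing the function by a polynomial that is uniformly close to it changes both sides by little:
  the spectral side by the contraction estimate and the Lipschitz comparison of spectra, uniformly
  in \<open>N\<close>.\<close>

lemma lipschitz_spectral_convergence:
  assumes Q: "\<And>N. N \<ge> 2 \<Longrightarrow> is_quantization N (T N)" and w: "continuous_on S2 \<omega>"
    and lip: "\<And>x y. \<bar>g x - g y\<bar> \<le> K * \<bar>x - y\<bar>" and K: "0 \<le> K"
  shows "(\<lambda>N. \<integral>r. g r \<partial>empirical_spectral_measure (T N \<omega>)) \<longlonglongrightarrow> (\<integral>x. g (\<omega> x) \<partial>sphere_area)"
proof (rule limit_by_approximation)
  fix e :: real assume e: "e > 0"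
  have gc: "continuous_on UNIV g"
  proof -
    have "K-lipschitz_on UNIV g" by (rule lipschitz_onI) (use lip K in \<open>auto simp: dist_real_def\<close>)
    then show ?thesis by (rule lipschitz_on_continuous_on)
  qed
  \<comment> \<open>\<open>K + 1\<close> instead of \<open>K\<close> because \<open>K\<close> may
    be zero\<close>
  define d where "d = e / (4 * pi * (K + 1))"
  have d: "d > 0" using e K by (simp add: d_def)
  have de: "4 * pi * (K * d) \<le> e"
  proof -
    have "4 * pi * (K * d) \<le> 4 * pi * ((K + 1) * d)" using d K by (intro mult_left_mono) auto
    also have "\<dots> = e" using K by (simp add: d_def)
    finally show ?thesis .
  qed
  obtain p where p: "rpoly p" "\<And>x. x \<in> S2 \<Longrightarrow> \<bar>\<omega> x - p x\<bar> < d"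
    using Stone_Weierstrass_real_polynomial_function[OF compact_sphere w d] by blast
  have pc: "continuous_on S2 p" using p(1) by (rule rpoly_continuous_on)
  have wL: "\<omega> \<in> sphere_L2" and pL: "p \<in> sphere_L2" using w pc continuous_sphere_L2 by auto
  have "\<forall>N. \<exists>U l. N \<ge> 2 \<longrightarrow> unitarily_diagonal N ((- \<i>) \<cdot>\<^sub>m T N p) U l"
    using skew_unitarily_diagonal quantizationD(1)[OF Q pL] by blast
  then obtain U l where s: "\<And>N. N \<ge> 2 \<Longrightarrow> unitarily_diagonal N ((- \<i>) \<cdot>\<^sub>m T N p) (U N) (l N)" by metis
  let ?t = "\<lambda>N. 4 * pi / real N * (\<Sum>i<N. g (l N i))"
  have "?t \<longlonglongrightarrow> (\<integral>x. g (p x) \<partial>sphere_area)"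
    by (rule has_symbol_spectral_convergence[OF has_symbol_quantized_poly[OF Q p(1)] s gc])
  moreover have "\<forall>\<^sub>F N in sequentially. \<bar>(\<integral>r. g r \<partial>empirical_spectral_measure (T N \<omega>)) - ?t N\<bar> \<le> e"
    using eventually_ge_at_top[of 2]
  proof eventually_elim
    case (elim N)
    note QN = Q[OF elim]
    obtain V m where V: "unitarily_diagonal N ((- \<i>) \<cdot>\<^sub>m T N \<omega>) V m" using skew_unitarily_diagonal[OF quantizationD(1)[OF QN wL]] by blast
    have wc: "T N \<omega> \<in> carrier_mat N N" and pcm: "T N p \<in> carrier_mat N N" using quantization_carrier[OF QN] wL pL by auto
    let ?D = "T N (\<lambda>x. \<omega> x - p x)"
    have DL: "(\<lambda>x. \<omega> x - p x) \<in> sphere_L2" by (intro continuous_sphere_L2 continuous_on_diff w pc)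
    have "(- \<i>) \<cdot>\<^sub>m T N \<omega> - (- \<i>) \<cdot>\<^sub>m T N p = (- \<i>) \<cdot>\<^sub>m ?D"
      unfolding quantization_diff[OF QN wL pL] using wc pcm by (auto intro!: eq_matI simp: algebra_simps)
    moreover have "frobenius_sq N ((- \<i>) \<cdot>\<^sub>m ?D) = frobenius_sq N ?D"
      using quantization_carrier[OF QN DL] by (auto simp: frobenius_sq_def norm_mult intro!: sum.cong)
    ultimately have "\<bar>(\<Sum>i<N. g (m i)) - (\<Sum>i<N. g (l N i))\<bar> \<le> K * sqrt (real N) * sqrt (frobenius_sq N ?D)"
      using spectral_sum_lipschitz[of N V "U N" "(- \<i>) \<cdot>\<^sub>m T N \<omega>" m "(- \<i>) \<cdot>\<^sub>m T N p" "l N" g K] V s[OF elim] lip K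
      unfolding unitarily_diagonal_def by metis
    then have "4 * pi / real N * \<bar>(\<Sum>i<N. g (m i)) - (\<Sum>i<N. g (l N i))\<bar> \<le> 4 * pi / real N * (K * sqrt (real N) * sqrt (frobenius_sq N ?D))"
      by (intro mult_left_mono) auto
    also have "\<dots> = K * sqrt (4 * pi) * skew_norm N ?D"
    proof -
      have "sqrt (4 * pi / real N) = sqrt (4 * pi) / sqrt (real N)" by (rule real_sqrt_divide)
      moreover have "sqrt (4 * pi) * sqrt (4 * pi) = 4 * pi" "sqrt (real N) * sqrt (real N) = real N" by simp_all
      moreover have "sqrt (real N) > 0" using elim by simp
      ultimately have a: "4 * pi / real N * sqrt (real N) = sqrt (4 * pi) * sqrt (4 * pi / real N)"
        by (metis (no_types, lifting) divide_divide_eq_left nonzero_mult_div_cancel_right less_irrefl times_divide_eq_left times_divide_eq_right)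
      have "4 * pi / real N * (K * sqrt (real N) * sqrt (frobenius_sq N ?D)) = K * (4 * pi / real N * sqrt (real N)) * sqrt (frobenius_sq N ?D)"
        by (simp only: mult_ac)
      then show ?thesis unfolding skew_norm_frobenius[OF quantizationD(1)[OF QN DL]] a by (simp only: mult.assoc)
    qed
    also have "\<dots> \<le> K * sqrt (4 * pi) * (sqrt (4 * pi) * d)"
    proof (intro mult_left_mono quantization_bound_continuous[OF Q elim])
      show "continuous_on S2 (\<lambda>x. \<omega> x - p x)" by (intro continuous_intros w pc)
      show "\<bar>\<omega> x - p x\<bar> \<le> d" if "x \<in> S2" for x using p(2)[OF that] by simp
    qed (use d K in auto)
    also have "\<dots> = 4 * pi * (K * d)" using real_sqrt_mult_self[of "4 * pi"] by (simp only: mult_ac) simp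
    also have "\<dots> \<le> e" by (rule de)
    finally have "\<bar>4 * pi / real N * ((\<Sum>i<N. g (m i)) - (\<Sum>i<N. g (l N i)))\<bar> \<le> e"
      by (simp add: abs_mult)
    then show ?case unfolding integral_spectral_measure_skew[OF wc V gc] by (simp only: right_diff_distrib)
  qed
  moreover have "\<bar>(\<integral>x. g (\<omega> x) \<partial>sphere_area) - (\<integral>x. g (p x) \<partial>sphere_area)\<bar> \<le> e"
  proof -
    have gp: "continuous_on S2 (\<lambda>x. g (p x))" using continuous_on_compose2[OF gc pc] by simp
    have gw: "continuous_on S2 (\<lambda>x. g (\<omega> x))" using continuous_on_compose2[OF gc w] by simp
    have "\<bar>\<integral>x. g (\<omega> x) - g (p x) \<partial>sphere_area\<bar> \<le> 4 * pi * (K * d)"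
    proof (rule sphere_integral_bound)
      fix x assume "x \<in> S2"
      then have "K * \<bar>\<omega> x - p x\<bar> \<le> K * d" using p(2)[of x] K by (intro mult_left_mono) auto
      then show "\<bar>g (\<omega> x) - g (p x)\<bar> \<le> K * d" using lip order_trans by blast
    qed (intro continuous_intros gp gw)
    then show ?thesis
      using sphere_integral(1)[OF gp] sphere_integral(1)[OF gw] de by simp
  qed
  ultimately show "\<exists>t L. t \<longlonglongrightarrow> L \<and> (\<forall>\<^sub>F N in sequentially. \<bar>(\<integral>r. g r \<partial>empirical_spectral_measure (T N \<omega>)) - t N\<bar> \<le> e)
      \<and> \<bar>(\<integral>x. g (\<omega> x) \<partial>sphere_area) - L\<bar> \<le> e" by blast
qed

lemma clamped_polynomial_lipschitz:
  assumes h: "real_polynomial_function (h :: real \<Rightarrow> real)" and R: "0 \<le> R"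
  shows "\<exists>K\<ge>0. \<forall>x y. \<bar>h (max (- R) (min R x)) - h (max (- R) (min R y))\<bar> \<le> K * \<bar>x - y\<bar>"
proof -
  obtain a n where an: "h = (\<lambda>x. \<Sum>k\<le>n. a k * x ^ k)" using h unfolding real_polynomial_function_iff_sum by blast
  define h' where "h' x = (\<Sum>k\<le>n. a k * (real k * x ^ (k - 1)))" for x
  have der: "(h has_real_derivative h' x) (at x within S)" for x S
    unfolding an h'_def by (auto intro!: derivative_eq_intros sum.cong)
  have "continuous_on {-R..R} h'" unfolding h'_def by (intro continuous_intros)
  then obtain B where B: "\<And>x. x \<in> {-R..R} \<Longrightarrow> \<bar>h' x\<bar> \<le> B"
    using continuous_on_compact_abs_bound[OF compact_Icc] by blast
  let ?c = "\<lambda>x. max (- R) (min R x)"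
  have "\<bar>h (?c x) - h (?c y)\<bar> \<le> \<bar>B\<bar> * \<bar>x - y\<bar>" for x y
  proof -
    have "norm (h (?c x) - h (?c y)) \<le> \<bar>B\<bar> * norm (?c x - ?c y)"
    proof (rule field_differentiable_bound[where S="{-R..R}" and f'=h'])
      show "norm (h' z) \<le> \<bar>B\<bar>" if "z \<in> {-R..R}" for z using B[OF that] by simp
    qed (use R der in auto)
    also have "\<dots> \<le> \<bar>B\<bar> * \<bar>x - y\<bar>" by (intro mult_left_mono) auto
    finally show ?thesis by simp
  qed
  then show ?thesis by (intro exI[of _ "\<bar>B\<bar>"]) simp
qed

text \<open>On an interval slightly larger than the range of the function the test function is approximated by
  a polynomial, which is made Lipschitz by clamping its argument. The error outside the interval is
  controlled by a Lipschitz cut-off whose average tends to zero, as the function takes no values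
  there.\<close>

lemma continuous_spectral_convergence:
  assumes Q: "\<And>N. N \<ge> 2 \<Longrightarrow> is_quantization N (T N)" and w: "continuous_on S2 \<omega>"
    and f: "continuous_on UNIV (f :: real \<Rightarrow> real)" and bf: "\<And>x. \<bar>f x\<bar> \<le> B"
  shows "(\<lambda>N. \<integral>r. f r \<partial>empirical_spectral_measure (T N \<omega>)) \<longlonglongrightarrow> (\<integral>x. f (\<omega> x) \<partial>sphere_area)"
proof (rule limit_by_approximation)
  fix e :: real assume e: "e > 0"
  have B0: "0 \<le> B" using bf[of 0] by linarith
  obtain M where M: "\<And>x. x \<in> S2 \<Longrightarrow> \<bar>\<omega> x\<bar> \<le> M"
    using continuous_on_compact_abs_bound[OF compact_sphere w] by blast
  have M0: "0 \<le> M" using M[of "axis 1 1"] by (simp add: abs_le_iff) 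
  define R where "R = M + 1"
  define d where "d = min 1 (e / (8 * pi))"
  have d: "d > 0" "d \<le> 1" "4 * pi * d \<le> e / 2"
  proof -
    show "d > 0" "d \<le> 1" using e by (simp_all add: d_def)
    have "4 * pi * d \<le> 4 * pi * (e / (8 * pi))" by (intro mult_left_mono) (auto simp: d_def)
    then show "4 * pi * d \<le> e / 2" by simp
  qed
  have fc: "continuous_on {-R..R} f" using f continuous_on_subset by blast
  obtain h where h: "real_polynomial_function h" "\<And>x. x \<in> {-R..R} \<Longrightarrow> \<bar>f x - h x\<bar> < d"
    using Stone_Weierstrass_real_polynomial_function[OF compact_Icc fc d(1)] by blast
  let ?c = "\<lambda>x. max (- R) (min R x)"
  have R0: "0 \<le> R" using M0 by (simp add: R_def)
  obtain K where K: "K \<ge> 0" "\<And>x y. \<bar>h (?c x) - h (?c y)\<bar> \<le> K * \<bar>x - y\<bar>"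
    using clamped_polynomial_lipschitz[OF h(1) R0] by blast
  \<comment> \<open>vanishes on the range of \<open>\<omega>\<close> and is \<open>1\<close>
    outside the interval from \<open>-R\<close> to \<open>R\<close>\<close>
  define cut where "cut x = min 1 (max 0 (\<bar>x\<bar> - M))" for x :: real
  have chi: "\<bar>cut x - cut y\<bar> \<le> 1 * \<bar>x - y\<bar>" for x y by (auto simp: cut_def min_def max_def)
  have fg: "\<bar>f x - h (?c x)\<bar> \<le> d + (2 * B + 1) * cut x" for x
  proof (cases "\<bar>x\<bar> \<le> R")
    case True
    then have "?c x = x" "x \<in> {-R..R}" by auto
    moreover have "(2 * B + 1) * cut x \<ge> 0" using B0 by (intro mult_nonneg_nonneg) (auto simp: cut_def)
    ultimately show ?thesis using h(2)[of x] by simp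
  next
    case False
    then have "cut x = 1" by (simp add: cut_def R_def)
    define y where "y = ?c x"
    have "y \<in> {-R..R}" using R0 by (auto simp: y_def)
    then have "\<bar>f y - h y\<bar> < d" by (rule h(2))
    moreover have "\<bar>f x - h y\<bar> \<le> \<bar>f x\<bar> + \<bar>f y\<bar> + \<bar>f y - h y\<bar>" by simp
    ultimately have "\<bar>f x - h y\<bar> \<le> d + (2 * B + 1) * 1" using bf[of x] bf[of y] by simp
    then have "\<bar>f x - h (?c x)\<bar> \<le> d + (2 * B + 1) * 1" unfolding y_def .
    then show ?thesis using \<open>cut x = 1\<close> by simp
  qed
  have gc: "continuous_on UNIV (\<lambda>x. h (?c x))" 
  proof -
    have "continuous_on UNIV h"
      using h(1) unfolding real_polynomial_function_iff_sum by (auto intro!: continuous_intros)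
    moreover have "continuous_on UNIV ?c" by (intro continuous_intros)
    ultimately show ?thesis using continuous_on_compose2[of UNIV h UNIV ?c] by simp
  qed
  have chic: "continuous_on UNIV cut" unfolding cut_def by (intro continuous_intros)
  have gl: "(\<lambda>N. \<integral>r. h (?c r) \<partial>empirical_spectral_measure (T N \<omega>)) \<longlonglongrightarrow> (\<integral>x. h (?c (\<omega> x)) \<partial>sphere_area)"
    by (rule lipschitz_spectral_convergence[OF Q w K(2) K(1)])
  have "(\<lambda>N. \<integral>r. cut r \<partial>empirical_spectral_measure (T N \<omega>)) \<longlonglongrightarrow> (\<integral>x. cut (\<omega> x) \<partial>sphere_area)"
    by (rule lipschitz_spectral_convergence[OF Q w chi zero_le_one])
  also have "(\<integral>x. cut (\<omega> x) \<partial>sphere_area) = (\<integral>x. 0 \<partial>sphere_area)"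
    by (rule Bochner_Integration.integral_cong) (use M in \<open>auto simp: cut_def\<close>)
  finally have "(\<lambda>N. (2 * B + 1) * (\<integral>r. cut r \<partial>empirical_spectral_measure (T N \<omega>))) \<longlonglongrightarrow> (2 * B + 1) * 0"
    by (intro tendsto_mult_left) simp
  then have tail: "\<forall>\<^sub>F N in sequentially. (2 * B + 1) * (\<integral>r. cut r \<partial>empirical_spectral_measure (T N \<omega>)) < e / 2"
    using e by (intro order_tendstoD(2)) auto
  have wL: "\<omega> \<in> sphere_L2" using w by (rule continuous_sphere_L2)
  have "\<forall>\<^sub>F N in sequentially. \<bar>(\<integral>r. f r \<partial>empirical_spectral_measure (T N \<omega>)) - (\<integral>r. h (?c r) \<partial>empirical_spectral_measure (T N \<omega>))\<bar> \<le> e"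
    using tail eventually_ge_at_top[of 2]
  proof eventually_elim
    case (elim N)
    note QN = Q[OF elim(2)]
    obtain V m where V: "unitarily_diagonal N ((- \<i>) \<cdot>\<^sub>m T N \<omega>) V m" using skew_unitarily_diagonal[OF quantizationD(1)[OF QN wL]] by blast
    note S = integral_spectral_measure_skew[OF quantization_carrier[OF QN wL] V]
    have "\<bar>(\<Sum>i<N. f (m i)) - (\<Sum>i<N. h (?c (m i)))\<bar> \<le> (\<Sum>i<N. d + (2 * B + 1) * cut (m i))"
      unfolding sum_subtractf[symmetric] by (rule order_trans[OF sum_abs]) (intro sum_mono fg)
    then have "4 * pi / real N * \<bar>(\<Sum>i<N. f (m i)) - (\<Sum>i<N. h (?c (m i)))\<bar> \<le> 4 * pi / real N * (\<Sum>i<N. d + (2 * B + 1) * cut (m i))"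
      by (intro mult_left_mono) auto
    also have "\<dots> = 4 * pi * d + (2 * B + 1) * (4 * pi / real N * (\<Sum>i<N. cut (m i)))"
      using elim(2) by (simp add: sum.distrib distrib_left flip: sum_distrib_left)
    also have "\<dots> \<le> e / 2 + e / 2" using elim(1) d(3) unfolding S[OF chic] by linarith
    finally have "\<bar>4 * pi / real N * ((\<Sum>i<N. f (m i)) - (\<Sum>i<N. h (?c (m i))))\<bar> \<le> e" by (simp add: abs_mult)
    then show ?case unfolding S[OF f] S[OF gc] by (simp only: right_diff_distrib)
  qed
  moreover have "\<bar>(\<integral>x. f (\<omega> x) \<partial>sphere_area) - (\<integral>x. h (?c (\<omega> x)) \<partial>sphere_area)\<bar> \<le> e"
  proof -
    have fw: "continuous_on S2 (\<lambda>x. f (\<omega> x))" using continuous_on_compose2[OF f w] by simp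
    have gw: "continuous_on S2 (\<lambda>x. h (?c (\<omega> x)))" using continuous_on_compose2[OF gc w] by simp
    have "\<bar>\<integral>x. f (\<omega> x) - h (?c (\<omega> x)) \<partial>sphere_area\<bar> \<le> 4 * pi * d"
    proof (rule sphere_integral_bound)
      fix x assume "x \<in> S2"
      then have "cut (\<omega> x) = 0" using M[of x] by (simp add: cut_def)
      then show "\<bar>f (\<omega> x) - h (?c (\<omega> x))\<bar> \<le> d" using fg[of "\<omega> x"] by simp
    qed (intro continuous_on_diff fw gw)
    then show ?thesis
      using sphere_integral(1)[OF fw] sphere_integral(1)[OF gw] d(3) e by simp
  qed
  ultimately show "\<exists>t L. t \<longlonglongrightarrow> L \<and> (\<forall>\<^sub>F N in sequentially. \<bar>(\<integral>r. f r \<partial>empirical_spectral_measure (T N \<omega>)) - t N\<bar> \<le> e)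
      \<and> \<bar>(\<integral>x. f (\<omega> x) \<partial>sphere_area) - L\<bar> \<le> e" using gl by blast
qed

lemma Ck_sphere_continuous: "Ck_sphere k f \<Longrightarrow> continuous_on S2 f"
proof -
  assume "Ck_sphere k f"
  then obtain U g where g: "S2 \<subseteq> U" "Ck_on k U g" "\<forall>x\<in>S2. f x = g x" unfolding Ck_sphere_def by blast
  have "continuous_on U g" using g(2) by (cases k) (auto intro: differentiable_imp_continuous_on)
  then show ?thesis using g continuous_on_subset continuous_on_cong by metis
qed

theorem theorem6:
  fixes \<omega> :: "real^3 \<Rightarrow> real" and T :: "nat \<Rightarrow> (real^3 \<Rightarrow> real) \<Rightarrow> complex mat"
  assumes "\<And>N. N \<ge> 2 \<Longrightarrow> is_quantization N (T N)"
    and "Ck_sphere 2 \<omega>"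
  shows "\<forall>f :: real \<Rightarrow> real. continuous_on UNIV f \<and> bounded (range f) \<longrightarrow>
    (\<lambda>N. \<integral>r. f r \<partial>empirical_spectral_measure (T N \<omega>))
      \<longlonglongrightarrow> (\<integral>r. f r \<partial>level_set_measure \<omega>)"
proof (intro allI impI)
  fix f :: "real \<Rightarrow> real" assume f: "continuous_on UNIV f \<and> bounded (range f)"
  have w: "continuous_on S2 \<omega>" by (rule Ck_sphere_continuous[OF assms(2)])
  obtain B where B: "\<And>x. \<bar>f x\<bar> \<le> B" using f unfolding bounded_iff by auto
  have "(\<integral>r. f r \<partial>level_set_measure \<omega>) = (\<integral>x. f (\<omega> x) \<partial>sphere_area)"
    unfolding level_set_measure_def
    by (rule integral_distr[OF continuous_measurable_sphere[OF w]]) (use f in \<open>auto intro: borel_measurable_continuous_onI\<close>)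
  then show "(\<lambda>N. \<integral>r. f r \<partial>empirical_spectral_measure (T N \<omega>)) \<longlonglongrightarrow> (\<integral>r. f r \<partial>level_set_measure \<omega>)"
    using continuous_spectral_convergence[OF assms(1) w conjunct1[OF f] B] by (simp only:)
qed

end
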